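(* Let $R$ be a commutative noetherian ring and let $M$ be a finitely generated $R$-module. Let $\boldsymbol{x}=x_1,\dots,x_n$ be a sequence of elements of $R$ such that $x_p\operatorname{Ext}_R^q(M,\Omega^rM)=0$ for all $1\le p\le n$ and $1\le q,r\le p$. Let $P=(\cdots\to P_1\to P_0\to0)$ be a projective resolution of $M$ (by finitely generated projective modules). Then the Koszul complex $K(\boldsymbol{x},M)$ is equivalent to a complex $$X=(0 \to X_n \to X_{n-1} \to \cdots \to X_1 \to X_0 \to 0)$$ such that $X_i=\bigoplus_{j=0}^i P_j^{\oplus\binom{n}{i-j}}$ for each $0\le i\le n-1$ and $X_n=\bigoplus_{j=0}^n(\Omega^jM)^{\oplus\binom{n}{j}}$.
   Context: For a projective resolution $P=(\cdots\xrightarrow{d_2}P_1\xrightarrow{d_1}P_0\to0)$ of $M$ and $j>0$, the $j$-th syzygy $\Omega^jM$ is the image of $d_j$ (with respect to $P$), and $\Omega^0M=M$. $K(\boldsymbol{x},M)=K(\boldsymbol{x},R)\otimes_RM$ is the Koszul complex. Complexes are graded homologically, with $X_i$ in degree $i$. Two complexes $X,Y$ are equivalent if there is a finite sequence of complexes $X=X^0,X^1,\dots,X^m=Y$ with a quasi-isomorphism (in one direction or the other) between $X^i$ and $X^{i+1}$ for each $i$. *)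

theory Defs
  imports "HOL-Algebra.Module" "HOL-Algebra.Ring_Divisibility"
begin

section \<open>Modules over a commutative ring\<close>

text \<open>
  The record of modules extends the record of rings, so that a module carries two
  fields that play no role (the ring product and unit).
\<close>

definition mod_hom ::
    "('a, 'r) ring_scheme \<Rightarrow> ('a, 'b) module \<Rightarrow> ('a, 'c) module \<Rightarrow> ('b \<Rightarrow> 'c) set" where
  "mod_hom R M N = {f \<in> carrier M \<rightarrow> carrier N.
      (\<forall>x\<in>carrier M. \<forall>y\<in>carrier M. f (x \<oplus>\<^bsub>M\<^esub> y) = f x \<oplus>\<^bsub>N\<^esub> f y) \<and>
      (\<forall>r\<in>carrier R. \<forall>x\<in>carrier M. f (r \<odot>\<^bsub>M\<^esub> x) = r \<odot>\<^bsub>N\<^esub> f x)}"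

definition zero_module :: "('a, 'b) module \<Rightarrow> bool" where
  "zero_module M \<longleftrightarrow> carrier M = {\<zero>\<^bsub>M\<^esub>}"

definition mod_ker :: "('a, 'b) module \<Rightarrow> ('a, 'c) module \<Rightarrow> ('b \<Rightarrow> 'c) \<Rightarrow> 'b set" where
  "mod_ker M N f = {x \<in> carrier M. f x = \<zero>\<^bsub>N\<^esub>}"

definition submodule_generated ::
    "('a, 'r) ring_scheme \<Rightarrow> ('a, 'b) module \<Rightarrow> 'b set \<Rightarrow> 'b set" where
  "submodule_generated R M S = \<Inter>{H. submodule H R M \<and> S \<subseteq> H}"

definition fg_module :: "('a, 'r) ring_scheme \<Rightarrow> ('a, 'b) module \<Rightarrow> bool" where
  "fg_module R M \<longleftrightarrow>
     (\<exists>S\<subseteq>carrier M. finite S \<and> submodule_generated R M S = carrier M)"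

text \<open>The quotient \<open>M/N\<close>; its elements are the cosets of \<open>N\<close>, and
  \<open>r \<odot> (N + a) = N + r \<odot> a\<close>.\<close>

definition quot_module :: "('a, 'b) module \<Rightarrow> 'b set \<Rightarrow> ('a, 'b set) module" where
  "quot_module M N =
     \<lparr>carrier = a_rcosets\<^bsub>M\<^esub> N, monoid.mult = undefined, monoid.one = undefined,
      ring.zero = N, ring.add = (\<lambda>A B. A <+>\<^bsub>M\<^esub> B),
      smult = (\<lambda>r A. \<Union>a\<in>A. N +>\<^bsub>M\<^esub> (r \<odot>\<^bsub>M\<^esub> a))\<rparr>"

definition direct_sum :: "'i set \<Rightarrow> ('i \<Rightarrow> ('a, 'b) module) \<Rightarrow> ('a, 'i \<Rightarrow> 'b) module" where
  "direct_sum I M =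
     \<lparr>carrier = {f \<in> (\<Pi>\<^sub>E i\<in>I. carrier (M i)). finite {i \<in> I. f i \<noteq> \<zero>\<^bsub>M i\<^esub>}},
      monoid.mult = undefined, monoid.one = undefined,
      ring.zero = (\<lambda>i\<in>I. \<zero>\<^bsub>M i\<^esub>),
      ring.add = (\<lambda>f g. \<lambda>i\<in>I. f i \<oplus>\<^bsub>M i\<^esub> g i),
      smult = (\<lambda>r f. \<lambda>i\<in>I. r \<odot>\<^bsub>M i\<^esub> f i)\<rparr>"

definition self_module :: "('a, 'r) ring_scheme \<Rightarrow> ('a, 'a) module" where
  "self_module R =
     \<lparr>carrier = carrier R, monoid.mult = undefined, monoid.one = undefined,
      ring.zero = \<zero>\<^bsub>R\<^esub>, ring.add = (\<lambda>a b. a \<oplus>\<^bsub>R\<^esub> b), smult = (\<lambda>a b. a \<otimes>\<^bsub>R\<^esub> b)\<rparr>"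

definition free_module :: "('a, 'r) ring_scheme \<Rightarrow> 'i set \<Rightarrow> ('a, 'i \<Rightarrow> 'a) module" where
  "free_module R I = direct_sum I (\<lambda>_. self_module R)"

definition free_basis :: "('a, 'r) ring_scheme \<Rightarrow> 'i set \<Rightarrow> 'i \<Rightarrow> 'i \<Rightarrow> 'a" where
  "free_basis R I i = (\<lambda>j\<in>I. if j = i then \<one>\<^bsub>R\<^esub> else \<zero>\<^bsub>R\<^esub>)"

text \<open>
  A module is projective if it is a direct summand (a retract) of a free module. The index
  set may be taken of the type of the elements of the module itself: if \<open>P\<close> is a summand of
  any free module, then it is one of the free module on the set \<open>carrier P\<close>.
\<close>

definition projective_module :: "('a, 'r) ring_scheme \<Rightarrow> ('a, 'b) module \<Rightarrow> bool" where
  "projective_module R P \<longleftrightarrow> module R P \<and>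
     (\<exists>(I :: 'b set) s p. s \<in> mod_hom R P (free_module R I) \<and>
        p \<in> mod_hom R (free_module R I) P \<and> (\<forall>x\<in>carrier P. p (s x) = x))"

text \<open>The module \<open>Hom\<^sub>R(M, N)\<close>; homomorphisms are made undefined outside \<open>carrier M\<close>
  in order to have equality of maps on \<open>carrier M\<close> coincide with equality of functions.\<close>

definition hom_module ::
    "('a, 'r) ring_scheme \<Rightarrow> ('a, 'b) module \<Rightarrow> ('a, 'c) module \<Rightarrow> ('a, 'b \<Rightarrow> 'c) module" where
  "hom_module R M N =
     \<lparr>carrier = mod_hom R M N \<inter> extensional (carrier M),
      monoid.mult = undefined, monoid.one = undefined,
      ring.zero = (\<lambda>x\<in>carrier M. \<zero>\<^bsub>N\<^esub>),
      ring.add = (\<lambda>f g. \<lambda>x\<in>carrier M. f x \<oplus>\<^bsub>N\<^esub> g x),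
      smult = (\<lambda>r f. \<lambda>x\<in>carrier M. r \<odot>\<^bsub>N\<^esub> f x)\<rparr>"


section \<open>Tensor products\<close>

definition tensor_free ::
    "('a, 'r) ring_scheme \<Rightarrow> ('a, 'b) module \<Rightarrow> ('a, 'c) module \<Rightarrow> ('a, 'b \<times> 'c \<Rightarrow> 'a) module"
  where "tensor_free R M N = free_module R (carrier M \<times> carrier N)"

definition pure_sym ::
    "('a, 'r) ring_scheme \<Rightarrow> ('a, 'b) module \<Rightarrow> ('a, 'c) module \<Rightarrow> 'b \<Rightarrow> 'c \<Rightarrow> 'b \<times> 'c \<Rightarrow> 'a"
  where "pure_sym R M N x y = free_basis R (carrier M \<times> carrier N) (x, y)"

definition tensor_rel ::
    "('a, 'r) ring_scheme \<Rightarrow> ('a, 'b) module \<Rightarrow> ('a, 'c) module \<Rightarrow> ('b \<times> 'c \<Rightarrow> 'a) set" where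
  "tensor_rel R M N =
     (let F = tensor_free R M N; e = pure_sym R M N in
      submodule_generated R F
       ({e (x \<oplus>\<^bsub>M\<^esub> x') y \<ominus>\<^bsub>F\<^esub> (e x y \<oplus>\<^bsub>F\<^esub> e x' y) | x x' y.
           x \<in> carrier M \<and> x' \<in> carrier M \<and> y \<in> carrier N} \<union>
        {e x (y \<oplus>\<^bsub>N\<^esub> y') \<ominus>\<^bsub>F\<^esub> (e x y \<oplus>\<^bsub>F\<^esub> e x y') | x y y'.
           x \<in> carrier M \<and> y \<in> carrier N \<and> y' \<in> carrier N} \<union>
        {e (r \<odot>\<^bsub>M\<^esub> x) y \<ominus>\<^bsub>F\<^esub> (r \<odot>\<^bsub>F\<^esub> e x y) | r x y.
           r \<in> carrier R \<and> x \<in> carrier M \<and> y \<in> carrier N} \<union>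
        {e x (r \<odot>\<^bsub>N\<^esub> y) \<ominus>\<^bsub>F\<^esub> (r \<odot>\<^bsub>F\<^esub> e x y) | r x y.
           r \<in> carrier R \<and> x \<in> carrier M \<and> y \<in> carrier N}))"

definition tensor_module ::
    "('a, 'r) ring_scheme \<Rightarrow> ('a, 'b) module \<Rightarrow> ('a, 'c) module \<Rightarrow> ('a, ('b \<times> 'c \<Rightarrow> 'a) set) module"
  where "tensor_module R M N = quot_module (tensor_free R M N) (tensor_rel R M N)"

text \<open>The map \<open>f \<otimes> N\<close> from \<open>M \<otimes> N\<close> to \<open>M' \<otimes> N\<close>, given on cosets through the linear
  extension of \<open>(x, y) \<mapsto> (f x, y)\<close> to the free modules.\<close>

definition tensor_map ::
    "('a, 'r) ring_scheme \<Rightarrow> ('a, 'b) module \<Rightarrow> ('a, 'd) module \<Rightarrow> ('a, 'c) module \<Rightarrow>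
     ('b \<Rightarrow> 'd) \<Rightarrow> ('b \<times> 'c \<Rightarrow> 'a) set \<Rightarrow> ('d \<times> 'c \<Rightarrow> 'a) set" where
  "tensor_map R M M' N f A =
     (let F = tensor_free R M' N in
      \<Union>\<phi>\<in>A. tensor_rel R M' N +>\<^bsub>F\<^esub>
        (\<Oplus>\<^bsub>F\<^esub>p\<in>{p \<in> carrier M \<times> carrier N. \<phi> p \<noteq> \<zero>\<^bsub>R\<^esub>}.
           \<phi> p \<odot>\<^bsub>F\<^esub> pure_sym R M' N (f (fst p)) (snd p)))"


section \<open>Complexes\<close>

text \<open>Homological grading by the integers: \<open>diff C i\<close> maps \<open>obj C i\<close> to \<open>obj C (i - 1)\<close>.\<close>

record ('a, 'b) cplx =
  obj :: "int \<Rightarrow> ('a, 'b) module"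
  diff :: "int \<Rightarrow> 'b \<Rightarrow> 'b"

definition chain_complex :: "('a, 'r) ring_scheme \<Rightarrow> ('a, 'b) cplx \<Rightarrow> bool" where
  "chain_complex R C \<longleftrightarrow>
     (\<forall>i. module R (obj C i)) \<and>
     (\<forall>i. diff C i \<in> mod_hom R (obj C i) (obj C (i - 1))) \<and>
     (\<forall>i. \<forall>x\<in>carrier (obj C i). diff C (i - 1) (diff C i x) = \<zero>\<^bsub>obj C (i - 2)\<^esub>)"

definition cycles :: "('a, 'b) cplx \<Rightarrow> int \<Rightarrow> 'b set" where
  "cycles C i = mod_ker (obj C i) (obj C (i - 1)) (diff C i)"

definition boundaries :: "('a, 'b) cplx \<Rightarrow> int \<Rightarrow> 'b set" where
  "boundaries C i = diff C (i + 1) ` carrier (obj C (i + 1))"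

definition homology :: "('a, 'b) cplx \<Rightarrow> int \<Rightarrow> ('a, 'b set) module" where
  "homology C i = quot_module ((obj C i)\<lparr>carrier := cycles C i\<rparr>) (boundaries C i)"

definition chain_map ::
    "('a, 'r) ring_scheme \<Rightarrow> ('a, 'b) cplx \<Rightarrow> ('a, 'c) cplx \<Rightarrow> (int \<Rightarrow> 'b \<Rightarrow> 'c) \<Rightarrow> bool" where
  "chain_map R C D f \<longleftrightarrow>
     chain_complex R C \<and> chain_complex R D \<and>
     (\<forall>i. f i \<in> mod_hom R (obj C i) (obj D i)) \<and>
     (\<forall>i. \<forall>x\<in>carrier (obj C i). f (i - 1) (diff C i x) = diff D i (f i x))"

definition homology_map ::
    "('a, 'c) cplx \<Rightarrow> (int \<Rightarrow> 'b \<Rightarrow> 'c) \<Rightarrow> int \<Rightarrow> 'b set \<Rightarrow> 'c set" where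
  "homology_map D f i A = (\<Union>a\<in>A. boundaries D i +>\<^bsub>obj D i\<^esub> f i a)"

definition quasi_iso ::
    "('a, 'r) ring_scheme \<Rightarrow> ('a, 'b) cplx \<Rightarrow> ('a, 'c) cplx \<Rightarrow> (int \<Rightarrow> 'b \<Rightarrow> 'c) \<Rightarrow> bool" where
  "quasi_iso R C D f \<longleftrightarrow> chain_map R C D f \<and>
     (\<forall>i. bij_betw (homology_map D f i) (carrier (homology C i)) (carrier (homology D i)))"

definition quasi_linked ::
    "('a, 'r) ring_scheme \<Rightarrow> ('a, 'b) cplx \<Rightarrow> ('a, 'c) cplx \<Rightarrow> bool" where
  "quasi_linked R C D \<longleftrightarrow> (\<exists>f. quasi_iso R C D f) \<or> (\<exists>g. quasi_iso R D C g)"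

text \<open>
  Equivalence of complexes: a finite sequence of quasi-isomorphisms, in either direction, from
  \<open>C\<close> to \<open>D\<close>. The first disjunct is the sequence with no complex strictly between \<open>C\<close> and \<open>D\<close>;
  in the second, \<open>Z\<close> and \<open>W\<close> are the first and the last such complex (possibly equal).
  As \<open>C\<close> and \<open>D\<close> may have elements of different types, a type has to be fixed for the elements
  of the complexes in between. Lists over \<open>'a + 'b + 'c\<close> are no restriction: whenever \<open>C\<close> and
  \<open>D\<close> are equivalent there are quasi-isomorphisms to both of them from one semifree
  resolution of \<open>C\<close>, which can be chosen of cardinality at most that of this type.
\<close>

definition equivalent ::
    "('a, 'r) ring_scheme \<Rightarrow> ('a, 'b) cplx \<Rightarrow> ('a, 'c) cplx \<Rightarrow> bool" where
  "equivalent R C D \<longleftrightarrow> quasi_linked R C D \<or>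
     (\<exists>Z W :: ('a, ('a + 'b + 'c) list) cplx.
        quasi_linked R C Z \<and> rtranclp (quasi_linked R) Z W \<and> quasi_linked R W D)"


section \<open>Resolutions, syzygies and Ext\<close>

definition projective_resolution ::
    "('a, 'r) ring_scheme \<Rightarrow> ('a, 'b) module \<Rightarrow> ('a, 'b) cplx \<Rightarrow> ('b \<Rightarrow> 'b) \<Rightarrow> bool" where
  "projective_resolution R M P \<epsilon> \<longleftrightarrow>
     chain_complex R P \<and>
     (\<forall>i<0. zero_module (obj P i)) \<and>
     (\<forall>i\<ge>0. projective_module R (obj P i)) \<and>
     (\<forall>i>0. cycles P i = boundaries P i) \<and>
     \<epsilon> \<in> mod_hom R (obj P 0) M \<and>
     \<epsilon> ` carrier (obj P 0) = carrier M \<and>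
     mod_ker (obj P 0) M \<epsilon> = boundaries P 0"

definition syzygy :: "('a, 'b) module \<Rightarrow> ('a, 'b) cplx \<Rightarrow> nat \<Rightarrow> ('a, 'b) module" where
  "syzygy M P j =
     (if j = 0 then M
      else (obj P (int j - 1))\<lparr>carrier := diff P (int j) ` carrier (obj P (int j))\<rparr>)"

text \<open>The complex \<open>Hom\<^sub>R(C, N)\<close>, with \<open>Hom\<^sub>R(C\<^sub>i, N)\<close> in homological degree \<open>-i\<close>.\<close>

definition hom_cplx ::
    "('a, 'r) ring_scheme \<Rightarrow> ('a, 'b) cplx \<Rightarrow> ('a, 'c) module \<Rightarrow> ('a, 'b \<Rightarrow> 'c) cplx" where
  "hom_cplx R C N =
     \<lparr>obj = (\<lambda>i. hom_module R (obj C (- i)) N),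
      diff = (\<lambda>i f. \<lambda>x\<in>carrier (obj C (1 - i)). f (diff C (1 - i) x))\<rparr>"

text \<open>\<open>Ext\<^sub>R\<^sup>q(M, N)\<close>, where \<open>P\<close> is a projective resolution of \<open>M\<close>.\<close>

definition Ext ::
    "('a, 'r) ring_scheme \<Rightarrow> ('a, 'b) cplx \<Rightarrow> ('a, 'c) module \<Rightarrow> nat \<Rightarrow> ('a, ('b \<Rightarrow> 'c) set) module"
  where "Ext R P N q = homology (hom_cplx R P N) (- int q)"


section \<open>Koszul complexes\<close>

text \<open>
  \<open>K(x, R)\<close> is in degree \<open>i\<close> the free module on the \<open>i\<close>-element subsets \<open>S\<close> of \<open>{1..n}\<close>, and
  the differential sends the basis element of \<open>S = {s\<^sub>1 < \<dots> < s\<^sub>i}\<close> to the sum over \<open>k\<close> of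
  \<open>(-1)\<^bsup>k - 1\<^esup> x\<^bsub>s\<^sub>k\<^esub>\<close> times the basis element of \<open>S - {s\<^sub>k}\<close>. The definition reads off the
  coefficient at \<open>T = S - {s}\<close>.
\<close>

definition koszul_index :: "nat \<Rightarrow> int \<Rightarrow> nat set set" where
  "koszul_index n i = {S. S \<subseteq> {1..n} \<and> int (card S) = i}"

definition koszul_ring ::
    "('a, 'r) ring_scheme \<Rightarrow> (nat \<Rightarrow> 'a) \<Rightarrow> nat \<Rightarrow> ('a, nat set \<Rightarrow> 'a) cplx" where
  "koszul_ring R x n =
     \<lparr>obj = (\<lambda>i. free_module R (koszul_index n i)),
      diff = (\<lambda>i f. \<lambda>T\<in>koszul_index n (i - 1).
        (\<Oplus>\<^bsub>R\<^esub>s\<in>{1..n} - T.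
           (\<ominus>\<^bsub>R\<^esub> \<one>\<^bsub>R\<^esub>) [^]\<^bsub>R\<^esub> card {t \<in> T. t < s} \<otimes>\<^bsub>R\<^esub> x s \<otimes>\<^bsub>R\<^esub> f (insert s T)))\<rparr>"

definition tensor_cplx ::
    "('a, 'r) ring_scheme \<Rightarrow> ('a, 'b) cplx \<Rightarrow> ('a, 'c) module \<Rightarrow> ('a, ('b \<times> 'c \<Rightarrow> 'a) set) cplx"
  where
  "tensor_cplx R C N =
     \<lparr>obj = (\<lambda>i. tensor_module R (obj C i) N),
      diff = (\<lambda>i. tensor_map R (obj C i) (obj C (i - 1)) N (diff C i))\<rparr>"

definition koszul ::
    "('a, 'r) ring_scheme \<Rightarrow> (nat \<Rightarrow> 'a) \<Rightarrow> nat \<Rightarrow> ('a, 'b) module \<Rightarrow>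
     ('a, ((nat set \<Rightarrow> 'a) \<times> 'b \<Rightarrow> 'a) set) cplx" where
  "koszul R x n M = tensor_cplx R (koszul_ring R x n) M"

end

theory Submission
  imports Defs
begin

text \<open>
  Let \<open>\<pi>\<^sub>j : P\<^sub>j \<rightarrow> \<Omega>\<^sup>j\<close> be the canonical surjections. As the class of \<open>\<pi>\<^sub>j\<^sub>+\<^sub>1\<close> in
  \<open>Ext\<^sup>j\<^sup>+\<^sup>1(M, \<Omega>\<^sup>j\<^sup>+\<^sup>1)\<close> is killed by \<open>x\<^sub>s\<close> for \<open>j < s\<close>, multiplication by \<open>x\<^sub>s\<close> on \<open>\<Omega>\<^sup>j\<close> lifts
  through \<open>\<pi>\<^sub>j\<close>; equivalently, there is \<open>u : P\<^sub>j \<rightarrow> P\<^sub>j\<close> with \<open>\<pi>\<^sub>j u = x\<^sub>s \<pi>\<^sub>j\<close> that vanishes on the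
  kernel of \<open>\<pi>\<^sub>j\<close>.

  The complex \<open>X\<close> is the total complex of a cube: its part of degree \<open>i\<close> is the sum over
  \<open>S \<subseteq> {1..n}\<close> of \<open>P\<^bsub>i-|S|\<^esub>\<close> if \<open>i < n\<close>, and of \<open>\<Omega>\<^bsup>n-|S|\<^esup>\<close> if \<open>i = n\<close>. Its differential combines
  that of \<open>P\<close> with maps that remove an element \<open>s\<close> from \<open>S\<close>; the latter are multiplication by
  \<open>x\<^sub>s\<close>, the lift \<open>u\<close>, or zero, depending on the sign of \<open>s - (i - |S|) - |S \<inter> {1..s}|\<close>. (This is
  what results from replacing, for \<open>m = 1, \<dots>, n\<close>, the cone of \<open>x\<^sub>m\<close> on the complex obtained from
  \<open>x\<^sub>1, \<dots>, x\<^bsub>m-1\<^esub>\<close> by the cone of a lift of \<open>x\<^sub>m\<close> to a resolution of the top module.)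

  The augmentation \<open>P\<^sub>0 \<rightarrow> M\<close> on the summands with \<open>|S| = i\<close> is a surjective chain map from \<open>X\<close> to
  \<open>K(x, M)\<close>. Its kernel is filtered by \<open>|S|\<close> with exact subquotients
  \<open>0 \<rightarrow> \<Omega>\<^bsup>n-|S|\<^esup> \<rightarrow> P\<^bsub>n-|S|-1\<^esub> \<rightarrow> \<dots> \<rightarrow> P\<^sub>1 \<rightarrow> \<Omega>\<^sup>1 \<rightarrow> 0\<close>, hence acyclic.
\<close>

section \<open>Homomorphisms, quotients and direct sums\<close>

text \<open>Writing \<open>S = insert s T\<close>, the summand \<open>P_j\<close> indexed by
  \<open>T\<close> has degree \<open>j + |{t \<in> T. t < s}|\<close> in the complex built from the
  first \<open>s - 1\<close> elements, whose top degree is \<open>s - 1\<close>; the sign compares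
  these two degrees. Below the top, multiplication by \<open>x s\<close> is already a chain map; in
  the top degree it acts on syzygies and has to be lifted to their covers; above it the lift can be
  zero, precisely because \<open>u\<close> vanishes on the kernel of the canonical surjection. The
  obstacle is strictness. A total complex needs squares that commute on the nose, while lifts are
  unique only up to homotopy and the lifts for two different elements need not commute. The
  vanishing of \<open>u\<close> on the kernel settles this too: in the critical square, for
  \<open>s < t\<close>, the two ways round are \<open>u_s u_t\<close> and \<open>x_t u_s\<close>,
  and they agree because \<open>u_t - x_t\<close> maps into the kernel on which \<open>u_s\<close>
  vanishes. The square comparing \<open>u_s u_t\<close> with \<open>u_t u_s\<close> never occurs,
  because the signs for \<open>s\<close> and \<open>t\<close> are ordered. The same property lets
  the maps descend from \<open>P_j\<close> to the syzygy in degree \<open>n\<close>. Hence the total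
  complex can be written down at once and no cone is formed.\<close>

lemma mod_homI:
  assumes "\<And>x. x \<in> carrier M \<Longrightarrow> f x \<in> carrier N"
    and "\<And>x y. x \<in> carrier M \<Longrightarrow> y \<in> carrier M \<Longrightarrow> f (x \<oplus>\<^bsub>M\<^esub> y) = f x \<oplus>\<^bsub>N\<^esub> f y"
    and "\<And>r x. r \<in> carrier R \<Longrightarrow> x \<in> carrier M \<Longrightarrow> f (r \<odot>\<^bsub>M\<^esub> x) = r \<odot>\<^bsub>N\<^esub> f x"
  shows "f \<in> mod_hom R M N"
  using assms by (auto simp: mod_hom_def)

lemma mod_hom_closed: "f \<in> mod_hom R M N \<Longrightarrow> x \<in> carrier M \<Longrightarrow> f x \<in> carrier N"
  by (auto simp: mod_hom_def)

lemma mod_hom_add: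
  "f \<in> mod_hom R M N \<Longrightarrow> x \<in> carrier M \<Longrightarrow> y \<in> carrier M \<Longrightarrow> f (x \<oplus>\<^bsub>M\<^esub> y) = f x \<oplus>\<^bsub>N\<^esub> f y"
  by (auto simp: mod_hom_def)

lemma mod_hom_smult:
  "f \<in> mod_hom R M N \<Longrightarrow> r \<in> carrier R \<Longrightarrow> x \<in> carrier M \<Longrightarrow> f (r \<odot>\<^bsub>M\<^esub> x) = r \<odot>\<^bsub>N\<^esub> f x"
  by (auto simp: mod_hom_def)

lemma mod_hom_cong:
  assumes "f \<in> mod_hom R M N" "module R M" "\<And>x. x \<in> carrier M \<Longrightarrow> g x = f x"
  shows "g \<in> mod_hom R M N"
proof -
  interpret M: module R M by fact
  show ?thesis
    by (rule mod_homI) (simp_all add: assms(3) mod_hom_closed[OF assms(1)] mod_hom_add[OF assms(1)]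
        mod_hom_smult[OF assms(1)])
qed

lemma mod_hom_compose:
  assumes "f \<in> mod_hom R M N" "g \<in> mod_hom R N L"
  shows "(\<lambda>x. g (f x)) \<in> mod_hom R M L"
  by (rule mod_homI) (simp_all add: mod_hom_closed[OF assms(1)] mod_hom_closed[OF assms(2)]
      mod_hom_add[OF assms(1)] mod_hom_add[OF assms(2)] mod_hom_smult[OF assms(1)]
      mod_hom_smult[OF assms(2)])

lemma mod_hom_zero:
  assumes "module R M" "module R N" "f \<in> mod_hom R M N"
  shows "f \<zero>\<^bsub>M\<^esub> = \<zero>\<^bsub>N\<^esub>"
proof -
  interpret M: module R M by fact
  interpret N: module R N by fact
  have "f \<zero>\<^bsub>M\<^esub> = f (\<zero>\<^bsub>R\<^esub> \<odot>\<^bsub>M\<^esub> \<zero>\<^bsub>M\<^esub>)" by simp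
  also have "\<dots> = \<zero>\<^bsub>N\<^esub>" 
    by (subst mod_hom_smult[OF assms(3)]) (use mod_hom_closed[OF assms(3)] in simp_all)
  finally show ?thesis .
qed

lemma mod_hom_inv:
  assumes "module R M" "module R N" "f \<in> mod_hom R M N" "x \<in> carrier M"
  shows "f (\<ominus>\<^bsub>M\<^esub> x) = \<ominus>\<^bsub>N\<^esub> f x"
proof -
  interpret M: module R M by fact
  interpret N: module R N by fact
  have "\<ominus>\<^bsub>M\<^esub> x = (\<ominus>\<^bsub>R\<^esub> \<one>\<^bsub>R\<^esub>) \<odot>\<^bsub>M\<^esub> x"
    using assms(4) by (simp add: M.smult_l_minus)
  then show ?thesis
    using assms(4) mod_hom_closed[OF assms(3,4)]
    by (simp add: mod_hom_smult[OF assms(3)] N.smult_l_minus)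
qed

lemma mod_hom_minus:
  assumes "module R M" "module R N" "f \<in> mod_hom R M N" "x \<in> carrier M" "y \<in> carrier M"
  shows "f (x \<ominus>\<^bsub>M\<^esub> y) = f x \<ominus>\<^bsub>N\<^esub> f y"
proof -
  interpret M: module R M by fact
  show ?thesis
    using assms by (simp add: a_minus_def mod_hom_add mod_hom_inv)
qed

lemma mod_hom_finsum:
  assumes "module R M" "module R N" "f \<in> mod_hom R M N" "finite A" "g \<in> A \<rightarrow> carrier M"
  shows "f (\<Oplus>\<^bsub>M\<^esub>i\<in>A. g i) = (\<Oplus>\<^bsub>N\<^esub>i\<in>A. f (g i))"
  using assms(4,5)
proof (induction A)
  case empty
  interpret M: module R M by fact
  interpret N: module R N by fact
  show ?case using mod_hom_zero[OF assms(1-3)] by simp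
next
  case (insert a A)
  interpret M: module R M by fact
  interpret N: module R N by fact
  have g: "g \<in> A \<rightarrow> carrier M" "g a \<in> carrier M" using insert by auto
  then have fg: "(\<lambda>i. f (g i)) \<in> A \<rightarrow> carrier N" "f (g a) \<in> carrier N"
    using mod_hom_closed[OF assms(3)] by auto
  show ?case
    using insert g fg by (simp add: mod_hom_add[OF assms(3)])
qed

lemma mod_hom_smult_map:
  assumes "module R M" "module R N" "f \<in> mod_hom R M N" "a \<in> carrier R"
  shows "(\<lambda>x. a \<odot>\<^bsub>N\<^esub> f x) \<in> mod_hom R M N"
proof -
  interpret M: module R M by fact
  interpret N: module R N by fact
  note f = mod_hom_closed[OF assms(3)]
  show ?thesis
  proof (rule mod_homI)
    fix r x assume "r \<in> carrier R" "x \<in> carrier M"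
    then show "a \<odot>\<^bsub>N\<^esub> f (r \<odot>\<^bsub>M\<^esub> x) = r \<odot>\<^bsub>N\<^esub> (a \<odot>\<^bsub>N\<^esub> f x)"
      using assms(4) f
      by (simp add: mod_hom_smult[OF assms(3)] N.smult_assoc1[symmetric] M.R.m_comm)
  qed (use assms(4) f in \<open>simp_all add: mod_hom_add[OF assms(3)] N.smult_r_distr\<close>)
qed

lemma mod_hom_diff_map:
  assumes "module R M" "module R N" "f \<in> mod_hom R M N" "g \<in> mod_hom R M N"
  shows "(\<lambda>x. f x \<ominus>\<^bsub>N\<^esub> g x) \<in> mod_hom R M N"
proof -
  interpret M: module R M by fact
  interpret N: module R N by fact
  note f = mod_hom_closed[OF assms(3)] and g = mod_hom_closed[OF assms(4)]
  show ?thesis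
    by (rule mod_homI)
      (use f g in \<open>simp_all add: mod_hom_add[OF assms(3)] mod_hom_add[OF assms(4)]
        mod_hom_smult[OF assms(3)] mod_hom_smult[OF assms(4)] N.minus_eq N.smult_r_distr
        N.smult_r_minus N.minus_add N.a_ac\<close>)
qed

lemma mod_hom_id: "(\<lambda>x. x) \<in> mod_hom R M M"
  by (rule mod_homI) auto

lemma mod_hom_const_zero:
  assumes "module R N"
  shows "(\<lambda>x. \<zero>\<^bsub>N\<^esub>) \<in> mod_hom R M N"
proof -
  interpret N: module R N by fact
  show ?thesis by (rule mod_homI) simp_all
qed

section \<open>Kernels, images, and module structures inherited along surjections\<close>

lemma submodule_ker:
  assumes "module R M" "module R N" "f \<in> mod_hom R M N"
  shows "submodule (mod_ker M N f) R M"
proof -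
  interpret M: module R M by fact
  interpret N: module R N by fact
  show ?thesis
    by (rule M.submoduleI)
      (auto simp: mod_ker_def mod_hom_zero[OF assms] mod_hom_inv[OF assms] mod_hom_add[OF assms(3)]
        mod_hom_smult[OF assms(3)])
qed

lemma submodule_image:
  assumes "module R M" "module R N" "f \<in> mod_hom R M N"
  shows "submodule (f ` carrier M) R N"
proof -
  interpret M: module R M by fact
  interpret N: module R N by fact
  show ?thesis
  proof (rule N.submoduleI)
    show "\<zero>\<^bsub>N\<^esub> \<in> f ` carrier M"
      using mod_hom_zero[OF assms] M.zero_closed by (metis imageI)
    show "\<ominus>\<^bsub>N\<^esub> a \<in> f ` carrier M" if "a \<in> f ` carrier M" for a
    proof -
      from that obtain x where "x \<in> carrier M" "a = f x" by auto
      then show ?thesis using mod_hom_inv[OF assms, of x] by (metis M.a_inv_closed imageI)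
    qed
    show "a \<oplus>\<^bsub>N\<^esub> b \<in> f ` carrier M" if "a \<in> f ` carrier M" "b \<in> f ` carrier M" for a b
    proof -
      from that obtain x y where "x \<in> carrier M" "a = f x" "y \<in> carrier M" "b = f y" by auto
      then show ?thesis using mod_hom_add[OF assms(3), of x y] by (metis M.a_closed imageI)
    qed
    show "r \<odot>\<^bsub>N\<^esub> b \<in> f ` carrier M" if "r \<in> carrier R" "b \<in> f ` carrier M" for r b
    proof -
      from that obtain x where "x \<in> carrier M" "b = f x" by auto
      then show ?thesis using that mod_hom_smult[OF assms(3), of r x]
        by (metis M.smult_closed imageI)
    qed
  qed (use mod_hom_closed[OF assms(3)] in auto)
qed

text \<open>Every axiom is an equation between sums and multiples, or asserts closure or an inverse,
  and each of these passes to the image of an operation-preserving surjection. Closure of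
  \<open>N\<close> is part of what is inherited, so the lemma applies to structures of which nothing
  is known beforehand, such as quotients.\<close>

lemma module_surj_image:
  fixes M :: "('a, 'b) module" and N :: "('a, 'c) module"
  assumes "module R M"
    and surj: "h ` carrier M = carrier N"
    and zero: "h \<zero>\<^bsub>M\<^esub> = \<zero>\<^bsub>N\<^esub>"
    and add: "\<And>x y. x \<in> carrier M \<Longrightarrow> y \<in> carrier M \<Longrightarrow> h (x \<oplus>\<^bsub>M\<^esub> y) = h x \<oplus>\<^bsub>N\<^esub> h y"
    and smult: "\<And>r x. r \<in> carrier R \<Longrightarrow> x \<in> carrier M \<Longrightarrow> h (r \<odot>\<^bsub>M\<^esub> x) = r \<odot>\<^bsub>N\<^esub> h x"
  shows "module R N"
proof -
  interpret M: module R M by fact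
  have ex: "\<exists>u\<in>carrier M. v = h u" if "v \<in> carrier N" for v
    using that surj by auto
  have in_N: "h u \<in> carrier N" if "u \<in> carrier M" for u using that surj by auto
  show ?thesis
  proof (rule moduleI)
    show "cring R" by unfold_locales
    show "abelian_group N"
    proof (rule abelian_groupI)
      fix x y assume "x \<in> carrier N" "y \<in> carrier N"
      then obtain u v where "u \<in> carrier M" "x = h u" "v \<in> carrier M" "y = h v"
        by (auto dest!: ex)
      then show "x \<oplus>\<^bsub>N\<^esub> y \<in> carrier N" "x \<oplus>\<^bsub>N\<^esub> y = y \<oplus>\<^bsub>N\<^esub> x"
        by (simp_all add: add[symmetric] in_N M.a_comm)
    next
      show "\<zero>\<^bsub>N\<^esub> \<in> carrier N" using in_N[OF M.zero_closed] zero by simp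
    next
      fix x y z assume "x \<in> carrier N" "y \<in> carrier N" "z \<in> carrier N"
      then obtain u v w where "u \<in> carrier M" "x = h u" "v \<in> carrier M" "y = h v"
        "w \<in> carrier M" "z = h w"
        by (auto dest!: ex)
      then show "x \<oplus>\<^bsub>N\<^esub> y \<oplus>\<^bsub>N\<^esub> z = x \<oplus>\<^bsub>N\<^esub> (y \<oplus>\<^bsub>N\<^esub> z)"
        by (simp add: add[symmetric] M.a_assoc)
    next
      fix x assume "x \<in> carrier N"
      then obtain u where u: "u \<in> carrier M" "x = h u" by (auto dest!: ex)
      then show "\<zero>\<^bsub>N\<^esub> \<oplus>\<^bsub>N\<^esub> x = x"
        by (simp add: add[symmetric] zero[symmetric])
      show "\<exists>y\<in>carrier N. y \<oplus>\<^bsub>N\<^esub> x = \<zero>\<^bsub>N\<^esub>"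
        using u by (intro bexI[of _ "h (\<ominus>\<^bsub>M\<^esub> u)"])
          (simp_all add: add[symmetric] zero[symmetric] M.l_neg in_N)
    qed
    fix a b x y assume ab: "a \<in> carrier R" and x: "x \<in> carrier N"
    then obtain u where u: "u \<in> carrier M" "x = h u" by (auto dest!: ex)
    then show "a \<odot>\<^bsub>N\<^esub> x \<in> carrier N" using ab by (simp add: smult[symmetric] in_N)
    show "(a \<oplus>\<^bsub>R\<^esub> b) \<odot>\<^bsub>N\<^esub> x = a \<odot>\<^bsub>N\<^esub> x \<oplus>\<^bsub>N\<^esub> b \<odot>\<^bsub>N\<^esub> x" if "b \<in> carrier R"
      using ab u that by (simp add: smult[symmetric] add[symmetric] M.smult_l_distr)
    show "a \<odot>\<^bsub>N\<^esub> (x \<oplus>\<^bsub>N\<^esub> y) = a \<odot>\<^bsub>N\<^esub> x \<oplus>\<^bsub>N\<^esub> a \<odot>\<^bsub>N\<^esub> y" if y: "y \<in> carrier N"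
    proof -
      obtain v where "v \<in> carrier M" "y = h v" using ex[OF y] by blast
      then show ?thesis
        using ab u by (simp add: smult[symmetric] add[symmetric] M.smult_r_distr)
    qed
    show "(a \<otimes>\<^bsub>R\<^esub> b) \<odot>\<^bsub>N\<^esub> x = a \<odot>\<^bsub>N\<^esub> (b \<odot>\<^bsub>N\<^esub> x)" if "b \<in> carrier R"
      using ab u that by (simp add: smult[symmetric] M.smult_assoc1)
  next
    fix x assume "x \<in> carrier N"
    then obtain u where u: "u \<in> carrier M" "x = h u" by (auto dest!: ex)
    then show "\<one>\<^bsub>R\<^esub> \<odot>\<^bsub>N\<^esub> x = x" by (simp add: smult[symmetric])
  qed
qed

section \<open>Cosets and quotient modules\<close>

lemma UN_const: "a \<in> A \<Longrightarrow> (\<Union>x\<in>A. c) = c"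
  by auto

lemma mem_coset_iff:
  assumes "module R M" "submodule N R M" "a \<in> carrier M"
  shows "x \<in> N +>\<^bsub>M\<^esub> a \<longleftrightarrow> x \<in> carrier M \<and> x \<ominus>\<^bsub>M\<^esub> a \<in> N"
proof -
  interpret M: module R M by fact
  note N = M.submoduleE[OF assms(2)]
  show ?thesis
  proof
    assume "x \<in> N +>\<^bsub>M\<^esub> a"
    then obtain h where h: "h \<in> N" "x = h \<oplus>\<^bsub>M\<^esub> a" by (auto simp: a_r_coset_def')
    then have "h \<in> carrier M" using N(1) by auto
    then show "x \<in> carrier M \<and> x \<ominus>\<^bsub>M\<^esub> a \<in> N"
      using h assms(3) by (simp add: M.minus_eq M.a_assoc M.r_neg)
  next
    assume "x \<in> carrier M \<and> x \<ominus>\<^bsub>M\<^esub> a \<in> N"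
    moreover from this have "x = (x \<ominus>\<^bsub>M\<^esub> a) \<oplus>\<^bsub>M\<^esub> a"
      using assms(3) by (simp add: M.minus_eq M.a_assoc M.l_neg)
    ultimately show "x \<in> N +>\<^bsub>M\<^esub> a" unfolding a_r_coset_def' by blast
  qed
qed

lemma coset_self:
  assumes "module R M" "submodule N R M" "a \<in> carrier M"
  shows "a \<in> N +>\<^bsub>M\<^esub> a"
proof -
  interpret M: module R M by fact
  have "\<zero>\<^bsub>M\<^esub> \<in> N"
    using subgroup.one_closed[OF submodule.axioms(1)[OF assms(2)]] by simp
  then show ?thesis using assms by (simp add: mem_coset_iff M.minus_eq M.r_neg)
qed

lemma coset_eq_iff:
  assumes "module R M" "submodule N R M" "a \<in> carrier M" "b \<in> carrier M"
  shows "N +>\<^bsub>M\<^esub> a = N +>\<^bsub>M\<^esub> b \<longleftrightarrow> a \<ominus>\<^bsub>M\<^esub> b \<in> N"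
proof
  assume "N +>\<^bsub>M\<^esub> a = N +>\<^bsub>M\<^esub> b"
  then show "a \<ominus>\<^bsub>M\<^esub> b \<in> N"
    using coset_self[OF assms(1-3)] mem_coset_iff[OF assms(1,2,4)] by blast
next
  assume ab: "a \<ominus>\<^bsub>M\<^esub> b \<in> N"
  interpret M: module R M by fact
  note N = M.submoduleE[OF assms(2)]
  have "x \<ominus>\<^bsub>M\<^esub> a \<in> N \<longleftrightarrow> x \<ominus>\<^bsub>M\<^esub> b \<in> N" if "x \<in> carrier M" for x
  proof -
    have 1: "x \<ominus>\<^bsub>M\<^esub> b = (x \<ominus>\<^bsub>M\<^esub> a) \<oplus>\<^bsub>M\<^esub> (a \<ominus>\<^bsub>M\<^esub> b)"
      using that assms(3,4)
      by (simp add: M.minus_eq M.a_assoc M.r_neg2 M.r_neg1)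
    have 2: "x \<ominus>\<^bsub>M\<^esub> a = (x \<ominus>\<^bsub>M\<^esub> b) \<oplus>\<^bsub>M\<^esub> (b \<ominus>\<^bsub>M\<^esub> a)"
      using that assms(3,4)
      by (simp add: M.minus_eq M.a_assoc M.r_neg2 M.r_neg1)
    have 3: "b \<ominus>\<^bsub>M\<^esub> a = \<ominus>\<^bsub>M\<^esub> (a \<ominus>\<^bsub>M\<^esub> b)"
      using assms(3,4) by (simp add: M.minus_eq M.minus_add M.a_comm)
    show ?thesis using 1 2 3 N(3,5) ab by metis
  qed
  then show "N +>\<^bsub>M\<^esub> a = N +>\<^bsub>M\<^esub> b"
    using mem_coset_iff[OF assms(1,2,3)] mem_coset_iff[OF assms(1,2,4)] by blast
qed

text \<open>Operations on cosets can be computed on representatives: the elementwise sum of two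
  cosets is one coset, and so is the union that defines the scalar multiple. The axioms then pass
  along the surjection \<open>a \<mapsto> N + a\<close>.\<close>

lemma
  assumes "module R M" "submodule N R M"
  shows quot_module_carrier: "carrier (quot_module M N) = (\<lambda>a. N +>\<^bsub>M\<^esub> a) ` carrier M"
    and quot_module_module: "module R (quot_module M N)"
    and quot_module_hom: "(\<lambda>a. N +>\<^bsub>M\<^esub> a) \<in> mod_hom R M (quot_module M N)"
proof -
  interpret M: module R M by fact
  note N = M.submoduleE[OF assms(2)]
  note mem = mem_coset_iff[OF assms] and eq = coset_eq_iff[OF assms]
  have 0: "\<zero>\<^bsub>quot_module M N\<^esub> = N +>\<^bsub>M\<^esub> \<zero>\<^bsub>M\<^esub>"
    using N(1) by (auto simp: quot_module_def mem M.minus_eq)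
  show c: "carrier (quot_module M N) = (\<lambda>a. N +>\<^bsub>M\<^esub> a) ` carrier M"
    by (auto simp: quot_module_def A_RCOSETS_def')
  have add: "(N +>\<^bsub>M\<^esub> a) \<oplus>\<^bsub>quot_module M N\<^esub> (N +>\<^bsub>M\<^esub> b) = N +>\<^bsub>M\<^esub> (a \<oplus>\<^bsub>M\<^esub> b)"
    if ab: "a \<in> carrier M" "b \<in> carrier M" for a b
  proof -
    have "(N +>\<^bsub>M\<^esub> a) <+>\<^bsub>M\<^esub> (N +>\<^bsub>M\<^esub> b) = N +>\<^bsub>M\<^esub> (a \<oplus>\<^bsub>M\<^esub> b)"
    proof (intro equalityI subsetI)
      fix x assume "x \<in> (N +>\<^bsub>M\<^esub> a) <+>\<^bsub>M\<^esub> (N +>\<^bsub>M\<^esub> b)"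
      then obtain h k where hk: "h \<in> N" "k \<in> N" "x = (h \<oplus>\<^bsub>M\<^esub> a) \<oplus>\<^bsub>M\<^esub> (k \<oplus>\<^bsub>M\<^esub> b)"
        by (auto simp: set_add_def' a_r_coset_def')
      then have "x = (h \<oplus>\<^bsub>M\<^esub> k) \<oplus>\<^bsub>M\<^esub> (a \<oplus>\<^bsub>M\<^esub> b)"
        using ab N(1) by (simp add: M.a_ac subset_eq)
      moreover have "h \<oplus>\<^bsub>M\<^esub> k \<in> N" using hk N by auto
      ultimately show "x \<in> N +>\<^bsub>M\<^esub> (a \<oplus>\<^bsub>M\<^esub> b)" by (auto simp: a_r_coset_def')
    next
      fix x assume "x \<in> N +>\<^bsub>M\<^esub> (a \<oplus>\<^bsub>M\<^esub> b)"
      then obtain h where h: "h \<in> N" "x = h \<oplus>\<^bsub>M\<^esub> (a \<oplus>\<^bsub>M\<^esub> b)" by (auto simp: a_r_coset_def')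
      then have "x = (h \<oplus>\<^bsub>M\<^esub> a) \<oplus>\<^bsub>M\<^esub> b" using ab N(1) by (simp add: M.a_ac subset_eq)
      moreover have "h \<oplus>\<^bsub>M\<^esub> a \<in> N +>\<^bsub>M\<^esub> a" using h by (auto simp: a_r_coset_def')
      moreover have "b \<in> N +>\<^bsub>M\<^esub> b" using coset_self[OF assms ab(2)] .
      ultimately show "x \<in> (N +>\<^bsub>M\<^esub> a) <+>\<^bsub>M\<^esub> (N +>\<^bsub>M\<^esub> b)" by (auto simp: set_add_def')
    qed
    then show ?thesis by (simp add: quot_module_def)
  qed
  have smult: "r \<odot>\<^bsub>quot_module M N\<^esub> (N +>\<^bsub>M\<^esub> a) = N +>\<^bsub>M\<^esub> (r \<odot>\<^bsub>M\<^esub> a)"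
    if r: "r \<in> carrier R" and a: "a \<in> carrier M" for r a
  proof -
    have "N +>\<^bsub>M\<^esub> (r \<odot>\<^bsub>M\<^esub> b) = N +>\<^bsub>M\<^esub> (r \<odot>\<^bsub>M\<^esub> a)" if "b \<in> N +>\<^bsub>M\<^esub> a" for b
    proof -
      have b: "b \<in> carrier M" "b \<ominus>\<^bsub>M\<^esub> a \<in> N" using that a by (auto simp: mem)
      have "r \<odot>\<^bsub>M\<^esub> b \<ominus>\<^bsub>M\<^esub> r \<odot>\<^bsub>M\<^esub> a = r \<odot>\<^bsub>M\<^esub> (b \<ominus>\<^bsub>M\<^esub> a)"
        using r a b by (simp add: M.minus_eq M.smult_r_distr M.smult_r_minus)
      then show ?thesis using r a b N(4) by (simp add: eq)
    qed
    \<comment> \<open>All members of the union are the same coset, so the union collapses.\<close>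
    then have "(\<Union>b\<in>N +>\<^bsub>M\<^esub> a. N +>\<^bsub>M\<^esub> (r \<odot>\<^bsub>M\<^esub> b)) = (\<Union>b\<in>N +>\<^bsub>M\<^esub> a. N +>\<^bsub>M\<^esub> (r \<odot>\<^bsub>M\<^esub> a))"
      by (rule SUP_cong[OF refl])
    also have "\<dots> = N +>\<^bsub>M\<^esub> (r \<odot>\<^bsub>M\<^esub> a)"
      by (rule UN_const[OF coset_self[OF assms a]])
    finally show ?thesis by (simp add: quot_module_def)
  qed
  show "module R (quot_module M N)"
    by (rule module_surj_image[OF assms(1), where h = "\<lambda>a. N +>\<^bsub>M\<^esub> a"])
      (simp_all add: 0 c add smult)
  show "(\<lambda>a. N +>\<^bsub>M\<^esub> a) \<in> mod_hom R M (quot_module M N)"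
    by (rule mod_homI) (simp_all add: c add smult)
qed

section \<open>Direct sums\<close>

lemma
  shows direct_sum_zero: "\<zero>\<^bsub>direct_sum I V\<^esub> = (\<lambda>i\<in>I. \<zero>\<^bsub>V i\<^esub>)"
    and direct_sum_add: "f \<oplus>\<^bsub>direct_sum I V\<^esub> g = (\<lambda>i\<in>I. f i \<oplus>\<^bsub>V i\<^esub> g i)"
    and direct_sum_smult: "r \<odot>\<^bsub>direct_sum I V\<^esub> f = (\<lambda>i\<in>I. r \<odot>\<^bsub>V i\<^esub> f i)"
  by (simp_all add: direct_sum_def)

lemma direct_sum_carrier:
  "carrier (direct_sum I V) = {f \<in> (\<Pi>\<^sub>E i\<in>I. carrier (V i)). finite {i \<in> I. f i \<noteq> \<zero>\<^bsub>V i\<^esub>}}"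
  by (simp add: direct_sum_def)

lemma direct_sum_carrier_finite:
  "finite I \<Longrightarrow> carrier (direct_sum I V) = (\<Pi>\<^sub>E i\<in>I. carrier (V i))"
  by (simp add: direct_sum_def)

lemma direct_sum_closed:
  "f \<in> carrier (direct_sum I V) \<Longrightarrow> i \<in> I \<Longrightarrow> f i \<in> carrier (V i)"
  by (auto simp: direct_sum_def)

lemma direct_sum_module:
  assumes "cring R" "\<And>i. i \<in> I \<Longrightarrow> module R (V i)"
  shows "module R (direct_sum I V)"
proof -
  interpret R: cring R by fact
  have ab: "abelian_group (V i)" if "i \<in> I" for i
    using assms(2)[OF that] by (simp add: module_def)
  note mods = assms(2)[THEN module.smult_closed] assms(2)[THEN module.smult_l_distr]
    assms(2)[THEN module.smult_r_distr] assms(2)[THEN module.smult_assoc1]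
    assms(2)[THEN module.smult_one] assms(2)[THEN module.smult_r_null]
    ab[THEN abelian_groupE(1)] ab[THEN abelian_groupE(2)] ab[THEN abelian_groupE(3)]
    ab[THEN abelian_groupE(4)] ab[THEN abelian_groupE(5)]
    ab[THEN abelian_group.axioms(1), THEN abelian_monoid.r_zero]
  have zz: "\<zero>\<^bsub>V i\<^esub> \<oplus>\<^bsub>V i\<^esub> \<zero>\<^bsub>V i\<^esub> = \<zero>\<^bsub>V i\<^esub>" if "i \<in> I" for i
    using that by (simp add: mods)
  have closed: "f i \<in> carrier (V i)" if "f \<in> carrier (direct_sum I V)" "i \<in> I" for f i
    using that by (rule direct_sum_closed)
  have ext: "(\<lambda>i\<in>I. f i) = f" if "f \<in> carrier (direct_sum I V)" for f
    using that by (auto simp: direct_sum_carrier PiE_def extensional_restrict)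
  have addc: "f \<oplus>\<^bsub>direct_sum I V\<^esub> g \<in> carrier (direct_sum I V)"
    if f: "f \<in> carrier (direct_sum I V)" and g: "g \<in> carrier (direct_sum I V)" for f g
  proof -
    have "{i \<in> I. f i \<oplus>\<^bsub>V i\<^esub> g i \<noteq> \<zero>\<^bsub>V i\<^esub>} \<subseteq> {i \<in> I. f i \<noteq> \<zero>\<^bsub>V i\<^esub>} \<union> {i \<in> I. g i \<noteq> \<zero>\<^bsub>V i\<^esub>}"
      using zz by auto
    then have "finite {i \<in> I. f i \<oplus>\<^bsub>V i\<^esub> g i \<noteq> \<zero>\<^bsub>V i\<^esub>}"
      by (rule finite_subset) (use f g in \<open>auto simp: direct_sum_carrier\<close>)
    then show ?thesis
      using closed[OF f] closed[OF g]
      by (simp add: direct_sum_carrier direct_sum_add mods cong: conj_cong)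
  qed
  have smultc: "r \<odot>\<^bsub>direct_sum I V\<^esub> f \<in> carrier (direct_sum I V)"
    if r: "r \<in> carrier R" and f: "f \<in> carrier (direct_sum I V)" for f r
  proof -
    have "{i \<in> I. r \<odot>\<^bsub>V i\<^esub> f i \<noteq> \<zero>\<^bsub>V i\<^esub>} \<subseteq> {i \<in> I. f i \<noteq> \<zero>\<^bsub>V i\<^esub>}"
      using r by (auto simp: mods)
    then have "finite {i \<in> I. r \<odot>\<^bsub>V i\<^esub> f i \<noteq> \<zero>\<^bsub>V i\<^esub>}"
      by (rule finite_subset) (use f in \<open>auto simp: direct_sum_carrier\<close>)
    then show ?thesis
      using closed[OF f] r
      by (simp add: direct_sum_carrier direct_sum_smult mods cong: conj_cong)
  qed
  have restr: "restrict h I = f"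
    if "f \<in> carrier (direct_sum I V)" "\<And>i. i \<in> I \<Longrightarrow> h i = f i" for f h
    using restrict_ext[of I h f] that(2) ext[OF that(1)] by simp
  \<comment> \<open>Additive inverses are taken as multiples by -1, so that their membership is an
    instance of \<open>smultc\<close>.\<close>
  have m1: "\<ominus>\<^bsub>R\<^esub> \<one>\<^bsub>R\<^esub> \<in> carrier R"
    by (simp add: R.a_inv_closed)
  show ?thesis
  proof (rule moduleI)
    show "abelian_group (direct_sum I V)"
    proof (rule abelian_groupI)
      show "\<zero>\<^bsub>direct_sum I V\<^esub> \<in> carrier (direct_sum I V)"
        by (simp add: direct_sum_carrier direct_sum_zero mods cong: conj_cong)
      fix f assume f: "f \<in> carrier (direct_sum I V)"
      show "\<zero>\<^bsub>direct_sum I V\<^esub> \<oplus>\<^bsub>direct_sum I V\<^esub> f = f"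
        unfolding direct_sum_zero direct_sum_add
        by (rule restr[OF f]) (use closed[OF f] in \<open>simp add: mods\<close>)
      have "(\<ominus>\<^bsub>R\<^esub> \<one>\<^bsub>R\<^esub>) \<odot>\<^bsub>direct_sum I V\<^esub> f \<oplus>\<^bsub>direct_sum I V\<^esub> f = \<zero>\<^bsub>direct_sum I V\<^esub>"
        unfolding direct_sum_zero direct_sum_add direct_sum_smult
      proof (rule restrict_ext)
        fix i assume i: "i \<in> I"
        interpret V: module R "V i" using assms(2) i .
        show "(\<lambda>i\<in>I. (\<ominus>\<^bsub>R\<^esub> \<one>\<^bsub>R\<^esub>) \<odot>\<^bsub>V i\<^esub> f i) i \<oplus>\<^bsub>V i\<^esub> f i = \<zero>\<^bsub>V i\<^esub>"
          using i closed[OF f i] by (simp add: V.smult_l_minus V.l_neg)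
      qed
      then show "\<exists>g\<in>carrier (direct_sum I V). g \<oplus>\<^bsub>direct_sum I V\<^esub> f = \<zero>\<^bsub>direct_sum I V\<^esub>"
        using smultc[OF m1 f] by blast
      fix g assume g: "g \<in> carrier (direct_sum I V)"
      show "f \<oplus>\<^bsub>direct_sum I V\<^esub> g \<in> carrier (direct_sum I V)" by (rule addc[OF f g])
      show "f \<oplus>\<^bsub>direct_sum I V\<^esub> g = g \<oplus>\<^bsub>direct_sum I V\<^esub> f"
        unfolding direct_sum_add by (rule restrict_ext) (simp add: closed f g mods)
      fix h assume h: "h \<in> carrier (direct_sum I V)"
      show "f \<oplus>\<^bsub>direct_sum I V\<^esub> g \<oplus>\<^bsub>direct_sum I V\<^esub> h = f \<oplus>\<^bsub>direct_sum I V\<^esub> (g \<oplus>\<^bsub>direct_sum I V\<^esub> h)"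
        unfolding direct_sum_add by (rule restrict_ext) (simp add: closed f g h ab[THEN abelian_groupE(3)])
    qed
    show "cring R" by fact
    fix f assume f: "f \<in> carrier (direct_sum I V)"
    show "\<one>\<^bsub>R\<^esub> \<odot>\<^bsub>direct_sum I V\<^esub> f = f"
      unfolding direct_sum_smult by (rule restr[OF f]) (simp add: closed f mods)
    fix a assume a: "a \<in> carrier R"
    show "a \<odot>\<^bsub>direct_sum I V\<^esub> f \<in> carrier (direct_sum I V)" by (rule smultc[OF a f])
    show "a \<odot>\<^bsub>direct_sum I V\<^esub> (f \<oplus>\<^bsub>direct_sum I V\<^esub> g)
      = a \<odot>\<^bsub>direct_sum I V\<^esub> f \<oplus>\<^bsub>direct_sum I V\<^esub> a \<odot>\<^bsub>direct_sum I V\<^esub> g"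
      if g: "g \<in> carrier (direct_sum I V)" for g
      unfolding direct_sum_add direct_sum_smult
      by (rule restrict_ext) (simp add: closed f g a mods)
    fix b assume b: "b \<in> carrier R"
    show "(a \<oplus>\<^bsub>R\<^esub> b) \<odot>\<^bsub>direct_sum I V\<^esub> f
      = a \<odot>\<^bsub>direct_sum I V\<^esub> f \<oplus>\<^bsub>direct_sum I V\<^esub> b \<odot>\<^bsub>direct_sum I V\<^esub> f"
      unfolding direct_sum_add direct_sum_smult
      by (rule restrict_ext) (simp add: closed f a b mods)
    show "(a \<otimes>\<^bsub>R\<^esub> b) \<odot>\<^bsub>direct_sum I V\<^esub> f = a \<odot>\<^bsub>direct_sum I V\<^esub> (b \<odot>\<^bsub>direct_sum I V\<^esub> f)"
      unfolding direct_sum_smult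
      by (rule restrict_ext) (simp add: closed f a b mods)
  qed
qed

lemma direct_sum_eqI:
  assumes "f \<in> carrier (direct_sum I V)" "g \<in> carrier (direct_sum I V)"
    "\<And>i. i \<in> I \<Longrightarrow> f i = g i"
  shows "f = g"
  using assms by (auto simp: direct_sum_carrier intro: PiE_ext)

lemma direct_sum_hom_proj:
  assumes "i \<in> I"
  shows "(\<lambda>f. f i) \<in> mod_hom R (direct_sum I V) (V i)"
  by (rule mod_homI)
    (simp_all add: assms direct_sum_closed[OF _ assms] direct_sum_add direct_sum_smult)

lemma direct_sum_hom_tuple:
  assumes "finite I" "\<And>i. i \<in> I \<Longrightarrow> (\<lambda>x. f x i) \<in> mod_hom R M (V i)"
  shows "(\<lambda>x. \<lambda>i\<in>I. f x i) \<in> mod_hom R M (direct_sum I V)"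
proof (rule mod_homI)
  note c = mod_hom_closed[OF assms(2)] and a = mod_hom_add[OF assms(2)]
    and m = mod_hom_smult[OF assms(2)]
  show "(\<lambda>i\<in>I. f x i) \<in> carrier (direct_sum I V)" if "x \<in> carrier M" for x
    using that c by (simp add: direct_sum_carrier_finite[OF assms(1)])
  show "(\<lambda>i\<in>I. f (x \<oplus>\<^bsub>M\<^esub> y) i) = (\<lambda>i\<in>I. f x i) \<oplus>\<^bsub>direct_sum I V\<^esub> (\<lambda>i\<in>I. f y i)"
    if "x \<in> carrier M" "y \<in> carrier M" for x y
    unfolding direct_sum_add by (rule restrict_ext) (simp add: a that)
  show "(\<lambda>i\<in>I. f (r \<odot>\<^bsub>M\<^esub> x) i) = r \<odot>\<^bsub>direct_sum I V\<^esub> (\<lambda>i\<in>I. f x i)"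
    if "r \<in> carrier R" "x \<in> carrier M" for r x
    unfolding direct_sum_smult by (rule restrict_ext) (simp add: m that)
qed

section \<open>Sums of homomorphisms and a cancellation of double sums\<close>

lemma mod_hom_add_map:
  assumes "module R M" "module R N" "f \<in> mod_hom R M N" "g \<in> mod_hom R M N"
  shows "(\<lambda>x. f x \<oplus>\<^bsub>N\<^esub> g x) \<in> mod_hom R M N"
proof -
  interpret M: module R M by fact
  interpret N: module R N by fact
  note f = mod_hom_closed[OF assms(3)] and g = mod_hom_closed[OF assms(4)]
  show ?thesis
    by (rule mod_homI)
      (use f g in \<open>simp_all add: mod_hom_add[OF assms(3)] mod_hom_add[OF assms(4)]
        mod_hom_smult[OF assms(3)] mod_hom_smult[OF assms(4)] N.smult_r_distr N.a_ac\<close>)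
qed

lemma mod_hom_finsum_map:
  assumes "module R M" "module R N" "finite A" "\<And>i. i \<in> A \<Longrightarrow> f i \<in> mod_hom R M N"
  shows "(\<lambda>x. \<Oplus>\<^bsub>N\<^esub>i\<in>A. f i x) \<in> mod_hom R M N"
  using assms(3,4)
proof (induction A)
  case empty
  interpret N: module R N by fact
  show ?case by (simp add: mod_hom_const_zero assms)
next
  case (insert a A)
  interpret N: module R N by fact
  have "(\<lambda>x. \<Oplus>\<^bsub>N\<^esub>i\<in>A. f i x) \<in> mod_hom R M N"
    by (rule insert.IH) (use insert.prems in auto)
  then have "(\<lambda>x. f a x \<oplus>\<^bsub>N\<^esub> (\<Oplus>\<^bsub>N\<^esub>i\<in>A. f i x)) \<in> mod_hom R M N"
    using insert.prems by (intro mod_hom_add_map assms(1,2)) auto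
  then show ?case
  proof (rule mod_hom_cong[OF _ assms(1)])
    fix x assume "x \<in> carrier M"
    have "f i x \<in> carrier N" if "i \<in> A" for i
      using that by (intro mod_hom_closed[OF insert.prems \<open>x \<in> carrier M\<close>]) auto
    moreover have "f a x \<in> carrier N"
      by (intro mod_hom_closed[OF insert.prems \<open>x \<in> carrier M\<close>]) auto
    ultimately show "(\<Oplus>\<^bsub>N\<^esub>i\<in>insert a A. f i x) = f a x \<oplus>\<^bsub>N\<^esub> (\<Oplus>\<^bsub>N\<^esub>i\<in>A. f i x)"
      using insert.hyps by simp
  qed
qed

text \<open>Adjoining \<open>u\<close> to \<open>A\<close> contributes exactly the terms
  \<open>a u t\<close> and \<open>a t u\<close> with \<open>t \<in> A\<close>, and these cancel in
  pairs. Cancelling pairs, rather than showing that the sum equals its own negative, is what makes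
  this valid in the presence of 2-torsion. It removes from the square of the total differential the
  terms that delete two elements.\<close>

lemma (in abelian_group) finsum_antisymmetric:
  assumes "finite A"
    and "\<And>s t. s \<in> A \<Longrightarrow> t \<in> A \<Longrightarrow> s \<noteq> t \<Longrightarrow> a s t \<in> carrier G"
    and "\<And>s t. s \<in> A \<Longrightarrow> t \<in> A \<Longrightarrow> s \<noteq> t \<Longrightarrow> a s t \<oplus> a t s = \<zero>"
  shows "(\<Oplus>s\<in>A. \<Oplus>t\<in>A - {s}. a s t) = \<zero>"
  using assms
proof (induction A)
  case empty
  then show ?case by simp
next
  case (insert u A)
  note ac = insert.prems(1)
  have c0: "a s \<in> B \<rightarrow> carrier G" if "s \<in> insert u A" "B \<subseteq> insert u A - {s}" for s B
    using that by (intro funcsetI ac) auto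
  have c1: "a u \<in> A \<rightarrow> carrier G" "(\<lambda>s. a s u) \<in> A \<rightarrow> carrier G"
    using insert.hyps by (intro funcsetI ac; auto)+
  have c2: "(\<lambda>s. \<Oplus>t\<in>A - {s}. a s t) \<in> A \<rightarrow> carrier G"
    by (intro funcsetI finsum_closed c0) auto
  have ne: "insert u A - {u} = A" using insert.hyps by auto
  have eq: "(\<Oplus>t\<in>insert u A - {s}. a s t) = a s u \<oplus> (\<Oplus>t\<in>A - {s}. a s t)" if s: "s \<in> A" for s
  proof -
    have 1: "insert u A - {s} = insert u (A - {s})" using s insert.hyps by auto
    show ?thesis
      unfolding 1
    proof (rule finsum_insert)
      show "a s \<in> A - {s} \<rightarrow> carrier G" "finite (A - {s})" "u \<notin> A - {s}"
        using s insert.hyps by (auto intro: subsetD[OF _ c0, OF _ _ subset_refl] funcsetI ac)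
      show "a s u \<in> carrier G" using s insert.hyps by (intro ac) auto
    qed
  qed
  have "(\<Oplus>s\<in>insert u A. \<Oplus>t\<in>insert u A - {s}. a s t)
      = (\<Oplus>t\<in>insert u A - {u}. a u t) \<oplus> (\<Oplus>s\<in>A. \<Oplus>t\<in>insert u A - {s}. a s t)"
    using insert.hyps by (intro finsum_insert funcsetI finsum_closed c0) auto
  also have "\<dots> = (\<Oplus>t\<in>A. a u t) \<oplus> (\<Oplus>s\<in>A. \<Oplus>t\<in>insert u A - {s}. a s t)"
    by (simp only: ne)
  also have "(\<Oplus>s\<in>A. \<Oplus>t\<in>insert u A - {s}. a s t) = (\<Oplus>s\<in>A. a s u \<oplus> (\<Oplus>t\<in>A - {s}. a s t))"
    using c1 c2 by (intro finsum_cong' funcsetI a_closed refl eq) auto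
  also have "\<dots> = (\<Oplus>s\<in>A. a s u) \<oplus> (\<Oplus>s\<in>A. \<Oplus>t\<in>A - {s}. a s t)"
    by (rule finsum_addf[OF c1(2) c2])
  also have "(\<Oplus>s\<in>A. \<Oplus>t\<in>A - {s}. a s t) = \<zero>"
    by (rule insert.IH) (use insert.prems in auto)
  also have "(\<Oplus>s\<in>A. a s u) \<oplus> \<zero> = (\<Oplus>s\<in>A. a s u)"
    using c1 by (intro r_zero finsum_closed)
  also have "(\<Oplus>t\<in>A. a u t) \<oplus> (\<Oplus>s\<in>A. a s u) = (\<Oplus>t\<in>A. a u t \<oplus> a t u)"
    by (rule finsum_addf[OF c1, symmetric])
  also have "\<dots> = \<zero>"
  proof (rule add.finprod_one_eqI)
    fix x assume "x \<in> A"
    then show "a u x \<oplus> a x u = \<zero>" using insert.hyps by (intro insert.prems(2)) auto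
  qed
  finally show ?case .
qed

section \<open>Quasi-isomorphisms\<close>

lemma chain_complex_module: "chain_complex R C \<Longrightarrow> module R (obj C i)"
  and chain_complex_hom: "chain_complex R C \<Longrightarrow> diff C i \<in> mod_hom R (obj C i) (obj C (i - 1))"
  and chain_complex_diff_diff: "chain_complex R C \<Longrightarrow> x \<in> carrier (obj C i) \<Longrightarrow>
    diff C (i - 1) (diff C i x) = \<zero>\<^bsub>obj C (i - 2)\<^esub>"
  by (simp_all add: chain_complex_def)

lemma submodule_boundaries:
  assumes "chain_complex R C"
  shows "submodule (boundaries C i) R (obj C i)"
  using submodule_image[OF chain_complex_module[OF assms] chain_complex_module[OF assms]
      chain_complex_hom[OF assms, of "i + 1"]]
  by (simp add: boundaries_def)

lemma cycles_carrier: "x \<in> cycles C i \<Longrightarrow> x \<in> carrier (obj C i)"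
  by (simp add: cycles_def mod_ker_def)

lemma homology_carrier:
  "carrier (homology C i) = (\<lambda>a. boundaries C i +>\<^bsub>obj C i\<^esub> a) ` cycles C i"
  by (auto simp: homology_def quot_module_def A_RCOSETS_def' a_r_coset_def')

text \<open>Since \<open>f\<close> sends boundaries to boundaries, every representative gives the
  same coset, and the union defining \<open>homology_map\<close> collapses.\<close>

lemma homology_map_coset:
  assumes "chain_map R C D f" "a \<in> carrier (obj C i)"
  shows "homology_map D f i (boundaries C i +>\<^bsub>obj C i\<^esub> a) = boundaries D i +>\<^bsub>obj D i\<^esub> f i a"
proof -
  have C: "chain_complex R C" and D: "chain_complex R D"
    and f: "\<And>i. f i \<in> mod_hom R (obj C i) (obj D i)"
    and comm: "\<And>i x. x \<in> carrier (obj C i) \<Longrightarrow> f (i - 1) (diff C i x) = diff D i (f i x)"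
    using assms(1) by (auto simp: chain_map_def)
  interpret Ci: module R "obj C i" using C by (rule chain_complex_module)
  note BC = submodule_boundaries[OF C, of i] and BD = submodule_boundaries[OF D, of i]
  note mC = chain_complex_module[OF C] and mD = chain_complex_module[OF D]
  have "boundaries D i +>\<^bsub>obj D i\<^esub> f i b = boundaries D i +>\<^bsub>obj D i\<^esub> f i a"
    if "b \<in> boundaries C i +>\<^bsub>obj C i\<^esub> a" for b
  proof -
    have b: "b \<in> carrier (obj C i)" "b \<ominus>\<^bsub>obj C i\<^esub> a \<in> boundaries C i"
      using that mem_coset_iff[OF mC BC assms(2)] by auto
    then obtain c where c: "c \<in> carrier (obj C (i + 1))" "b \<ominus>\<^bsub>obj C i\<^esub> a = diff C (i + 1) c"
      by (auto simp: boundaries_def)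
    have "f i b \<ominus>\<^bsub>obj D i\<^esub> f i a = f i (b \<ominus>\<^bsub>obj C i\<^esub> a)"
      using mod_hom_minus[OF mC mD f b(1) assms(2)] by simp
    also have "\<dots> = diff D (i + 1) (f (i + 1) c)"
      using comm[OF c(1)] c(2) by simp
    also have "\<dots> \<in> boundaries D i"
      unfolding boundaries_def using mod_hom_closed[OF f c(1)] by blast
    finally show ?thesis
      using coset_eq_iff[OF mD BD] mod_hom_closed[OF f] b(1) assms(2) by simp
  qed
  then have "homology_map D f i (boundaries C i +>\<^bsub>obj C i\<^esub> a)
      = (\<Union>b\<in>boundaries C i +>\<^bsub>obj C i\<^esub> a. boundaries D i +>\<^bsub>obj D i\<^esub> f i a)"
    unfolding homology_map_def by (rule SUP_cong[OF refl])
  also have "\<dots> = boundaries D i +>\<^bsub>obj D i\<^esub> f i a"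
    by (rule UN_const[OF coset_self[OF mC BC assms(2)]])
  finally show ?thesis .
qed

text \<open>The long exact sequence of the kernel, \<open>C\<close> and \<open>D\<close>, carried
  out as a diagram chase: acyclicity of the kernel corrects a preimage of a cycle to a cycle, and a
  cycle with bounding image to a boundary.\<close>

lemma quasi_iso_if_acyclic_kernel:
  assumes f: "chain_map R C D f"
    and surj: "\<And>i. f i ` carrier (obj C i) = carrier (obj D i)"
    and ker: "\<And>i x. x \<in> carrier (obj C i) \<Longrightarrow> f i x = \<zero>\<^bsub>obj D i\<^esub> \<Longrightarrow>
        diff C i x = \<zero>\<^bsub>obj C (i - 1)\<^esub> \<Longrightarrow>
        \<exists>w\<in>carrier (obj C (i + 1)). f (i + 1) w = \<zero>\<^bsub>obj D (i + 1)\<^esub> \<and> diff C (i + 1) w = x"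
  shows "quasi_iso R C D f"
proof -
  have C: "chain_complex R C" and D: "chain_complex R D"
    and fh: "\<And>i. f i \<in> mod_hom R (obj C i) (obj D i)"
    and comm: "\<And>i x. x \<in> carrier (obj C i) \<Longrightarrow> f (i - 1) (diff C i x) = diff D i (f i x)"
    using f by (auto simp: chain_map_def)
  note mC = chain_complex_module[OF C] and mD = chain_complex_module[OF D]
    and dC = chain_complex_hom[OF C] and dD = chain_complex_hom[OF D]
    and BC = submodule_boundaries[OF C] and BD = submodule_boundaries[OF D]
    and fc = mod_hom_closed[OF fh] and dCc = mod_hom_closed[OF dC]
  have "bij_betw (homology_map D f i) (carrier (homology C i)) (carrier (homology D i))" for i
  proof -
    interpret Ci: module R "obj C i" by (rule mC)
    interpret Ci1: module R "obj C (i - 1)" by (rule mC)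
    interpret Di: module R "obj D i" by (rule mD)
    have fcyc: "f i a \<in> cycles D i" if "a \<in> cycles C i" for a
      using that comm[of a i] mod_hom_zero[OF mC mD fh, of "i - 1"] fc[of a i]
      by (auto simp: cycles_def mod_ker_def)
    have inj: "inj_on (homology_map D f i) (carrier (homology C i))"
    proof (rule inj_onI)
      fix A B assume "A \<in> carrier (homology C i)" "B \<in> carrier (homology C i)"
        and eq: "homology_map D f i A = homology_map D f i B"
      then obtain a b where a: "a \<in> cycles C i" "A = boundaries C i +>\<^bsub>obj C i\<^esub> a"
        and b: "b \<in> cycles C i" "B = boundaries C i +>\<^bsub>obj C i\<^esub> b"
        by (auto simp: homology_carrier)
      note ac = cycles_carrier[OF a(1)] and bc = cycles_carrier[OF b(1)]
      define z where "z = a \<ominus>\<^bsub>obj C i\<^esub> b"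
      have z: "z \<in> carrier (obj C i)" using ac bc by (simp add: z_def)
      have "diff C i z = diff C i a \<ominus>\<^bsub>obj C (i - 1)\<^esub> diff C i b"
        unfolding z_def using ac bc by (rule mod_hom_minus[OF mC mC dC])
      then have dz: "diff C i z = \<zero>\<^bsub>obj C (i - 1)\<^esub>"
        using a(1) b(1) by (simp add: cycles_def mod_ker_def Ci1.minus_eq)
      have "f i a \<ominus>\<^bsub>obj D i\<^esub> f i b \<in> boundaries D i"
        using eq fc[OF ac] fc[OF bc] coset_eq_iff[OF mD BD]
        by (simp add: a(2) b(2) homology_map_coset[OF f ac] homology_map_coset[OF f bc])
      moreover have "f i z = f i a \<ominus>\<^bsub>obj D i\<^esub> f i b"
        unfolding z_def using ac bc by (rule mod_hom_minus[OF mC mD fh])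
      ultimately obtain y where y: "y \<in> carrier (obj D (i + 1))" "f i z = diff D (i + 1) y"
        by (auto simp: boundaries_def)
      from y(1) surj[of "i + 1"] obtain c where c: "c \<in> carrier (obj C (i + 1))" "y = f (i + 1) c"
        by auto
      have dc: "diff C (i + 1) c \<in> carrier (obj C i)" using dCc[OF c(1)] by simp
      \<comment> \<open>Subtracting the boundary of a preimage of \<open>y\<close> moves
        \<open>z\<close> into the kernel of \<open>f\<close> without changing its class, so that
        \<open>ker\<close> applies.\<close>
      define u where "u = z \<ominus>\<^bsub>obj C i\<^esub> diff C (i + 1) c"
      have u: "u \<in> carrier (obj C i)" using z dc by (simp add: u_def)
      have "f i u = f i z \<ominus>\<^bsub>obj D i\<^esub> f i (diff C (i + 1) c)"
        unfolding u_def using z dc by (rule mod_hom_minus[OF mC mD fh])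
      also have "f i (diff C (i + 1) c) = f i z"
        using comm[OF c(1)] y(2) c(2) by simp
      finally have fu: "f i u = \<zero>\<^bsub>obj D i\<^esub>"
        using fc[OF z] by (simp add: Di.minus_eq Di.r_neg)
      have "diff C i u = diff C i z \<ominus>\<^bsub>obj C (i - 1)\<^esub> diff C i (diff C (i + 1) c)"
        unfolding u_def using z dc by (rule mod_hom_minus[OF mC mC dC])
      also have "diff C i (diff C (i + 1) c) = \<zero>\<^bsub>obj C (i - 1)\<^esub>"
        using chain_complex_diff_diff[OF C c(1)] by simp
      finally have "diff C i u = \<zero>\<^bsub>obj C (i - 1)\<^esub>" using dz by (simp add: Ci1.minus_eq)
      from ker[OF u fu this] obtain w where w: "w \<in> carrier (obj C (i + 1))" "diff C (i + 1) w = u"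
        by auto
      have "z = u \<oplus>\<^bsub>obj C i\<^esub> diff C (i + 1) c"
        using z dc by (simp add: u_def Ci.minus_eq Ci.a_assoc Ci.l_neg)
      moreover have "u \<in> boundaries C i" "diff C (i + 1) c \<in> boundaries C i"
        using w c by (auto simp: boundaries_def)
      ultimately have "z \<in> boundaries C i" using Ci.submoduleE(5)[OF BC] by simp
      then show "A = B"
        using coset_eq_iff[OF mC BC ac bc] by (simp add: a(2) b(2) z_def)
    qed
    have "homology_map D f i ` carrier (homology C i) = carrier (homology D i)"
    proof (intro equalityI subsetI)
      fix B assume "B \<in> homology_map D f i ` carrier (homology C i)"
      then show "B \<in> carrier (homology D i)"
        using fcyc by (auto simp: homology_carrier homology_map_coset[OF f cycles_carrier])
    next
      fix B assume "B \<in> carrier (homology D i)"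
      then obtain b where b: "b \<in> cycles D i" "B = boundaries D i +>\<^bsub>obj D i\<^esub> b"
        by (auto simp: homology_carrier)
      from cycles_carrier[OF b(1)] surj obtain a where a: "a \<in> carrier (obj C i)" "b = f i a"
        by (metis imageE)
      \<comment> \<open>The defect of \<open>a\<close> from being a cycle is a cycle of the kernel,
        hence bounds some \<open>w\<close> in the kernel; replacing \<open>a\<close> by
        \<open>a - w\<close> leaves the image unchanged.\<close>
      define z where "z = diff C i a"
      have z: "z \<in> carrier (obj C (i - 1))" using dCc[OF a(1)] by (simp add: z_def)
      have fz: "f (i - 1) z = \<zero>\<^bsub>obj D (i - 1)\<^esub>"
        using comm[OF a(1)] b(1) a(2) by (simp add: z_def cycles_def mod_ker_def)
      have "diff C (i - 1) z = \<zero>\<^bsub>obj C (i - 1 - 1)\<^esub>"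
        using chain_complex_diff_diff[OF C a(1)] by (simp add: z_def)
      from ker[OF z fz this] obtain w where w: "w \<in> carrier (obj C i)" "f i w = \<zero>\<^bsub>obj D i\<^esub>"
        "diff C i w = z" by auto
      define v where "v = a \<ominus>\<^bsub>obj C i\<^esub> w"
      have v: "v \<in> carrier (obj C i)" using a(1) w(1) by (simp add: v_def)
      have "diff C i v = diff C i a \<ominus>\<^bsub>obj C (i - 1)\<^esub> diff C i w"
        unfolding v_def using a(1) w(1) by (rule mod_hom_minus[OF mC mC dC])
      then have "diff C i v = \<zero>\<^bsub>obj C (i - 1)\<^esub>"
        using z by (simp add: w(3) z_def[symmetric] Ci1.minus_eq Ci1.r_neg)
      then have vc: "v \<in> cycles C i" using v by (simp add: cycles_def mod_ker_def)
      have "f i v = f i a \<ominus>\<^bsub>obj D i\<^esub> f i w"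
        unfolding v_def using a(1) w(1) by (rule mod_hom_minus[OF mC mD fh])
      then have "f i v = b" using fc[OF a(1)] by (simp add: w(2) a(2) Di.minus_eq)
      then have "homology_map D f i (boundaries C i +>\<^bsub>obj C i\<^esub> v) = B"
        using homology_map_coset[OF f v] b(2) by simp
      then show "B \<in> homology_map D f i ` carrier (homology C i)"
        using vc unfolding homology_carrier by blast
    qed
    then show ?thesis using inj by (simp add: bij_betw_def)
  qed
  then show ?thesis using f by (simp add: quasi_iso_def)
qed

section \<open>Free modules and tensor products\<close>

lemma self_module_module:
  assumes "cring R"
  shows "module R (self_module R)"
proof -
  interpret R: cring R by fact
  show ?thesis
  proof (rule moduleI)
    show "abelian_group (self_module R)"
    proof (rule abelian_groupI)
      fix x assume "x \<in> carrier (self_module R)"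
      then show "\<exists>y\<in>carrier (self_module R). y \<oplus>\<^bsub>self_module R\<^esub> x = \<zero>\<^bsub>self_module R\<^esub>"
        by (intro bexI[of _ "\<ominus>\<^bsub>R\<^esub> x"]) (simp_all add: self_module_def R.l_neg)
    qed (simp_all add: self_module_def R.a_ac)
  qed (simp_all add: self_module_def assms R.l_distr R.r_distr R.m_assoc)
qed

lemma self_module_simps [simp]:
  "carrier (self_module R) = carrier R"
  "\<zero>\<^bsub>self_module R\<^esub> = \<zero>\<^bsub>R\<^esub>"
  "a \<oplus>\<^bsub>self_module R\<^esub> b = a \<oplus>\<^bsub>R\<^esub> b"
  "a \<odot>\<^bsub>self_module R\<^esub> b = a \<otimes>\<^bsub>R\<^esub> b"
  by (simp_all add: self_module_def)

lemma finsum_self_module: "finsum (self_module R) f A = finsum R f A"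
  by (simp add: finsum_def finprod_def self_module_def)

lemma smult_hom_self_module:
  assumes "module R N" "y \<in> carrier N"
  shows "(\<lambda>r. r \<odot>\<^bsub>N\<^esub> y) \<in> mod_hom R (self_module R) N"
proof -
  interpret N: module R N by fact
  show ?thesis
    by (rule mod_homI) (use assms(2) in \<open>simp_all add: N.smult_l_distr N.smult_assoc1\<close>)
qed

lemma free_module_module: "cring R \<Longrightarrow> module R (free_module R X)"
  unfolding free_module_def by (intro direct_sum_module self_module_module)

lemma free_module_closed: "\<phi> \<in> carrier (free_module R X) \<Longrightarrow> p \<in> X \<Longrightarrow> \<phi> p \<in> carrier R"
  unfolding free_module_def by (drule direct_sum_closed) auto

lemma free_module_finite_support:
  "\<phi> \<in> carrier (free_module R X) \<Longrightarrow> finite {p \<in> X. \<phi> p \<noteq> \<zero>\<^bsub>R\<^esub>}"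
  by (simp add: free_module_def direct_sum_carrier)

lemma free_basis_closed:
  assumes "cring R" "q \<in> X"
  shows "free_basis R X q \<in> carrier (free_module R X)"
proof -
  interpret R: cring R by fact
  have "{i \<in> X. free_basis R X q i \<noteq> \<zero>\<^bsub>R\<^esub>} \<subseteq> {q}" by (auto simp: free_basis_def)
  then have "finite {i \<in> X. free_basis R X q i \<noteq> \<zero>\<^bsub>R\<^esub>}" by (rule finite_subset) simp
  then show ?thesis
    by (auto simp: free_module_def direct_sum_carrier free_basis_def cong: conj_cong)
qed

text \<open>The sum runs over the support only: this makes it finite for an arbitrary
  \<open>X\<close>, and it is literally the sum that occurs in \<open>tensor_map\<close>.\<close>

definition linear_extension ::
    "('a, 'r) ring_scheme \<Rightarrow> ('a, 'c) module \<Rightarrow> 'p set \<Rightarrow> ('p \<Rightarrow> 'c) \<Rightarrow> ('p \<Rightarrow> 'a) \<Rightarrow> 'c" where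
  "linear_extension R N X b \<phi> = (\<Oplus>\<^bsub>N\<^esub>p\<in>{p \<in> X. \<phi> p \<noteq> \<zero>\<^bsub>R\<^esub>}. \<phi> p \<odot>\<^bsub>N\<^esub> b p)"

text \<open>The support changes under addition and scaling; enlarging it by zero terms brings the
  sums to be compared onto one finite index set.\<close>

lemma linear_extension_superset:
  assumes "module R N" "b \<in> X \<rightarrow> carrier N" "\<phi> \<in> X \<rightarrow> carrier R"
    and "finite Y" "Y \<subseteq> X" "{p \<in> X. \<phi> p \<noteq> \<zero>\<^bsub>R\<^esub>} \<subseteq> Y"
  shows "linear_extension R N X b \<phi> = (\<Oplus>\<^bsub>N\<^esub>p\<in>Y. \<phi> p \<odot>\<^bsub>N\<^esub> b p)"
proof -
  interpret N: module R N by fact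
  have c: "\<phi> p \<odot>\<^bsub>N\<^esub> b p \<in> carrier N" if "p \<in> X" for p
    using assms(2,3) that by (intro N.smult_closed) auto
  show ?thesis
    unfolding linear_extension_def
  proof (rule N.add.finprod_mono_neutral_cong_left)
    fix i assume "i \<in> Y - {p \<in> X. \<phi> p \<noteq> \<zero>\<^bsub>R\<^esub>}"
    then have "i \<in> X" "\<phi> i = \<zero>\<^bsub>R\<^esub>" using assms(5) by auto
    then show "\<phi> i \<odot>\<^bsub>N\<^esub> b i = \<zero>\<^bsub>N\<^esub>" using assms(2) by (simp add: Pi_def)
  qed (use assms c in auto)
qed

lemma linear_extension_hom:
  assumes "module R N" "b \<in> X \<rightarrow> carrier N"
  shows "linear_extension R N X b \<in> mod_hom R (free_module R X) N"
proof -
  interpret N: module R N by fact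
  interpret F: module R "free_module R X" by (rule free_module_module) unfold_locales
  let ?F = "free_module R X"
  let ?s = "\<lambda>\<phi>. {p \<in> X. \<phi> p \<noteq> \<zero>\<^bsub>R\<^esub>}"
  have c: "r \<odot>\<^bsub>N\<^esub> b p \<in> carrier N" if "p \<in> X" "r \<in> carrier R" for p r
    using assms(2) that by (intro N.smult_closed) auto
  have fc: "\<phi> \<in> X \<rightarrow> carrier R" if "\<phi> \<in> carrier ?F" for \<phi>
    using free_module_closed[OF that] by auto
  show ?thesis
  proof (rule mod_homI)
    fix \<phi> assume \<phi>: "\<phi> \<in> carrier ?F"
    show "linear_extension R N X b \<phi> \<in> carrier N"
      unfolding linear_extension_def
      by (rule N.finsum_closed) (use c free_module_closed[OF \<phi>] in auto)
    fix \<psi> assume \<psi>: "\<psi> \<in> carrier ?F"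
    let ?Y = "?s \<phi> \<union> ?s \<psi>"
    have Y: "finite ?Y" "?Y \<subseteq> X"
      using free_module_finite_support[OF \<phi>] free_module_finite_support[OF \<psi>] by auto
    have val: "(\<phi> \<oplus>\<^bsub>?F\<^esub> \<psi>) p = \<phi> p \<oplus>\<^bsub>R\<^esub> \<psi> p" if "p \<in> X" for p
      using that by (simp add: free_module_def direct_sum_add)
    have sub: "?s (\<phi> \<oplus>\<^bsub>?F\<^esub> \<psi>) \<subseteq> ?Y" by (auto simp: val)
    have "linear_extension R N X b (\<phi> \<oplus>\<^bsub>?F\<^esub> \<psi>) = (\<Oplus>\<^bsub>N\<^esub>p\<in>?Y. (\<phi> \<oplus>\<^bsub>?F\<^esub> \<psi>) p \<odot>\<^bsub>N\<^esub> b p)"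
      by (rule linear_extension_superset[OF assms fc Y sub]) (use \<phi> \<psi> in simp)
    also have "\<dots> = (\<Oplus>\<^bsub>N\<^esub>p\<in>?Y. \<phi> p \<odot>\<^bsub>N\<^esub> b p \<oplus>\<^bsub>N\<^esub> \<psi> p \<odot>\<^bsub>N\<^esub> b p)"
    proof (rule N.finsum_cong'[OF refl])
      fix p assume "p \<in> ?Y"
      then have p: "p \<in> X" by auto
      then have "b p \<in> carrier N" using assms(2) by auto
      then show "(\<phi> \<oplus>\<^bsub>?F\<^esub> \<psi>) p \<odot>\<^bsub>N\<^esub> b p = \<phi> p \<odot>\<^bsub>N\<^esub> b p \<oplus>\<^bsub>N\<^esub> \<psi> p \<odot>\<^bsub>N\<^esub> b p"
        using free_module_closed[OF \<phi> p] free_module_closed[OF \<psi> p]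
        by (simp add: val[OF p] N.smult_l_distr)
    qed (use c free_module_closed[OF \<phi>] free_module_closed[OF \<psi>] in auto)
    also have "\<dots> = (\<Oplus>\<^bsub>N\<^esub>p\<in>?Y. \<phi> p \<odot>\<^bsub>N\<^esub> b p) \<oplus>\<^bsub>N\<^esub> (\<Oplus>\<^bsub>N\<^esub>p\<in>?Y. \<psi> p \<odot>\<^bsub>N\<^esub> b p)"
      by (rule N.finsum_addf) (use c free_module_closed[OF \<phi>] free_module_closed[OF \<psi>] in auto)
    also have "(\<Oplus>\<^bsub>N\<^esub>p\<in>?Y. \<phi> p \<odot>\<^bsub>N\<^esub> b p) = linear_extension R N X b \<phi>"
      by (rule linear_extension_superset[OF assms fc[OF \<phi>] Y, symmetric]) auto
    also have "(\<Oplus>\<^bsub>N\<^esub>p\<in>?Y. \<psi> p \<odot>\<^bsub>N\<^esub> b p) = linear_extension R N X b \<psi>"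
      by (rule linear_extension_superset[OF assms fc[OF \<psi>] Y, symmetric]) auto
    finally show "linear_extension R N X b (\<phi> \<oplus>\<^bsub>?F\<^esub> \<psi>)
      = linear_extension R N X b \<phi> \<oplus>\<^bsub>N\<^esub> linear_extension R N X b \<psi>" .
  next
    fix r \<phi> assume r: "r \<in> carrier R" and \<phi>: "\<phi> \<in> carrier ?F"
    let ?Y = "?s \<phi>"
    have Y: "finite ?Y" "?Y \<subseteq> X" using free_module_finite_support[OF \<phi>] by auto
    have val: "(r \<odot>\<^bsub>?F\<^esub> \<phi>) p = r \<otimes>\<^bsub>R\<^esub> \<phi> p" if "p \<in> X" for p
      using that by (simp add: free_module_def direct_sum_smult)
    have sub: "?s (r \<odot>\<^bsub>?F\<^esub> \<phi>) \<subseteq> ?Y" using r by (auto simp: val)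
    have "linear_extension R N X b (r \<odot>\<^bsub>?F\<^esub> \<phi>) = (\<Oplus>\<^bsub>N\<^esub>p\<in>?Y. (r \<odot>\<^bsub>?F\<^esub> \<phi>) p \<odot>\<^bsub>N\<^esub> b p)"
      by (rule linear_extension_superset[OF assms fc Y sub]) (use \<phi> r in simp)
    also have "\<dots> = (\<Oplus>\<^bsub>N\<^esub>p\<in>?Y. r \<odot>\<^bsub>N\<^esub> (\<phi> p \<odot>\<^bsub>N\<^esub> b p))"
    proof (rule N.finsum_cong'[OF refl])
      fix p assume "p \<in> ?Y"
      then have p: "p \<in> X" by auto
      then have "b p \<in> carrier N" using assms(2) by auto
      then show "(r \<odot>\<^bsub>?F\<^esub> \<phi>) p \<odot>\<^bsub>N\<^esub> b p = r \<odot>\<^bsub>N\<^esub> (\<phi> p \<odot>\<^bsub>N\<^esub> b p)"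
        using free_module_closed[OF \<phi> p] r by (simp add: val[OF p] N.smult_assoc1)
    qed (use c free_module_closed[OF \<phi>] r in auto)
    also have "\<dots> = r \<odot>\<^bsub>N\<^esub> linear_extension R N X b \<phi>"
      unfolding linear_extension_def
      by (rule N.finsum_smult_ldistr[symmetric]) (use Y r c free_module_closed[OF \<phi>] in auto)
    finally show "linear_extension R N X b (r \<odot>\<^bsub>?F\<^esub> \<phi>) = r \<odot>\<^bsub>N\<^esub> linear_extension R N X b \<phi>" .
  qed
qed

lemma linear_extension_basis:
  assumes "module R N" "b \<in> X \<rightarrow> carrier N" "q \<in> X"
  shows "linear_extension R N X b (free_basis R X q) = b q"
proof -
  interpret N: module R N by fact
  have cr: "cring R" by unfold_locales
  have "linear_extension R N X b (free_basis R X q) = (\<Oplus>\<^bsub>N\<^esub>p\<in>{q}. free_basis R X q p \<odot>\<^bsub>N\<^esub> b p)"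
    by (rule linear_extension_superset[OF assms(1,2)])
      (use assms(3) free_module_closed[OF free_basis_closed[OF cr assms(3)]] in
        \<open>auto simp: free_basis_def\<close>)
  also have "\<dots> = b q"
    using assms(2,3) by (simp add: free_basis_def Pi_def)
  finally show ?thesis .
qed

lemma free_module_expand:
  assumes "cring R" "\<phi> \<in> carrier (free_module R X)"
  shows "linear_extension R (free_module R X) X (free_basis R X) \<phi> = \<phi>"
proof -
  interpret R: cring R by fact
  interpret F: module R "free_module R X" by (rule free_module_module) fact
  let ?F = "free_module R X" and ?s = "{p \<in> X. \<phi> p \<noteq> \<zero>\<^bsub>R\<^esub>}"
  note fin = free_module_finite_support[OF assms(2)]
  have b: "free_basis R X \<in> X \<rightarrow> carrier ?F" using free_basis_closed[OF assms(1)] by auto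
  have bc: "(\<lambda>p. \<phi> p \<odot>\<^bsub>?F\<^esub> free_basis R X p) \<in> ?s \<rightarrow> carrier ?F"
    using b free_module_closed[OF assms(2)] by (auto intro!: F.smult_closed)
  have le: "linear_extension R ?F X (free_basis R X) \<phi> \<in> carrier ?F"
    by (rule mod_hom_closed[OF linear_extension_hom[OF F.module_axioms b] assms(2)])
  show ?thesis
  proof (rule direct_sum_eqI[OF le[unfolded free_module_def[of R X]] assms(2)[unfolded free_module_def],
        folded free_module_def])
    fix q assume q: "q \<in> X"
    have proj: "(\<lambda>f. f q) \<in> mod_hom R ?F (self_module R)"
      unfolding free_module_def by (rule direct_sum_hom_proj[OF q])
    have "linear_extension R ?F X (free_basis R X) \<phi> q
        = (\<Oplus>\<^bsub>self_module R\<^esub>p\<in>?s. (\<phi> p \<odot>\<^bsub>?F\<^esub> free_basis R X p) q)"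
      unfolding linear_extension_def
      by (rule mod_hom_finsum[OF F.module_axioms self_module_module[OF assms(1)] proj fin bc])
    also have "\<dots> = (\<Oplus>\<^bsub>R\<^esub>p\<in>?s. if q = p then \<phi> p else \<zero>\<^bsub>R\<^esub>)"
      unfolding finsum_self_module
      by (rule R.finsum_cong')
        (use q free_module_closed[OF assms(2)] in
          \<open>auto simp: free_module_def direct_sum_smult free_basis_def\<close>)
    also have "\<dots> = \<phi> q"
    proof (cases "q \<in> ?s")
      case True
      then show ?thesis
        using fin free_module_closed[OF assms(2)] by (intro R.finsum_singleton) auto
    next
      case False
      then have "(\<Oplus>\<^bsub>R\<^esub>p\<in>?s. if q = p then \<phi> p else \<zero>\<^bsub>R\<^esub>) = \<zero>\<^bsub>R\<^esub>"
        by (intro R.add.finprod_one_eqI) auto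
      then show ?thesis using False q by simp
    qed
    finally show "linear_extension R ?F X (free_basis R X) \<phi> q = \<phi> q" .
  qed
qed

lemma free_module_hom_eq:
  assumes "module R N" "f \<in> mod_hom R (free_module R X) N" "g \<in> mod_hom R (free_module R X) N"
    and "\<And>p. p \<in> X \<Longrightarrow> f (free_basis R X p) = g (free_basis R X p)"
    and "\<phi> \<in> carrier (free_module R X)"
  shows "f \<phi> = g \<phi>"
proof -
  interpret N: module R N by fact
  have cr: "cring R" by unfold_locales
  interpret F: module R "free_module R X" by (rule free_module_module) fact
  let ?F = "free_module R X" and ?s = "{p \<in> X. \<phi> p \<noteq> \<zero>\<^bsub>R\<^esub>}"
  note fin = free_module_finite_support[OF assms(5)]
  have b: "free_basis R X p \<in> carrier ?F" if "p \<in> X" for p using free_basis_closed[OF cr that] .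
  have bc: "(\<lambda>p. \<phi> p \<odot>\<^bsub>?F\<^esub> free_basis R X p) \<in> ?s \<rightarrow> carrier ?F"
    using b free_module_closed[OF assms(5)] by (auto intro!: F.smult_closed)
  have ext: "h \<phi> = (\<Oplus>\<^bsub>N\<^esub>p\<in>?s. \<phi> p \<odot>\<^bsub>N\<^esub> h (free_basis R X p))" if h: "h \<in> mod_hom R ?F N" for h
  proof -
    have "h \<phi> = h (linear_extension R ?F X (free_basis R X) \<phi>)"
      by (simp only: free_module_expand[OF cr assms(5)])
    also have "\<dots> = (\<Oplus>\<^bsub>N\<^esub>p\<in>?s. h (\<phi> p \<odot>\<^bsub>?F\<^esub> free_basis R X p))"
      unfolding linear_extension_def
      by (rule mod_hom_finsum[OF F.module_axioms assms(1) h fin bc])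
    also have "\<dots> = (\<Oplus>\<^bsub>N\<^esub>p\<in>?s. \<phi> p \<odot>\<^bsub>N\<^esub> h (free_basis R X p))"
      by (rule N.finsum_cong')
        (use b free_module_closed[OF assms(5)] mod_hom_closed[OF h] in
          \<open>auto simp: mod_hom_smult[OF h]\<close>)
    finally show ?thesis .
  qed
  show ?thesis
    unfolding ext[OF assms(2)] ext[OF assms(3)]
    by (rule N.finsum_cong')
      (use assms(4) b free_module_closed[OF assms(5)] mod_hom_closed[OF assms(3)] in auto)
qed

section \<open>Tensor products and their universal property\<close>

lemma submodule_generated_submodule:
  assumes "module R M" "S \<subseteq> carrier M"
  shows "submodule (submodule_generated R M S) R M"
proof -
  interpret M: module R M by fact
  have "submodule (carrier M) R M" by (rule M.carrier_is_submodule)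
  then have sub: "submodule_generated R M S \<subseteq> carrier M"
    using assms(2) by (auto simp: submodule_generated_def)
  show ?thesis
  proof (rule M.submoduleI[OF sub])
    show "\<zero>\<^bsub>M\<^esub> \<in> submodule_generated R M S"
      unfolding submodule_generated_def
      using subgroup.one_closed[OF submodule.axioms(1)] by fastforce
  qed (auto simp: submodule_generated_def M.submoduleE)
qed

lemma submodule_generated_incl: "S \<subseteq> submodule_generated R M S"
  and submodule_generated_least: "submodule H R M \<Longrightarrow> S \<subseteq> H \<Longrightarrow> submodule_generated R M S \<subseteq> H"
  by (auto simp: submodule_generated_def)

lemma module_eq_if_minus_zero:
  assumes "module R M" "x \<in> carrier M" "y \<in> carrier M" "x \<ominus>\<^bsub>M\<^esub> y = \<zero>\<^bsub>M\<^esub>"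
  shows "x = y"
proof -
  interpret M: module R M by fact
  have "x = (x \<ominus>\<^bsub>M\<^esub> y) \<oplus>\<^bsub>M\<^esub> y" using assms(2,3) by (simp add: M.minus_eq M.a_assoc M.l_neg)
  then show ?thesis using assms(3,4) by simp
qed

lemma free_basis_simps: "q \<in> X \<Longrightarrow> free_basis R X p q = (if q = p then \<one>\<^bsub>R\<^esub> else \<zero>\<^bsub>R\<^esub>)"
  by (simp add: free_basis_def)

locale tensor_product = M: module R M + N: module R N
  for R :: "('a, 'r) ring_scheme" and M :: "('a, 'b) module" and N :: "('a, 'c) module"
begin

abbreviation "F \<equiv> tensor_free R M N"
abbreviation "e \<equiv> pure_sym R M N"
abbreviation "rel \<equiv> tensor_rel R M N"
abbreviation "T \<equiv> tensor_module R M N"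
abbreviation cls where "cls \<phi> \<equiv> rel +>\<^bsub>F\<^esub> \<phi>"
abbreviation pure where "pure x y \<equiv> cls (e x y)"

text \<open>The generating set of \<open>tensor_rel\<close>, copied so that \<open>rel_eq\<close>
  holds by unfolding and single relations can be cited.\<close>

definition gens :: "('b \<times> 'c \<Rightarrow> 'a) set" where
  "gens =
       ({e (x \<oplus>\<^bsub>M\<^esub> x') y \<ominus>\<^bsub>F\<^esub> (e x y \<oplus>\<^bsub>F\<^esub> e x' y) | x x' y.
           x \<in> carrier M \<and> x' \<in> carrier M \<and> y \<in> carrier N} \<union>
        {e x (y \<oplus>\<^bsub>N\<^esub> y') \<ominus>\<^bsub>F\<^esub> (e x y \<oplus>\<^bsub>F\<^esub> e x y') | x y y'.
           x \<in> carrier M \<and> y \<in> carrier N \<and> y' \<in> carrier N} \<union>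
        {e (r \<odot>\<^bsub>M\<^esub> x) y \<ominus>\<^bsub>F\<^esub> (r \<odot>\<^bsub>F\<^esub> e x y) | r x y.
           r \<in> carrier R \<and> x \<in> carrier M \<and> y \<in> carrier N} \<union>
        {e x (r \<odot>\<^bsub>N\<^esub> y) \<ominus>\<^bsub>F\<^esub> (r \<odot>\<^bsub>F\<^esub> e x y) | r x y.
           r \<in> carrier R \<and> x \<in> carrier M \<and> y \<in> carrier N})"

lemma
  assumes "x \<in> carrier M" "y \<in> carrier N"
  shows gens_add_left: "x' \<in> carrier M \<Longrightarrow> e (x \<oplus>\<^bsub>M\<^esub> x') y \<ominus>\<^bsub>F\<^esub> (e x y \<oplus>\<^bsub>F\<^esub> e x' y) \<in> gens"
    and gens_add_right: "y' \<in> carrier N \<Longrightarrow> e x (y \<oplus>\<^bsub>N\<^esub> y') \<ominus>\<^bsub>F\<^esub> (e x y \<oplus>\<^bsub>F\<^esub> e x y') \<in> gens"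
    and gens_smult_left: "r \<in> carrier R \<Longrightarrow> e (r \<odot>\<^bsub>M\<^esub> x) y \<ominus>\<^bsub>F\<^esub> (r \<odot>\<^bsub>F\<^esub> e x y) \<in> gens"
    and gens_smult_right: "r \<in> carrier R \<Longrightarrow> e x (r \<odot>\<^bsub>N\<^esub> y) \<ominus>\<^bsub>F\<^esub> (r \<odot>\<^bsub>F\<^esub> e x y) \<in> gens"
  unfolding gens_def using assms by blast+

lemma rel_eq: "rel = submodule_generated R F gens"
  unfolding tensor_rel_def gens_def Let_def by (rule refl)

lemma cring: "cring R" by unfold_locales

lemma F_module: "module R F"
  unfolding tensor_free_def by (rule free_module_module[OF cring])

sublocale F: module R F by (rule F_module)

lemma e_closed: "x \<in> carrier M \<Longrightarrow> y \<in> carrier N \<Longrightarrow> e x y \<in> carrier F"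
  by (simp add: pure_sym_def tensor_free_def free_basis_closed[OF cring])

lemma gens_closed: "gens \<subseteq> carrier F"
  unfolding gens_def
  by (auto intro!: F.minus_closed F.a_closed F.smult_closed e_closed)

lemma rel_submodule: "submodule rel R F"
  unfolding rel_eq by (rule submodule_generated_submodule[OF F_module gens_closed])

lemma gens_rel: "g \<in> gens \<Longrightarrow> g \<in> rel"
  unfolding rel_eq by (rule subsetD[OF submodule_generated_incl])

lemma T_module: "module R T"
  unfolding tensor_module_def by (rule quot_module_module[OF F_module rel_submodule])

lemma T_carrier: "carrier T = cls ` carrier F"
  unfolding tensor_module_def by (rule quot_module_carrier[OF F_module rel_submodule])

lemma cls_hom: "cls \<in> mod_hom R F T"
  unfolding tensor_module_def by (rule quot_module_hom[OF F_module rel_submodule])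

lemma cls_eq: "a \<in> carrier F \<Longrightarrow> b \<in> carrier F \<Longrightarrow> a \<ominus>\<^bsub>F\<^esub> b \<in> gens \<Longrightarrow> cls a = cls b"
  by (subst coset_eq_iff[OF F_module rel_submodule]) (auto intro: gens_rel)

lemma pure_closed: "x \<in> carrier M \<Longrightarrow> y \<in> carrier N \<Longrightarrow> pure x y \<in> carrier T"
  by (rule mod_hom_closed[OF cls_hom e_closed])

lemma pure_hom_left:
  assumes y: "y \<in> carrier N"
  shows "(\<lambda>x. pure x y) \<in> mod_hom R M T"
proof (rule mod_homI)
  fix x x' assume x: "x \<in> carrier M" "x' \<in> carrier M"
  have "pure (x \<oplus>\<^bsub>M\<^esub> x') y = cls (e x y \<oplus>\<^bsub>F\<^esub> e x' y)"
    by (rule cls_eq) (use x y in \<open>simp_all add: e_closed gens_add_left\<close>)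
  also have "\<dots> = pure x y \<oplus>\<^bsub>T\<^esub> pure x' y"
    by (rule mod_hom_add[OF cls_hom]) (use x y in \<open>auto simp: e_closed\<close>)
  finally show "pure (x \<oplus>\<^bsub>M\<^esub> x') y = pure x y \<oplus>\<^bsub>T\<^esub> pure x' y" .
next
  fix r x assume x: "r \<in> carrier R" "x \<in> carrier M"
  have "pure (r \<odot>\<^bsub>M\<^esub> x) y = cls (r \<odot>\<^bsub>F\<^esub> e x y)"
    by (rule cls_eq) (use x y in \<open>simp_all add: e_closed gens_smult_left\<close>)
  also have "\<dots> = r \<odot>\<^bsub>T\<^esub> pure x y"
    by (rule mod_hom_smult[OF cls_hom]) (use x y in \<open>auto simp: e_closed\<close>)
  finally show "pure (r \<odot>\<^bsub>M\<^esub> x) y = r \<odot>\<^bsub>T\<^esub> pure x y" .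
qed (rule pure_closed[OF _ y])

lemma pure_hom_right:
  assumes x: "x \<in> carrier M"
  shows "(\<lambda>y. pure x y) \<in> mod_hom R N T"
proof (rule mod_homI)
  fix y y' assume y: "y \<in> carrier N" "y' \<in> carrier N"
  have "pure x (y \<oplus>\<^bsub>N\<^esub> y') = cls (e x y \<oplus>\<^bsub>F\<^esub> e x y')"
    by (rule cls_eq) (use x y in \<open>simp_all add: e_closed gens_add_right\<close>)
  also have "\<dots> = pure x y \<oplus>\<^bsub>T\<^esub> pure x y'"
    by (rule mod_hom_add[OF cls_hom]) (use x y in \<open>auto simp: e_closed\<close>)
  finally show "pure x (y \<oplus>\<^bsub>N\<^esub> y') = pure x y \<oplus>\<^bsub>T\<^esub> pure x y'" .
next
  fix r y assume y: "r \<in> carrier R" "y \<in> carrier N"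
  have "pure x (r \<odot>\<^bsub>N\<^esub> y) = cls (r \<odot>\<^bsub>F\<^esub> e x y)"
    by (rule cls_eq) (use x y in \<open>simp_all add: e_closed gens_smult_right\<close>)
  also have "\<dots> = r \<odot>\<^bsub>T\<^esub> pure x y"
    by (rule mod_hom_smult[OF cls_hom]) (use x y in \<open>auto simp: e_closed\<close>)
  finally show "pure x (r \<odot>\<^bsub>N\<^esub> y) = r \<odot>\<^bsub>T\<^esub> pure x y" .
qed (rule pure_closed[OF x])

text \<open>The universal property, phrased on the free module \<open>F\<close> instead of the
  quotient, so that no map out of cosets has to be defined. The relations are sent to zero because
  the kernel of \<open>ev\<close> is a submodule and bilinearity of \<open>b\<close> puts every
  generator into it.\<close>

lemma bilinear_extension:
  assumes L: "module R L"
    and left: "\<And>y. y \<in> carrier N \<Longrightarrow> (\<lambda>x. b x y) \<in> mod_hom R M L"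
    and right: "\<And>x. x \<in> carrier M \<Longrightarrow> (\<lambda>y. b x y) \<in> mod_hom R N L"
  defines "ev \<equiv> linear_extension R L (carrier M \<times> carrier N) (\<lambda>p. b (fst p) (snd p))"
  shows "ev \<in> mod_hom R F L"
    and "\<And>x y. x \<in> carrier M \<Longrightarrow> y \<in> carrier N \<Longrightarrow> ev (e x y) = b x y"
    and "\<And>\<phi>. \<phi> \<in> rel \<Longrightarrow> ev \<phi> = \<zero>\<^bsub>L\<^esub>"
proof -
  interpret L: module R L by fact
  have b: "(\<lambda>p. b (fst p) (snd p)) \<in> carrier M \<times> carrier N \<rightarrow> carrier L"
    using mod_hom_closed[OF left] by auto
  have bc: "b x y \<in> carrier L" if "x \<in> carrier M" "y \<in> carrier N" for x y
    using mod_hom_closed[OF left] that by auto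
  show hom: "ev \<in> mod_hom R F L"
    unfolding ev_def tensor_free_def by (rule linear_extension_hom[OF L b])
  show ev: "ev (e x y) = b x y" if "x \<in> carrier M" "y \<in> carrier N" for x y
    unfolding ev_def pure_sym_def using linear_extension_basis[OF L b, of "(x, y)"] that by simp
  have "rel \<subseteq> mod_ker F L ev"
    unfolding rel_eq
  proof (rule submodule_generated_least[OF submodule_ker[OF F_module L hom]], rule subsetI)
    fix g assume g: "g \<in> gens"
    note ev_simps = mod_hom_minus[OF F_module L hom] mod_hom_add[OF hom] mod_hom_smult[OF hom]
    have "ev g = \<zero>\<^bsub>L\<^esub>"
      using g unfolding gens_def
      by (elim UnE CollectE exE conjE)
        (simp_all add: ev_simps ev e_closed bc mod_hom_add[OF left] mod_hom_add[OF right]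
          mod_hom_smult[OF left] mod_hom_smult[OF right] L.minus_eq L.r_neg)
    then show "g \<in> mod_ker F L ev" using subsetD[OF gens_closed g] by (simp add: mod_ker_def)
  qed
  then show "ev \<phi> = \<zero>\<^bsub>L\<^esub>" if "\<phi> \<in> rel" for \<phi>
    using subsetD[OF \<open>rel \<subseteq> mod_ker F L ev\<close> that] by (simp add: mod_ker_def)
qed

lemma F_hom_eq:
  assumes "module R L" "f \<in> mod_hom R F L" "g \<in> mod_hom R F L"
    and "\<And>x y. x \<in> carrier M \<Longrightarrow> y \<in> carrier N \<Longrightarrow> f (e x y) = g (e x y)"
    and "\<phi> \<in> carrier F"
  shows "f \<phi> = g \<phi>"
  by (rule free_module_hom_eq[OF assms(1), of f "carrier M \<times> carrier N" g])
    (use assms(2-5) in \<open>auto simp: tensor_free_def pure_sym_def\<close>)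

end

section \<open>Tensoring a free module of finite rank\<close>

locale free_tensor_product = N: module R N
  for R :: "('a, 'r) ring_scheme" and I :: "'i set" and N :: "('a, 'c) module" +
  assumes finite_I: "finite I"
begin

abbreviation "A \<equiv> free_module R I"
abbreviation "D \<equiv> direct_sum I (\<lambda>_. N)"

lemma cring': "cring R" by unfold_locales

lemma A_module: "module R A" by (rule free_module_module[OF cring'])

sublocale tensor_product R A N
  unfolding tensor_product_def using A_module N.module_axioms by blast

lemma D_module: "module R D"
  by (rule direct_sum_module[OF cring']) (rule N.module_axioms)

definition scale :: "('i \<Rightarrow> 'a) \<Rightarrow> 'c \<Rightarrow> 'i \<Rightarrow> 'c" where
  "scale u y = (\<lambda>i\<in>I. u i \<odot>\<^bsub>N\<^esub> y)"

text \<open>Lifts to \<open>F\<close> the isomorphism of \<open>A \<otimes> N\<close> with a finite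
  sum of copies of \<open>N\<close>; \<open>scale u y\<close> is the image of
  \<open>u \<otimes> y\<close>.\<close>

definition ev :: "(('i \<Rightarrow> 'a) \<times> 'c \<Rightarrow> 'a) \<Rightarrow> 'i \<Rightarrow> 'c" where
  "ev = linear_extension R D (carrier A \<times> carrier N) (\<lambda>p. scale (fst p) (snd p))"

text \<open>The isomorphism in the opposite direction. It is the one used later, since it requires
  no choice of representatives of a coset.\<close>

definition to_tensor :: "('i \<Rightarrow> 'c) \<Rightarrow> (('i \<Rightarrow> 'a) \<times> 'c \<Rightarrow> 'a) set" where
  "to_tensor m = (\<Oplus>\<^bsub>T\<^esub>i\<in>I. pure (free_basis R I i) (m i))"

lemma A_proj: "i \<in> I \<Longrightarrow> (\<lambda>u. u i) \<in> mod_hom R A (self_module R)"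
  unfolding free_module_def by (rule direct_sum_hom_proj)

lemma scale_hom_left: "y \<in> carrier N \<Longrightarrow> (\<lambda>u. scale u y) \<in> mod_hom R A D"
  unfolding scale_def
  by (rule direct_sum_hom_tuple[OF finite_I])
    (rule mod_hom_compose[OF A_proj smult_hom_self_module[OF N.module_axioms]])

lemma scale_hom_right: "u \<in> carrier A \<Longrightarrow> (\<lambda>y. scale u y) \<in> mod_hom R N D"
  unfolding scale_def
  by (rule direct_sum_hom_tuple[OF finite_I])
    (rule mod_hom_smult_map[OF N.module_axioms N.module_axioms mod_hom_id free_module_closed])

lemma ev_hom: "ev \<in> mod_hom R F D"
  and ev_pure: "u \<in> carrier A \<Longrightarrow> y \<in> carrier N \<Longrightarrow> ev (e u y) = scale u y"
  and ev_rel: "\<phi> \<in> rel \<Longrightarrow> ev \<phi> = \<zero>\<^bsub>D\<^esub>"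
  using bilinear_extension[OF D_module scale_hom_left scale_hom_right, folded ev_def]
  by simp_all

lemma basis_closed: "i \<in> I \<Longrightarrow> free_basis R I i \<in> carrier A"
  by (rule free_basis_closed[OF cring'])

lemma to_tensor_hom: "to_tensor \<in> mod_hom R D T"
proof -
  have "(\<lambda>m. pure (free_basis R I i) (m i)) \<in> mod_hom R D T" if "i \<in> I" for i
    using mod_hom_compose[OF direct_sum_hom_proj[OF that] pure_hom_right[OF basis_closed[OF that]]] .
  then show ?thesis
    unfolding to_tensor_def[abs_def]
    by (rule mod_hom_finsum_map[OF D_module T_module finite_I])
qed

text \<open>The coefficient \<open>u i\<close> moves across the tensor sign, and \<open>u\<close> is
  the sum of its coordinates times the basis elements.\<close>

lemma scale_expand:
  assumes u: "u \<in> carrier A" and y: "y \<in> carrier N"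
  shows "to_tensor (scale u y) = pure u y"
proof -
  have ui: "u i \<in> carrier R" if "i \<in> I" for i using free_module_closed[OF u that] .
  interpret T: module R T by (rule T_module)
  have bc: "free_basis R I \<in> I \<rightarrow> carrier A" using basis_closed by auto
  have "to_tensor (scale u y) = (\<Oplus>\<^bsub>T\<^esub>i\<in>I. pure (u i \<odot>\<^bsub>A\<^esub> free_basis R I i) y)"
    unfolding to_tensor_def
  proof (rule T.finsum_cong'[OF refl])
    fix i assume i: "i \<in> I"
    show "pure (free_basis R I i) (scale u y i) = pure (u i \<odot>\<^bsub>A\<^esub> free_basis R I i) y"
      using i by (simp add: scale_def mod_hom_smult[OF pure_hom_right] mod_hom_smult[OF pure_hom_left]
          basis_closed ui y)
  qed (auto intro!: pure_closed M.smult_closed basis_closed ui y)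
  also have "\<dots> = pure (\<Oplus>\<^bsub>A\<^esub>i\<in>I. u i \<odot>\<^bsub>A\<^esub> free_basis R I i) y"
    by (rule mod_hom_finsum[OF A_module T_module pure_hom_left[OF y] finite_I, symmetric])
      (auto intro!: M.smult_closed basis_closed ui)
  also have "(\<Oplus>\<^bsub>A\<^esub>i\<in>I. u i \<odot>\<^bsub>A\<^esub> free_basis R I i) = u"
    using free_module_expand[OF cring' u]
      linear_extension_superset[OF A_module bc _ finite_I subset_refl, of u] ui by auto
  finally show ?thesis .
qed

text \<open>Both sides are linear in \<open>\<phi>\<close>, and on the symbol of
  \<open>(u, y)\<close> they agree by \<open>scale_expand\<close>.\<close>

lemma to_tensor_ev:
  assumes "\<phi> \<in> carrier F"
  shows "to_tensor (ev \<phi>) = cls \<phi>"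
  by (rule F_hom_eq[OF T_module mod_hom_compose[OF ev_hom to_tensor_hom] cls_hom _ assms])
    (simp add: ev_pure scale_expand)

lemma ev_surj:
  assumes m: "m \<in> carrier D"
  shows "\<exists>\<phi>\<in>carrier F. ev \<phi> = m"
proof
  let ?\<phi> = "\<Oplus>\<^bsub>F\<^esub>i\<in>I. e (free_basis R I i) (m i)"
  have mi: "m i \<in> carrier N" if "i \<in> I" for i using direct_sum_closed[OF m that] .
  have ec: "(\<lambda>i. e (free_basis R I i) (m i)) \<in> I \<rightarrow> carrier F"
    by (auto intro!: e_closed basis_closed mi)
  show \<phi>: "?\<phi> \<in> carrier F" by (rule F.finsum_closed[OF ec])
  have sc: "(\<lambda>i. scale (free_basis R I i) (m i)) \<in> I \<rightarrow> carrier D"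
    using mod_hom_closed[OF scale_hom_right] basis_closed mi by auto
  interpret D: module R D by (rule D_module)
  have "ev ?\<phi> = (\<Oplus>\<^bsub>D\<^esub>i\<in>I. ev (e (free_basis R I i) (m i)))"
    by (rule mod_hom_finsum[OF F_module D_module ev_hom finite_I ec])
  also have "\<dots> = (\<Oplus>\<^bsub>D\<^esub>i\<in>I. scale (free_basis R I i) (m i))"
    by (rule D.finsum_cong') (use sc in \<open>auto simp: ev_pure basis_closed mi\<close>)
  also have "\<dots> = m"
  proof (rule direct_sum_eqI[OF D.finsum_closed[OF sc] m])
    fix j assume j: "j \<in> I"
    have "(\<Oplus>\<^bsub>D\<^esub>i\<in>I. scale (free_basis R I i) (m i)) j = (\<Oplus>\<^bsub>N\<^esub>i\<in>I. scale (free_basis R I i) (m i) j)"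
      by (rule mod_hom_finsum[OF D_module N.module_axioms direct_sum_hom_proj[OF j] finite_I sc])
    also have "\<dots> = (\<Oplus>\<^bsub>N\<^esub>i\<in>I. if j = i then m i else \<zero>\<^bsub>N\<^esub>)"
      by (rule N.finsum_cong') (use j mi in \<open>auto simp: scale_def free_basis_simps\<close>)
    also have "\<dots> = m j"
      by (rule N.finsum_singleton[OF j finite_I]) (use mi in auto)
    finally show "(\<Oplus>\<^bsub>D\<^esub>i\<in>I. scale (free_basis R I i) (m i)) j = m j" .
  qed
  finally show "ev ?\<phi> = m" .
qed

text \<open>By \<open>to_tensor_ev\<close> the quotient map of \<open>F\<close> factors through the
  surjection \<open>ev\<close>, which gives surjectivity. If \<open>to_tensor\<close> identifies two
  values of \<open>ev\<close>, their arguments differ by a relation, and \<open>ev\<close> kills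
  relations.\<close>

lemma to_tensor_bij: "bij_betw to_tensor (carrier D) (carrier T)"
  unfolding bij_betw_def
proof
  interpret D: module R D by (rule D_module)
  interpret T: module R T by (rule T_module)
  show "inj_on to_tensor (carrier D)"
  proof (rule inj_onI)
    fix m m' assume m: "m \<in> carrier D" "m' \<in> carrier D" and eq: "to_tensor m = to_tensor m'"
    from ev_surj[OF m(1)] obtain \<phi> where 1: "\<phi> \<in> carrier F" "ev \<phi> = m" by (elim bexE)
    from ev_surj[OF m(2)] obtain \<phi>' where 2: "\<phi>' \<in> carrier F" "ev \<phi>' = m'" by (elim bexE)
    note p = 1 2
    have "cls \<phi> = cls \<phi>'"
      using eq to_tensor_ev[OF p(1)] to_tensor_ev[OF p(3)] p by simp
    then have "ev (\<phi> \<ominus>\<^bsub>F\<^esub> \<phi>') = \<zero>\<^bsub>D\<^esub>"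
      using coset_eq_iff[OF F_module rel_submodule p(1,3)] by (intro ev_rel) simp
    then have "m \<ominus>\<^bsub>D\<^esub> m' = \<zero>\<^bsub>D\<^esub>"
      using mod_hom_minus[OF F_module D_module ev_hom p(1,3)] p by simp
    then show "m = m'" by (rule module_eq_if_minus_zero[OF D_module m])
  qed
  show "to_tensor ` carrier D = carrier T"
  proof (intro equalityI subsetI)
    fix t assume "t \<in> carrier T"
    then obtain \<phi> where \<phi>: "\<phi> \<in> carrier F" "t = cls \<phi>" unfolding T_carrier by (elim imageE)
    then have "t = to_tensor (ev \<phi>)" using to_tensor_ev[OF \<phi>(1)] by simp
    then show "t \<in> to_tensor ` carrier D"
      using mod_hom_closed[OF ev_hom \<phi>(1)] by (rule image_eqI)
  next
    fix t assume "t \<in> to_tensor ` carrier D"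
    then show "t \<in> carrier T" using mod_hom_closed[OF to_tensor_hom] by (elim imageE) simp
  qed
qed

end

text \<open>Under the identification with sums of copies of \<open>N\<close>,
  \<open>f \<otimes> N\<close> becomes \<open>d\<close> as soon as the two agree on pure tensors:
  both routes are linear on the free module over the pairs. The union in \<open>tensor_map\<close>
  collapses because \<open>ev\<close> is constant on a coset of the relations.\<close>

lemma tensor_map_to_tensor:
  assumes T1: "free_tensor_product R I N" and T2: "free_tensor_product R J N"
    and f: "f \<in> mod_hom R (free_module R I) (free_module R J)"
    and d: "d \<in> mod_hom R (direct_sum I (\<lambda>_. N)) (direct_sum J (\<lambda>_. N))"
    and fd: "\<And>u y. u \<in> carrier (free_module R I) \<Longrightarrow> y \<in> carrier N \<Longrightarrow>
      d (free_tensor_product.scale I N u y) = free_tensor_product.scale J N (f u) y"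
    and m: "m \<in> carrier (direct_sum I (\<lambda>_. N))"
  shows "tensor_map R (free_module R I) (free_module R J) N f (free_tensor_product.to_tensor R I N m)
    = free_tensor_product.to_tensor R J N (d m)"
proof -
  interpret I: free_tensor_product R I N by fact
  interpret J: free_tensor_product R J N by fact
  let ?b = "\<lambda>p. J.e (f (fst p)) (snd p)"
  let ?L = "linear_extension R J.F (carrier I.A \<times> carrier N) ?b"
  have b: "?b \<in> carrier I.A \<times> carrier N \<rightarrow> carrier J.F"
    by (intro funcsetI J.e_closed mod_hom_closed[OF f]) (simp_all add: mem_Times_iff)
  have L: "?L \<in> mod_hom R I.F J.F"
    unfolding tensor_free_def[of R "free_module R I"] by (rule linear_extension_hom[OF J.F_module b])
  have Lp: "?L (I.e u y) = J.e (f u) y" if "u \<in> carrier I.A" "y \<in> carrier N" for u y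
    unfolding pure_sym_def[of R "free_module R I"]
    using linear_extension_basis[OF J.F_module b, of "(u, y)"] that by simp
  have key: "J.cls (?L \<psi>) = J.to_tensor (d (I.ev \<psi>))" if "\<psi> \<in> carrier I.F" for \<psi>
  proof (rule I.F_hom_eq[OF J.T_module mod_hom_compose[OF L J.cls_hom]
        mod_hom_compose[OF mod_hom_compose[OF I.ev_hom d] J.to_tensor_hom] _ that])
    fix u y assume u: "u \<in> carrier I.A" "y \<in> carrier N"
    then show "J.cls (?L (I.e u y)) = J.to_tensor (d (I.ev (I.e u y)))"
      by (simp only: Lp I.ev_pure fd J.scale_expand mod_hom_closed[OF f])
  qed
  obtain \<phi> where \<phi>: "\<phi> \<in> carrier I.F" "I.ev \<phi> = m"
    using I.ev_surj[OF m] by (elim bexE)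
  have "tensor_map R I.A J.A N f (I.to_tensor m) = tensor_map R I.A J.A N f (I.cls \<phi>)"
    using I.to_tensor_ev[OF \<phi>(1)] \<phi>(2) by simp
  also have "\<dots> = (\<Union>\<psi>\<in>I.cls \<phi>. J.cls (?L \<psi>))"
    unfolding tensor_map_def Let_def linear_extension_def by (rule refl)
  also have "\<dots> = (\<Union>\<psi>\<in>I.cls \<phi>. J.to_tensor (d m))"
  proof (rule SUP_cong[OF refl])
    fix \<psi> assume "\<psi> \<in> I.cls \<phi>"
    then have \<psi>: "\<psi> \<in> carrier I.F" "\<psi> \<ominus>\<^bsub>I.F\<^esub> \<phi> \<in> I.rel"
      unfolding mem_coset_iff[OF I.F_module I.rel_submodule \<phi>(1)] by simp_all
    have "I.ev \<psi> \<ominus>\<^bsub>I.D\<^esub> I.ev \<phi> = \<zero>\<^bsub>I.D\<^esub>"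
      using I.ev_rel[OF \<psi>(2)] mod_hom_minus[OF I.F_module I.D_module I.ev_hom \<psi>(1) \<phi>(1)] by simp
    then have "I.ev \<psi> = I.ev \<phi>"
      by (rule module_eq_if_minus_zero[OF I.D_module mod_hom_closed[OF I.ev_hom \<psi>(1)]
            mod_hom_closed[OF I.ev_hom \<phi>(1)]])
    then have "I.ev \<psi> = m" using \<phi>(2) by simp
    then show "J.cls (?L \<psi>) = J.to_tensor (d m)" using key[OF \<psi>(1)] by simp
  qed
  also have "\<dots> = J.to_tensor (d m)"
    by (rule UN_const[OF coset_self[OF I.F_module I.rel_submodule \<phi>(1)]])
  finally show ?thesis .
qed

section \<open>The total complex of a cube of complexes\<close>

lemma mod_hom_smult_add:
  assumes "module R M" "g \<in> mod_hom R M L" "a \<in> carrier R" "u \<in> carrier M" "w \<in> carrier M"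
  shows "g (a \<odot>\<^bsub>M\<^esub> u \<oplus>\<^bsub>M\<^esub> w) = a \<odot>\<^bsub>L\<^esub> g u \<oplus>\<^bsub>L\<^esub> g w"
proof -
  interpret M: module R M by fact
  show ?thesis using assms(3-5) by (simp add: mod_hom_add[OF assms(2)] mod_hom_smult[OF assms(2)])
qed

section \<open>Signs, and the Koszul differential with coefficients in a module\<close>

definition parity_sign :: "('a, 'r) ring_scheme \<Rightarrow> nat \<Rightarrow> 'a" where
  "parity_sign R k = (\<ominus>\<^bsub>R\<^esub> \<one>\<^bsub>R\<^esub>) [^]\<^bsub>R\<^esub> k"

definition koszul_sign :: "('a, 'r) ring_scheme \<Rightarrow> nat set \<Rightarrow> nat \<Rightarrow> 'a" where
  "koszul_sign R T s = parity_sign R (card {t \<in> T. t < s})"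

text \<open>The differential of \<open>K(x, N)\<close> after its degree \<open>i\<close> part has
  been identified with a sum of copies of \<open>N\<close>. For the ring itself this is the
  differential of \<open>koszul_ring\<close>.\<close>

definition koszul_diff ::
    "('a, 'r) ring_scheme \<Rightarrow> (nat \<Rightarrow> 'a) \<Rightarrow> nat \<Rightarrow> ('a, 'b) module \<Rightarrow> int \<Rightarrow>
     (nat set \<Rightarrow> 'b) \<Rightarrow> nat set \<Rightarrow> 'b" where
  "koszul_diff R x n N i m = (\<lambda>T\<in>koszul_index n (i - 1).
     \<Oplus>\<^bsub>N\<^esub>s\<in>{1..n} - T. (koszul_sign R T s \<otimes>\<^bsub>R\<^esub> x s) \<odot>\<^bsub>N\<^esub> m (insert s T))"

context cring
begin

lemma parity_sign_closed [simp]: "parity_sign R k \<in> carrier R"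
  by (simp add: parity_sign_def)

lemma parity_sign_0 [simp]: "parity_sign R 0 = \<one>"
  by (simp add: parity_sign_def)

lemma parity_sign_Suc: "parity_sign R (Suc k) = \<ominus> parity_sign R k"
  by (simp add: parity_sign_def r_minus)

lemma parity_sign_square: "parity_sign R k \<otimes> parity_sign R k = \<one>"
  by (induction k) (simp_all add: parity_sign_Suc l_minus r_minus)

lemma koszul_sign_closed [simp]: "koszul_sign R T s \<in> carrier R"
  by (simp add: koszul_sign_def)

text \<open>Inserting the smaller element \<open>s\<close> shifts the position of \<open>t\<close>
  by one, whereas inserting \<open>t\<close> leaves the position of \<open>s\<close>
  unchanged.\<close>

lemma koszul_sign_antisymmetric_less:
  assumes "finite T" "s \<notin> T" "s < t"
  shows "koszul_sign R T s \<otimes> koszul_sign R (insert s T) t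
      = \<ominus> (koszul_sign R T t \<otimes> koszul_sign R (insert t T) s)"
proof -
  have "{u \<in> insert s T. u < t} = insert s {u \<in> T. u < t}" using assms(3) by auto
  then have "koszul_sign R (insert s T) t = \<ominus> koszul_sign R T t"
    using assms by (simp add: koszul_sign_def parity_sign_Suc)
  moreover have "{u \<in> insert t T. u < s} = {u \<in> T. u < s}" using assms(3) by auto
  then have "koszul_sign R (insert t T) s = koszul_sign R T s" by (simp add: koszul_sign_def)
  ultimately show ?thesis by (simp add: r_minus m_comm)
qed

lemma koszul_sign_antisymmetric:
  assumes "finite T" "s \<notin> T" "t \<notin> T" "s \<noteq> t"
  shows "koszul_sign R T s \<otimes> koszul_sign R (insert s T) t
      = \<ominus> (koszul_sign R T t \<otimes> koszul_sign R (insert t T) s)"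
proof (cases "s < t")
  case True
  then show ?thesis using koszul_sign_antisymmetric_less[OF assms(1,2)] by simp
next
  case False
  then have "t < s" using assms(4) by simp
  then show ?thesis using koszul_sign_antisymmetric_less[OF assms(1,3)] by simp
qed

end

lemma koszul_index_finite: "finite (koszul_index n i)"
  by (rule finite_subset[of _ "Pow {1..n}"]) (auto simp: koszul_index_def)

lemma koszul_index_subset: "S \<in> koszul_index n i \<Longrightarrow> S \<subseteq> {1..n}"
  and koszul_index_card: "S \<in> koszul_index n i \<Longrightarrow> int (card S) = i"
  by (simp_all add: koszul_index_def)

lemma koszul_index_insert:
  assumes "T \<in> koszul_index n (i - 1)" "s \<in> {1..n} - T"
  shows "insert s T \<in> koszul_index n i"
proof -
  have "finite T" using assms(1) finite_subset[of T "{1..n}"] by (auto simp: koszul_index_def)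
  then show ?thesis using assms by (auto simp: koszul_index_def)
qed

lemma koszul_diff_hom:
  assumes "module R N" "\<And>s. s \<in> {1..n} \<Longrightarrow> x s \<in> carrier R"
  shows "koszul_diff R x n N i \<in> mod_hom R (direct_sum (koszul_index n i) (\<lambda>_. N))
    (direct_sum (koszul_index n (i - 1)) (\<lambda>_. N))"
proof -
  interpret N: module R N by fact
  have D: "module R (direct_sum (koszul_index n i) (\<lambda>_. N))"
    by (rule direct_sum_module[OF _ assms(1)]) unfold_locales
  show ?thesis
    unfolding koszul_diff_def[abs_def]
  proof (rule direct_sum_hom_tuple[OF koszul_index_finite])
    fix T assume T: "T \<in> koszul_index n (i - 1)"
    show "(\<lambda>m. \<Oplus>\<^bsub>N\<^esub>s\<in>{1..n} - T. (koszul_sign R T s \<otimes>\<^bsub>R\<^esub> x s) \<odot>\<^bsub>N\<^esub> m (insert s T))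
        \<in> mod_hom R (direct_sum (koszul_index n i) (\<lambda>_. N)) N"
    proof (rule mod_hom_finsum_map[OF D assms(1)])
      fix s assume s: "s \<in> {1..n} - T"
      show "(\<lambda>m. (koszul_sign R T s \<otimes>\<^bsub>R\<^esub> x s) \<odot>\<^bsub>N\<^esub> m (insert s T))
          \<in> mod_hom R (direct_sum (koszul_index n i) (\<lambda>_. N)) N"
        by (rule mod_hom_smult_map[OF D assms(1) direct_sum_hom_proj[OF koszul_index_insert[OF T s]]])
          (use assms(2) s in simp)
    qed simp
  qed
qed

text \<open>The index \<open>i\<close> is the total degree, so \<open>\<delta>\<close> (inside the
  complex at a vertex \<open>S\<close>) and \<open>\<gamma>\<close> (along the edge that removes
  \<open>s\<close>) both lower it by one and no shifts appear. All squares commute without signs;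
  signs enter only in the total differential. The augmentation \<open>\<eta>\<close> lives at a
  vertex \<open>S\<close> in degree \<open>card S\<close>. The last assumption is acyclicity of its
  kernel at each vertex; the clause about \<open>i + 1\<close> keeps the preimage inside that
  kernel.\<close>

locale koszul_cube = cring R + N: module R N
  for R :: "('a, 'r) ring_scheme" (structure) and N :: "('a, 'b) module" +
  fixes x :: "nat \<Rightarrow> 'a" and n :: nat
    and V :: "nat set \<Rightarrow> int \<Rightarrow> ('a, 'b) module"
    and \<delta> :: "nat set \<Rightarrow> int \<Rightarrow> 'b \<Rightarrow> 'b"
    and \<gamma> :: "nat set \<Rightarrow> nat \<Rightarrow> int \<Rightarrow> 'b \<Rightarrow> 'b"
    and \<eta> :: "int \<Rightarrow> 'b \<Rightarrow> 'b"
  assumes x_closed: "s \<in> {1..n} \<Longrightarrow> x s \<in> carrier R"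
    and V_module: "S \<subseteq> {1..n} \<Longrightarrow> module R (V S i)"
    and \<delta>_hom: "S \<subseteq> {1..n} \<Longrightarrow> \<delta> S i \<in> mod_hom R (V S i) (V S (i - 1))"
    and \<gamma>_hom: "T \<subseteq> {1..n} \<Longrightarrow> s \<in> {1..n} - T \<Longrightarrow>
      \<gamma> T s i \<in> mod_hom R (V (insert s T) i) (V T (i - 1))"
    and \<delta>_\<delta>: "S \<subseteq> {1..n} \<Longrightarrow> v \<in> carrier (V S i) \<Longrightarrow> \<delta> S (i - 1) (\<delta> S i v) = \<zero>\<^bsub>V S (i - 2)\<^esub>"
    and \<delta>_\<gamma>: "T \<subseteq> {1..n} \<Longrightarrow> s \<in> {1..n} - T \<Longrightarrow> v \<in> carrier (V (insert s T) i) \<Longrightarrow>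
      \<delta> T (i - 1) (\<gamma> T s i v) = \<gamma> T s (i - 1) (\<delta> (insert s T) i v)"
    and \<gamma>_\<gamma>: "T \<subseteq> {1..n} \<Longrightarrow> s \<in> {1..n} - T \<Longrightarrow> t \<in> {1..n} - T \<Longrightarrow> s \<noteq> t \<Longrightarrow>
      v \<in> carrier (V (insert s (insert t T)) i) \<Longrightarrow>
      \<gamma> T s (i - 1) (\<gamma> (insert s T) t i v) = \<gamma> T t (i - 1) (\<gamma> (insert t T) s i v)"
    and \<eta>_hom: "S \<in> koszul_index n i \<Longrightarrow> \<eta> i \<in> mod_hom R (V S i) N"
    and \<eta>_surj: "S \<in> koszul_index n i \<Longrightarrow> \<eta> i ` carrier (V S i) = carrier N"
    and \<eta>_\<delta>: "S \<in> koszul_index n (i - 1) \<Longrightarrow> v \<in> carrier (V S i) \<Longrightarrow> \<eta> (i - 1) (\<delta> S i v) = \<zero>\<^bsub>N\<^esub>"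
    and \<eta>_\<gamma>: "T \<in> koszul_index n (i - 1) \<Longrightarrow> s \<in> {1..n} - T \<Longrightarrow> v \<in> carrier (V (insert s T) i) \<Longrightarrow>
      \<eta> (i - 1) (\<gamma> T s i v) = x s \<odot>\<^bsub>N\<^esub> \<eta> i v"
    and exact: "S \<subseteq> {1..n} \<Longrightarrow> v \<in> carrier (V S i) \<Longrightarrow> \<delta> S i v = \<zero>\<^bsub>V S (i - 1)\<^esub> \<Longrightarrow>
      (S \<in> koszul_index n i \<Longrightarrow> \<eta> i v = \<zero>\<^bsub>N\<^esub>) \<Longrightarrow>
      \<exists>w\<in>carrier (V S (i + 1)). \<delta> S (i + 1) w = v \<and>
        (S \<in> koszul_index n (i + 1) \<longrightarrow> \<eta> (i + 1) w = \<zero>\<^bsub>N\<^esub>)"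
begin

section \<open>The total complex and its augmentation to the Koszul complex\<close>

definition Y :: "int \<Rightarrow> ('a, nat set \<Rightarrow> 'b) module" where
  "Y i = direct_sum (Pow {1..n}) (\<lambda>S. V S i)"

text \<open>The factor depending on \<open>card T\<close> turns the commuting squares of
  \<open>\<delta>\<close> and \<open>\<gamma>\<close> into anticommuting ones, and the Koszul signs
  do the same for the squares of two \<open>\<gamma>\<close>.\<close>

definition comp :: "int \<Rightarrow> nat set \<Rightarrow> (nat set \<Rightarrow> 'b) \<Rightarrow> 'b" where
  "comp i T z = parity_sign R (card T) \<odot>\<^bsub>V T (i - 1)\<^esub> \<delta> T i (z T) \<oplus>\<^bsub>V T (i - 1)\<^esub>
     (\<Oplus>\<^bsub>V T (i - 1)\<^esub>s\<in>{1..n} - T. koszul_sign R T s \<odot>\<^bsub>V T (i - 1)\<^esub> \<gamma> T s i (z (insert s T)))"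

definition d :: "int \<Rightarrow> (nat set \<Rightarrow> 'b) \<Rightarrow> nat set \<Rightarrow> 'b" where
  "d i z = (\<lambda>T\<in>Pow {1..n}. comp i T z)"

definition f :: "int \<Rightarrow> (nat set \<Rightarrow> 'b) \<Rightarrow> nat set \<Rightarrow> 'b" where
  "f i z = (\<lambda>S\<in>koszul_index n i. \<eta> i (z S))"

definition K :: "int \<Rightarrow> ('a, nat set \<Rightarrow> 'b) module" where
  "K i = direct_sum (koszul_index n i) (\<lambda>_. N)"

lemma Y_module: "module R (Y i)"
  unfolding Y_def by (rule direct_sum_module[OF is_cring]) (rule V_module, simp)

lemma K_module: "module R (K i)"
  unfolding K_def by (rule direct_sum_module[OF is_cring N.module_axioms])

lemma Y_carrier: "carrier (Y i) = (\<Pi>\<^sub>E S\<in>Pow {1..n}. carrier (V S i))"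
  by (simp add: Y_def direct_sum_carrier_finite)

lemma Y_closed: "z \<in> carrier (Y i) \<Longrightarrow> S \<subseteq> {1..n} \<Longrightarrow> z S \<in> carrier (V S i)"
  by (auto simp: Y_carrier)

lemma Y_proj: "S \<subseteq> {1..n} \<Longrightarrow> (\<lambda>z. z S) \<in> mod_hom R (Y i) (V S i)"
  unfolding Y_def by (rule direct_sum_hom_proj) simp

lemma Y_eqI:
  assumes "z \<in> carrier (Y i)" "w \<in> carrier (Y i)" "\<And>S. S \<subseteq> {1..n} \<Longrightarrow> z S = w S"
  shows "z = w"
  by (rule direct_sum_eqI[OF assms(1,2)[unfolded Y_def]]) (simp add: assms(3))

lemma Y_zero: "S \<subseteq> {1..n} \<Longrightarrow> \<zero>\<^bsub>Y i\<^esub> S = \<zero>\<^bsub>V S i\<^esub>"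
  by (simp add: Y_def direct_sum_zero)

lemma insert_subset': "T \<subseteq> {1..n} \<Longrightarrow> s \<in> {1..n} - T \<Longrightarrow> insert s T \<subseteq> {1..n}"
  by auto

lemma term_hom:
  assumes "T \<subseteq> {1..n}" "s \<in> {1..n} - T"
  shows "(\<lambda>z. koszul_sign R T s \<odot>\<^bsub>V T (i - 1)\<^esub> \<gamma> T s i (z (insert s T))) \<in> mod_hom R (Y i) (V T (i - 1))"
  by (rule mod_hom_smult_map[OF Y_module V_module[OF assms(1)]
        mod_hom_compose[OF Y_proj[OF insert_subset'[OF assms]] \<gamma>_hom[OF assms]] koszul_sign_closed])

lemma comp_hom:
  assumes T: "T \<subseteq> {1..n}"
  shows "comp i T \<in> mod_hom R (Y i) (V T (i - 1))"
  unfolding comp_def[abs_def]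
  by (rule mod_hom_add_map[OF Y_module V_module[OF T]
        mod_hom_smult_map[OF Y_module V_module[OF T] mod_hom_compose[OF Y_proj[OF T] \<delta>_hom[OF T]] parity_sign_closed]
        mod_hom_finsum_map[OF Y_module V_module[OF T]]])
    (simp, rule term_hom[OF T])

lemma d_hom: "d i \<in> mod_hom R (Y i) (Y (i - 1))"
  unfolding d_def[abs_def] Y_def[of "i - 1"]
  by (rule direct_sum_hom_tuple) (simp, rule comp_hom, simp)

lemma f_hom: "f i \<in> mod_hom R (Y i) (K i)"
  unfolding f_def[abs_def] K_def
  by (rule direct_sum_hom_tuple[OF koszul_index_finite])
    (rule mod_hom_compose[OF Y_proj[OF koszul_index_subset] \<eta>_hom])

lemma d_at: "T \<subseteq> {1..n} \<Longrightarrow> d i z T = comp i T z"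
  by (simp add: d_def)

text \<open>In the component at \<open>T\<close>, the terms with \<open>\<delta>\<close> twice
  vanish. Each mixed term occurs twice, with opposite signs because \<open>insert s T\<close> has
  one element more than \<open>T\<close>. The terms with \<open>\<gamma>\<close> twice are symmetric
  in the two removed elements while their signs are antisymmetric.\<close>

lemma d_d:
  assumes z: "z \<in> carrier (Y i)"
  shows "d (i - 1) (d i z) = \<zero>\<^bsub>Y (i - 1 - 1)\<^esub>"
proof (rule Y_eqI)
  interpret Y2: module R "Y (i - 1 - 1)" by (rule Y_module)
  show "\<zero>\<^bsub>Y (i - 1 - 1)\<^esub> \<in> carrier (Y (i - 1 - 1))" by (rule Y2.zero_closed)
  have dz: "d i z \<in> carrier (Y (i - 1))" by (rule mod_hom_closed[OF d_hom z])
  show "d (i - 1) (d i z) \<in> carrier (Y (i - 1 - 1))" by (rule mod_hom_closed[OF d_hom dz])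
  fix T assume T: "T \<subseteq> {1..n}"
  let ?X = "{1..n} - T"
  define G where "G = V T (i - 1 - 1)"
  have G_module: "module R G" unfolding G_def by (rule V_module[OF T])
  interpret G: module R G by (rule G_module)
  have \<delta>G: "\<delta> T (i - 1) \<in> mod_hom R (V T (i - 1)) G"
    unfolding G_def by (rule \<delta>_hom[OF T])
  have \<gamma>G: "\<gamma> T s (i - 1) \<in> mod_hom R (V (insert s T) (i - 1)) G" if "s \<in> ?X" for s
    unfolding G_def by (rule \<gamma>_hom[OF T that])
  interpret H: module R "V T (i - 1)" by (rule V_module[OF T])
  have finT: "finite T" using T finite_subset by blast
  note ins = insert_subset'[OF T]
  \<comment> \<open>\<open>p s\<close> is the mixed term in which \<open>s\<close> is removed;
    \<open>q s t\<close>, below, is the term in which first \<open>t\<close> and then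
    \<open>s\<close> is removed.\<close>
  define p where "p s = \<delta> T (i - 1) (\<gamma> T s i (z (insert s T)))" for s
  define q where "q s t = \<gamma> T s (i - 1) (\<gamma> (insert s T) t i (z (insert t (insert s T))))" for s t
  have zc: "z (insert s T) \<in> carrier (V (insert s T) i)" if "s \<in> ?X" for s
    using Y_closed[OF z ins[OF that]] .
  have gz: "\<gamma> T s i (z (insert s T)) \<in> carrier (V T (i - 1))" if "s \<in> ?X" for s
    by (rule mod_hom_closed[OF \<gamma>_hom[OF T that] zc[OF that]])
  have pc: "p s \<in> carrier G" if "s \<in> ?X" for s
    unfolding p_def by (rule mod_hom_closed[OF \<delta>G gz[OF that]])
  have st: "t \<in> {1..n} - insert s T \<and> insert t (insert s T) \<subseteq> {1..n}" if "s \<in> ?X" "t \<in> ?X - {s}" for s t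
    using that T by auto
  have zc2: "z (insert t (insert s T)) \<in> carrier (V (insert t (insert s T)) i)"
    if "s \<in> ?X" "t \<in> ?X - {s}" for s t
    by (rule Y_closed[OF z]) (use st[OF that] in simp)
  have ggz: "\<gamma> (insert s T) t i (z (insert t (insert s T))) \<in> carrier (V (insert s T) (i - 1))"
    if "s \<in> ?X" "t \<in> ?X - {s}" for s t
    by (rule mod_hom_closed[OF \<gamma>_hom[OF ins[OF that(1)] conjunct1[OF st[OF that]]] zc2[OF that]])
  have qc: "q s t \<in> carrier G" if "s \<in> ?X" "t \<in> ?X - {s}" for s t
    unfolding q_def by (rule mod_hom_closed[OF \<gamma>G[OF that(1)] ggz[OF that]])
  have qsym: "q s t = q t s" if "s \<in> ?X" "t \<in> ?X - {s}" for s t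
  proof -
    note comm = insert_commute[of s t T]
    have "\<gamma> T s (i - 1) (\<gamma> (insert s T) t i (z (insert s (insert t T))))
      = \<gamma> T t (i - 1) (\<gamma> (insert t T) s i (z (insert s (insert t T))))"
    proof (rule \<gamma>_\<gamma>[OF T that(1)])
      show "z (insert s (insert t T)) \<in> carrier (V (insert s (insert t T)) i)"
        unfolding comm by (rule zc2[OF that])
    qed (use that in simp_all)
    then show ?thesis unfolding q_def by (simp only: comm)
  qed
  have smc: "r \<odot>\<^bsub>G\<^esub> g \<in> carrier G" if "r \<in> carrier R" "g \<in> carrier G" for r g
    using that by (rule G.smult_closed)
  have eT: "\<delta> T (i - 1) (comp i T z) = (\<Oplus>\<^bsub>G\<^esub>s\<in>?X. koszul_sign R T s \<odot>\<^bsub>G\<^esub> p s)"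
  proof -
    let ?S = "\<Oplus>\<^bsub>V T (i - 1)\<^esub>s\<in>?X. koszul_sign R T s \<odot>\<^bsub>V T (i - 1)\<^esub> \<gamma> T s i (z (insert s T))"
    have fc: "(\<lambda>s. koszul_sign R T s \<odot>\<^bsub>V T (i - 1)\<^esub> \<gamma> T s i (z (insert s T))) \<in> ?X \<rightarrow> carrier (V T (i - 1))"
      using gz by (auto intro!: H.smult_closed)
    have dc: "\<delta> T i (z T) \<in> carrier (V T (i - 1))"
      by (rule mod_hom_closed[OF \<delta>_hom[OF T] Y_closed[OF z T]])
    have sc: "?S \<in> carrier (V T (i - 1))" by (rule H.finsum_closed[OF fc])
    have "\<delta> T (i - 1) (comp i T z)
        = parity_sign R (card T) \<odot>\<^bsub>G\<^esub> \<delta> T (i - 1) (\<delta> T i (z T)) \<oplus>\<^bsub>G\<^esub> \<delta> T (i - 1) ?S"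
      unfolding comp_def by (rule mod_hom_smult_add[OF V_module[OF T] \<delta>G parity_sign_closed dc sc])
    also have "\<delta> T (i - 1) (\<delta> T i (z T)) = \<zero>\<^bsub>G\<^esub>"
      using \<delta>_\<delta>[OF T Y_closed[OF z T]] by (simp add: G_def)
    also have "\<delta> T (i - 1) ?S = (\<Oplus>\<^bsub>G\<^esub>s\<in>?X. \<delta> T (i - 1) (koszul_sign R T s \<odot>\<^bsub>V T (i - 1)\<^esub> \<gamma> T s i (z (insert s T))))"
      by (rule mod_hom_finsum[OF V_module[OF T] G_module \<delta>G _ fc]) simp
    also have "\<dots> = (\<Oplus>\<^bsub>G\<^esub>s\<in>?X. koszul_sign R T s \<odot>\<^bsub>G\<^esub> p s)"
      by (rule G.finsum_cong') (use pc gz in \<open>auto simp: p_def mod_hom_smult[OF \<delta>G]\<close>)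
    also have "parity_sign R (card T) \<odot>\<^bsub>G\<^esub> \<zero>\<^bsub>G\<^esub> \<oplus>\<^bsub>G\<^esub> (\<Oplus>\<^bsub>G\<^esub>s\<in>?X. koszul_sign R T s \<odot>\<^bsub>G\<^esub> p s)
        = (\<Oplus>\<^bsub>G\<^esub>s\<in>?X. koszul_sign R T s \<odot>\<^bsub>G\<^esub> p s)"
      using pc by (simp add: Pi_def)
    finally show ?thesis .
  qed
  have eS: "\<gamma> T s (i - 1) (comp i (insert s T) z)
      = (\<ominus> parity_sign R (card T)) \<odot>\<^bsub>G\<^esub> p s \<oplus>\<^bsub>G\<^esub>
        (\<Oplus>\<^bsub>G\<^esub>t\<in>?X - {s}. koszul_sign R (insert s T) t \<odot>\<^bsub>G\<^esub> q s t)" if s: "s \<in> ?X" for s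
  proof -
    let ?sT = "insert s T"
    let ?H = "V ?sT (i - 1)"
    interpret H': module R ?H by (rule V_module[OF ins[OF s]])
    note gh = \<gamma>G[OF s]
    have Xs: "{1..n} - ?sT = ?X - {s}" by auto
    let ?S = "\<Oplus>\<^bsub>?H\<^esub>t\<in>?X - {s}. koszul_sign R ?sT t \<odot>\<^bsub>?H\<^esub> \<gamma> ?sT t i (z (insert t ?sT))"
    have fc: "(\<lambda>t. koszul_sign R ?sT t \<odot>\<^bsub>?H\<^esub> \<gamma> ?sT t i (z (insert t ?sT))) \<in> ?X - {s} \<rightarrow> carrier ?H"
      by (rule funcsetI) (rule H'.smult_closed[OF koszul_sign_closed ggz[OF s]])
    have dc: "\<delta> ?sT i (z ?sT) \<in> carrier ?H"
      by (rule mod_hom_closed[OF \<delta>_hom[OF ins[OF s]] zc[OF s]])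
    have sc: "?S \<in> carrier ?H" by (rule H'.finsum_closed[OF fc])
    have "\<gamma> T s (i - 1) (comp i ?sT z)
        = parity_sign R (card ?sT) \<odot>\<^bsub>G\<^esub> \<gamma> T s (i - 1) (\<delta> ?sT i (z ?sT)) \<oplus>\<^bsub>G\<^esub> \<gamma> T s (i - 1) ?S"
      unfolding comp_def Xs
      by (rule mod_hom_smult_add[OF V_module[OF ins[OF s]] gh parity_sign_closed dc sc])
    also have "\<gamma> T s (i - 1) (\<delta> ?sT i (z ?sT)) = p s"
      unfolding p_def by (rule \<delta>_\<gamma>[OF T s zc[OF s], symmetric])
    also have "parity_sign R (card ?sT) = \<ominus> parity_sign R (card T)"
      using s finT by (simp add: parity_sign_Suc)
    also have "\<gamma> T s (i - 1) ?S = (\<Oplus>\<^bsub>G\<^esub>t\<in>?X - {s}. \<gamma> T s (i - 1)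
        (koszul_sign R ?sT t \<odot>\<^bsub>?H\<^esub> \<gamma> ?sT t i (z (insert t ?sT))))"
      by (rule mod_hom_finsum[OF V_module[OF ins[OF s]] G_module gh _ fc]) simp
    also have "\<dots> = (\<Oplus>\<^bsub>G\<^esub>t\<in>?X - {s}. koszul_sign R ?sT t \<odot>\<^bsub>G\<^esub> q s t)"
    proof (rule G.finsum_cong'[OF refl])
      fix t assume t: "t \<in> ?X - {s}"
      show "\<gamma> T s (i - 1) (koszul_sign R ?sT t \<odot>\<^bsub>?H\<^esub> \<gamma> ?sT t i (z (insert t ?sT)))
          = koszul_sign R ?sT t \<odot>\<^bsub>G\<^esub> q s t"
        unfolding q_def by (rule mod_hom_smult[OF gh koszul_sign_closed ggz[OF s t]])
    qed (rule funcsetI, rule smc[OF koszul_sign_closed qc[OF s]])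
    finally show ?thesis .
  qed
  have A: "(\<lambda>s. parity_sign R (card T) \<odot>\<^bsub>G\<^esub> (koszul_sign R T s \<odot>\<^bsub>G\<^esub> p s)) \<in> ?X \<rightarrow> carrier G"
    by (rule funcsetI) (rule smc[OF parity_sign_closed smc[OF koszul_sign_closed pc]])
  have B: "(\<lambda>s. koszul_sign R T s \<odot>\<^bsub>G\<^esub> ((\<ominus> parity_sign R (card T)) \<odot>\<^bsub>G\<^esub> p s)) \<in> ?X \<rightarrow> carrier G"
    by (rule funcsetI) (rule smc[OF koszul_sign_closed smc[OF _ pc]], simp_all)
  let ?c = "\<lambda>s t. (koszul_sign R T s \<otimes> koszul_sign R (insert s T) t) \<odot>\<^bsub>G\<^esub> q s t"
  have cc: "?c s t \<in> carrier G" if "s \<in> ?X" "t \<in> ?X - {s}" for s t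
    by (rule smc[OF _ qc[OF that]]) simp
  have C: "(\<lambda>s. \<Oplus>\<^bsub>G\<^esub>t\<in>?X - {s}. ?c s t) \<in> ?X \<rightarrow> carrier G"
    by (rule funcsetI, rule G.finsum_closed, rule funcsetI) (rule cc)
  have "d (i - 1) (d i z) T = comp (i - 1) T (d i z)" by (rule d_at[OF T])
  also have "\<dots> = parity_sign R (card T) \<odot>\<^bsub>G\<^esub> \<delta> T (i - 1) (comp i T z) \<oplus>\<^bsub>G\<^esub>
      (\<Oplus>\<^bsub>G\<^esub>s\<in>?X. koszul_sign R T s \<odot>\<^bsub>G\<^esub> \<gamma> T s (i - 1) (d i z (insert s T)))"
    unfolding comp_def[of "i - 1"] d_at[OF T] G_def ..
  also have "(\<Oplus>\<^bsub>G\<^esub>s\<in>?X. koszul_sign R T s \<odot>\<^bsub>G\<^esub> \<gamma> T s (i - 1) (d i z (insert s T)))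
      = (\<Oplus>\<^bsub>G\<^esub>s\<in>?X. koszul_sign R T s \<odot>\<^bsub>G\<^esub> ((\<ominus> parity_sign R (card T)) \<odot>\<^bsub>G\<^esub> p s) \<oplus>\<^bsub>G\<^esub>
          (\<Oplus>\<^bsub>G\<^esub>t\<in>?X - {s}. ?c s t))"
  proof (rule G.finsum_cong'[OF refl])
    show "(\<lambda>s. koszul_sign R T s \<odot>\<^bsub>G\<^esub> ((\<ominus> parity_sign R (card T)) \<odot>\<^bsub>G\<^esub> p s) \<oplus>\<^bsub>G\<^esub>
          (\<Oplus>\<^bsub>G\<^esub>t\<in>?X - {s}. ?c s t)) \<in> ?X \<rightarrow> carrier G"
      by (rule funcsetI) (rule G.a_closed[OF funcset_mem[OF B] funcset_mem[OF C]])
    fix s assume s: "s \<in> ?X"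
    have qq: "(\<lambda>t. koszul_sign R (insert s T) t \<odot>\<^bsub>G\<^esub> q s t) \<in> ?X - {s} \<rightarrow> carrier G"
      by (rule funcsetI) (rule smc[OF koszul_sign_closed qc[OF s]])
    have "koszul_sign R T s \<odot>\<^bsub>G\<^esub> \<gamma> T s (i - 1) (d i z (insert s T))
      = koszul_sign R T s \<odot>\<^bsub>G\<^esub> ((\<ominus> parity_sign R (card T)) \<odot>\<^bsub>G\<^esub> p s) \<oplus>\<^bsub>G\<^esub>
        koszul_sign R T s \<odot>\<^bsub>G\<^esub> (\<Oplus>\<^bsub>G\<^esub>t\<in>?X - {s}. koszul_sign R (insert s T) t \<odot>\<^bsub>G\<^esub> q s t)"
      unfolding d_at[OF ins[OF s]] eS[OF s]
      by (rule G.smult_r_distr[OF koszul_sign_closed smc[OF _ pc[OF s]] G.finsum_closed[OF qq]]) simp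
    also have "koszul_sign R T s \<odot>\<^bsub>G\<^esub> (\<Oplus>\<^bsub>G\<^esub>t\<in>?X - {s}. koszul_sign R (insert s T) t \<odot>\<^bsub>G\<^esub> q s t)
        = (\<Oplus>\<^bsub>G\<^esub>t\<in>?X - {s}. koszul_sign R T s \<odot>\<^bsub>G\<^esub> (koszul_sign R (insert s T) t \<odot>\<^bsub>G\<^esub> q s t))"
      by (rule G.finsum_smult_ldistr[OF _ koszul_sign_closed qq]) simp
    also have "\<dots> = (\<Oplus>\<^bsub>G\<^esub>t\<in>?X - {s}. ?c s t)"
    proof (rule G.finsum_cong'[OF refl])
      show "?c s \<in> ?X - {s} \<rightarrow> carrier G" by (rule funcsetI) (rule cc[OF s])
      fix t assume t: "t \<in> ?X - {s}"
      show "koszul_sign R T s \<odot>\<^bsub>G\<^esub> (koszul_sign R (insert s T) t \<odot>\<^bsub>G\<^esub> q s t) = ?c s t"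
        by (rule G.smult_assoc1[OF koszul_sign_closed koszul_sign_closed qc[OF s t], symmetric])
    qed
    finally show "koszul_sign R T s \<odot>\<^bsub>G\<^esub> \<gamma> T s (i - 1) (d i z (insert s T))
      = koszul_sign R T s \<odot>\<^bsub>G\<^esub> ((\<ominus> parity_sign R (card T)) \<odot>\<^bsub>G\<^esub> p s) \<oplus>\<^bsub>G\<^esub> (\<Oplus>\<^bsub>G\<^esub>t\<in>?X - {s}. ?c s t)" .
  qed
  also have "\<dots> = (\<Oplus>\<^bsub>G\<^esub>s\<in>?X. koszul_sign R T s \<odot>\<^bsub>G\<^esub> ((\<ominus> parity_sign R (card T)) \<odot>\<^bsub>G\<^esub> p s)) \<oplus>\<^bsub>G\<^esub>
      (\<Oplus>\<^bsub>G\<^esub>s\<in>?X. \<Oplus>\<^bsub>G\<^esub>t\<in>?X - {s}. ?c s t)"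
    by (rule G.finsum_addf[OF B C])
  also have "(\<Oplus>\<^bsub>G\<^esub>s\<in>?X. \<Oplus>\<^bsub>G\<^esub>t\<in>?X - {s}. ?c s t) = \<zero>\<^bsub>G\<^esub>"
  proof (rule G.finsum_antisymmetric)
    fix s t assume st': "s \<in> ?X" "t \<in> ?X" "s \<noteq> t"
    show "?c s t \<in> carrier G" by (rule cc) (use st' in auto)
    have "?c s t = (\<ominus> (koszul_sign R T t \<otimes> koszul_sign R (insert t T) s)) \<odot>\<^bsub>G\<^esub> q s t"
      using koszul_sign_antisymmetric[OF finT, of s t] st' by (simp only: Diff_iff not_False_eq_True)
    also have "\<dots> = \<ominus>\<^bsub>G\<^esub> ?c t s"
      using qsym[of s t] qc[of s t] st' by (simp add: G.smult_l_minus)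
    finally show "?c s t \<oplus>\<^bsub>G\<^esub> ?c t s = \<zero>\<^bsub>G\<^esub>"
      using cc[of t s] st' by (simp add: G.l_neg)
  qed simp
  also have "parity_sign R (card T) \<odot>\<^bsub>G\<^esub> \<delta> T (i - 1) (comp i T z)
      = (\<Oplus>\<^bsub>G\<^esub>s\<in>?X. parity_sign R (card T) \<odot>\<^bsub>G\<^esub> (koszul_sign R T s \<odot>\<^bsub>G\<^esub> p s))"
    unfolding eT by (rule G.finsum_smult_ldistr[OF _ parity_sign_closed])
      (simp, rule funcsetI, rule smc[OF koszul_sign_closed pc])
  also have "(\<Oplus>\<^bsub>G\<^esub>s\<in>?X. parity_sign R (card T) \<odot>\<^bsub>G\<^esub> (koszul_sign R T s \<odot>\<^bsub>G\<^esub> p s)) \<oplus>\<^bsub>G\<^esub>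
      ((\<Oplus>\<^bsub>G\<^esub>s\<in>?X. koszul_sign R T s \<odot>\<^bsub>G\<^esub> ((\<ominus> parity_sign R (card T)) \<odot>\<^bsub>G\<^esub> p s)) \<oplus>\<^bsub>G\<^esub> \<zero>\<^bsub>G\<^esub>)
      = (\<Oplus>\<^bsub>G\<^esub>s\<in>?X. parity_sign R (card T) \<odot>\<^bsub>G\<^esub> (koszul_sign R T s \<odot>\<^bsub>G\<^esub> p s) \<oplus>\<^bsub>G\<^esub>
          koszul_sign R T s \<odot>\<^bsub>G\<^esub> ((\<ominus> parity_sign R (card T)) \<odot>\<^bsub>G\<^esub> p s))"
    unfolding G.r_zero[OF G.finsum_closed[OF B]] by (rule G.finsum_addf[OF A B, symmetric])
  also have "\<dots> = \<zero>\<^bsub>G\<^esub>"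
  proof (rule G.add.finprod_one_eqI)
    fix s assume s: "s \<in> ?X"
    show "parity_sign R (card T) \<odot>\<^bsub>G\<^esub> (koszul_sign R T s \<odot>\<^bsub>G\<^esub> p s) \<oplus>\<^bsub>G\<^esub>
          koszul_sign R T s \<odot>\<^bsub>G\<^esub> ((\<ominus> parity_sign R (card T)) \<odot>\<^bsub>G\<^esub> p s) = \<zero>\<^bsub>G\<^esub>"
      using pc[OF s]
      by (simp add: G.smult_l_minus G.smult_r_minus G.smult_assoc1[symmetric] m_comm G.r_neg)
  qed
  also have "\<zero>\<^bsub>G\<^esub> = \<zero>\<^bsub>Y (i - 1 - 1)\<^esub> T" unfolding G_def by (rule Y_zero[OF T, symmetric])
  finally show "d (i - 1) (d i z) T = \<zero>\<^bsub>Y (i - 1 - 1)\<^esub> T" .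
qed

lemma K_closed: "m \<in> carrier (K i) \<Longrightarrow> S \<in> koszul_index n i \<Longrightarrow> m S \<in> carrier N"
  unfolding K_def by (rule direct_sum_closed)

lemma K_eqI:
  assumes "m \<in> carrier (K i)" "l \<in> carrier (K i)" "\<And>S. S \<in> koszul_index n i \<Longrightarrow> m S = l S"
  shows "m = l"
  by (rule direct_sum_eqI[OF assms(1,2)[unfolded K_def] assms(3)])

lemma f_at: "S \<in> koszul_index n i \<Longrightarrow> f i z S = \<eta> i (z S)"
  by (simp add: f_def)

text \<open>In a component \<open>T\<close> with \<open>i - 1\<close> elements,
  \<open>\<eta>\<close> kills the summand with \<open>\<delta>\<close> and turns removal of
  \<open>s\<close> into multiplication by \<open>x s\<close>; what is left is the Koszul
  differential with the same signs.\<close>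

lemma f_d:
  assumes z: "z \<in> carrier (Y i)"
  shows "f (i - 1) (d i z) = koszul_diff R x n N i (f i z)"
proof (rule K_eqI)
  show "f (i - 1) (d i z) \<in> carrier (K (i - 1))"
    by (rule mod_hom_closed[OF f_hom mod_hom_closed[OF d_hom z]])
  show "koszul_diff R x n N i (f i z) \<in> carrier (K (i - 1))"
    unfolding K_def
    by (rule mod_hom_closed[OF koszul_diff_hom[where x = x and n = n, OF N.module_axioms x_closed]
          mod_hom_closed[OF f_hom z, unfolded K_def]])
  fix T assume T': "T \<in> koszul_index n (i - 1)"
  note T = koszul_index_subset[OF T']
  let ?X = "{1..n} - T" and ?H = "V T (i - 1)"
  interpret H: module R ?H by (rule V_module[OF T])
  note \<eta> = \<eta>_hom[OF T'] and ins = insert_subset'[OF T]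
  have zc: "z (insert s T) \<in> carrier (V (insert s T) i)" if "s \<in> ?X" for s
    using Y_closed[OF z ins[OF that]] .
  have gz: "\<gamma> T s i (z (insert s T)) \<in> carrier ?H" if "s \<in> ?X" for s
    by (rule mod_hom_closed[OF \<gamma>_hom[OF T that] zc[OF that]])
  have fc: "(\<lambda>s. koszul_sign R T s \<odot>\<^bsub>?H\<^esub> \<gamma> T s i (z (insert s T))) \<in> ?X \<rightarrow> carrier ?H"
    by (rule funcsetI) (rule H.smult_closed[OF koszul_sign_closed gz])
  have ezc: "\<eta> i (z (insert s T)) \<in> carrier N" if "s \<in> ?X" for s
    by (rule mod_hom_closed[OF \<eta>_hom[OF koszul_index_insert[OF T' that]] zc[OF that]])
  have nc: "(\<lambda>s. (koszul_sign R T s \<otimes> x s) \<odot>\<^bsub>N\<^esub> \<eta> i (z (insert s T))) \<in> ?X \<rightarrow> carrier N"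
    by (rule funcsetI) (use ezc x_closed in \<open>auto intro!: N.smult_closed\<close>)
  have "f (i - 1) (d i z) T = \<eta> (i - 1) (comp i T z)"
    by (simp only: f_at[OF T'] d_at[OF T])
  also have "\<dots> = parity_sign R (card T) \<odot>\<^bsub>N\<^esub> \<eta> (i - 1) (\<delta> T i (z T)) \<oplus>\<^bsub>N\<^esub>
      \<eta> (i - 1) (\<Oplus>\<^bsub>?H\<^esub>s\<in>?X. koszul_sign R T s \<odot>\<^bsub>?H\<^esub> \<gamma> T s i (z (insert s T)))"
    unfolding comp_def
    by (rule mod_hom_smult_add[OF V_module[OF T] \<eta> parity_sign_closed
          mod_hom_closed[OF \<delta>_hom[OF T] Y_closed[OF z T]] H.finsum_closed[OF fc]])
  also have "\<eta> (i - 1) (\<delta> T i (z T)) = \<zero>\<^bsub>N\<^esub>"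
    by (rule \<eta>_\<delta>[OF T' Y_closed[OF z T]])
  also have "\<eta> (i - 1) (\<Oplus>\<^bsub>?H\<^esub>s\<in>?X. koszul_sign R T s \<odot>\<^bsub>?H\<^esub> \<gamma> T s i (z (insert s T)))
      = (\<Oplus>\<^bsub>N\<^esub>s\<in>?X. \<eta> (i - 1) (koszul_sign R T s \<odot>\<^bsub>?H\<^esub> \<gamma> T s i (z (insert s T))))"
    by (rule mod_hom_finsum[OF V_module[OF T] N.module_axioms \<eta> _ fc]) simp
  also have "\<dots> = (\<Oplus>\<^bsub>N\<^esub>s\<in>?X. (koszul_sign R T s \<otimes> x s) \<odot>\<^bsub>N\<^esub> \<eta> i (z (insert s T)))"
  proof (rule N.finsum_cong'[OF refl nc])
    fix s assume s: "s \<in> ?X"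
    have "\<eta> (i - 1) (koszul_sign R T s \<odot>\<^bsub>?H\<^esub> \<gamma> T s i (z (insert s T)))
        = koszul_sign R T s \<odot>\<^bsub>N\<^esub> (x s \<odot>\<^bsub>N\<^esub> \<eta> i (z (insert s T)))"
      unfolding mod_hom_smult[OF \<eta> koszul_sign_closed gz[OF s]] \<eta>_\<gamma>[OF T' s zc[OF s]] ..
    then show "\<eta> (i - 1) (koszul_sign R T s \<odot>\<^bsub>?H\<^esub> \<gamma> T s i (z (insert s T)))
        = (koszul_sign R T s \<otimes> x s) \<odot>\<^bsub>N\<^esub> \<eta> i (z (insert s T))"
      using ezc[OF s] x_closed s by (simp add: N.smult_assoc1)
  qed
  also have "\<dots> = (\<Oplus>\<^bsub>N\<^esub>s\<in>?X. (koszul_sign R T s \<otimes> x s) \<odot>\<^bsub>N\<^esub> f i z (insert s T))"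
    by (rule N.finsum_cong'[OF refl])
      (use ezc x_closed in \<open>auto intro!: N.smult_closed simp: f_at[OF koszul_index_insert[OF T']]\<close>)
  also have "parity_sign R (card T) \<odot>\<^bsub>N\<^esub> \<zero>\<^bsub>N\<^esub> \<oplus>\<^bsub>N\<^esub> \<dots> = \<dots>"
    unfolding N.smult_r_null[OF parity_sign_closed]
    by (rule N.l_zero, rule N.finsum_closed)
      (use ezc x_closed in \<open>auto intro!: N.smult_closed simp: f_at[OF koszul_index_insert[OF T']]\<close>)
  also have "\<dots> = koszul_diff R x n N i (f i z) T" using T' by (simp add: koszul_diff_def)
  finally show "f (i - 1) (d i z) T = koszul_diff R x n N i (f i z) T" .
qed

lemma f_surj: "f i ` carrier (Y i) = carrier (K i)"
proof (intro equalityI subsetI)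
  fix m assume "m \<in> f i ` carrier (Y i)"
  then show "m \<in> carrier (K i)" using mod_hom_closed[OF f_hom] by (elim imageE) simp
next
  fix m assume m: "m \<in> carrier (K i)"
  \<comment> \<open>Only the components in \<open>koszul_index n i\<close> are seen by
    \<open>f\<close>; the others may be taken to be zero.\<close>
  define z where "z = (\<lambda>S\<in>Pow {1..n}. if S \<in> koszul_index n i
    then SOME v. v \<in> carrier (V S i) \<and> \<eta> i v = m S else \<zero>\<^bsub>V S i\<^esub>)"
  have zS: "z S \<in> carrier (V S i) \<and> \<eta> i (z S) = m S" if S: "S \<in> koszul_index n i" for S
  proof -
    have "m S \<in> \<eta> i ` carrier (V S i)" using \<eta>_surj[OF S] K_closed[OF m S] by simp
    then have "\<exists>v. v \<in> carrier (V S i) \<and> \<eta> i v = m S" by auto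
    from someI_ex[OF this] show ?thesis using S koszul_index_subset[OF S] by (simp add: z_def)
  qed
  have z: "z \<in> carrier (Y i)"
    unfolding Y_carrier
  proof (rule PiE_I)
    fix S assume S: "S \<in> Pow {1..n}"
    interpret S: module R "V S i" using V_module S by simp
    show "z S \<in> carrier (V S i)"
      using zS[of S] S by (cases "S \<in> koszul_index n i") (simp_all add: z_def)
  qed (simp add: z_def)
  have "f i z = m"
    by (rule K_eqI[OF mod_hom_closed[OF f_hom z] m]) (simp add: f_at zS)
  then show "m \<in> f i ` carrier (Y i)" using z by blast
qed

text \<open>A cycle in the kernel is killed by removing its components in order of decreasing
  cardinality: a component of maximal cardinality is itself a cycle of \<open>V S\<close>.\<close>

lemma acyclic_kernel_step:
  assumes z: "z \<in> carrier (Y i)" and fz: "f i z = \<zero>\<^bsub>K i\<^esub>" and dz: "d i z = \<zero>\<^bsub>Y (i - 1)\<^esub>"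
    and top: "\<And>S. S \<subseteq> {1..n} \<Longrightarrow> k < card S \<Longrightarrow> z S = \<zero>\<^bsub>V S i\<^esub>"
  shows "\<exists>v\<in>carrier (Y (i + 1)). f (i + 1) v = \<zero>\<^bsub>K (i + 1)\<^esub> \<and>
    (\<forall>S. S \<subseteq> {1..n} \<longrightarrow> k \<le> card S \<longrightarrow> d (i + 1) v S = z S)"
proof -
  define P where "P S w \<longleftrightarrow> w \<in> carrier (V S (i + 1)) \<and> \<delta> S (i + 1) w = z S \<and>
        (S \<in> koszul_index n (i + 1) \<longrightarrow> \<eta> (i + 1) w = \<zero>\<^bsub>N\<^esub>)" for S w
  have ex: "\<exists>w. P S w" if S: "S \<subseteq> {1..n}" "card S = k" for S
  proof -
    let ?H = "V S (i - 1)"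
    interpret H: module R ?H by (rule V_module[OF S(1)])
    have finS: "finite S" using S(1) finite_subset by blast
    have zS: "z S \<in> carrier (V S i)" by (rule Y_closed[OF z S(1)])
    have dzS: "\<delta> S i (z S) \<in> carrier ?H" by (rule mod_hom_closed[OF \<delta>_hom[OF S(1)] zS])
    \<comment> \<open>The other contributions to the component of \<open>d i z\<close> at
      \<open>S\<close> come from sets with \<open>k + 1\<close> elements, where \<open>z\<close>
      vanishes. Hence this component is \<open>\<delta> S i (z S)\<close> up to sign.\<close>
    have 0: "koszul_sign R S s \<odot>\<^bsub>?H\<^esub> \<gamma> S s i (z (insert s S)) = \<zero>\<^bsub>?H\<^esub>" if s: "s \<in> {1..n} - S" for s
    proof -
      have "z (insert s S) = \<zero>\<^bsub>V (insert s S) i\<^esub>"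
        by (rule top[OF insert_subset'[OF S(1) s]]) (use S(2) s finS in simp)
      then have "\<gamma> S s i (z (insert s S)) = \<zero>\<^bsub>?H\<^esub>"
        using mod_hom_zero[OF V_module[OF insert_subset'[OF S(1) s]] V_module[OF S(1)] \<gamma>_hom[OF S(1) s]]
        by simp
      then show ?thesis by (simp only: H.smult_r_null[OF koszul_sign_closed])
    qed
    have "(\<Oplus>\<^bsub>?H\<^esub>s\<in>{1..n} - S. koszul_sign R S s \<odot>\<^bsub>?H\<^esub> \<gamma> S s i (z (insert s S))) = \<zero>\<^bsub>?H\<^esub>"
      by (rule H.add.finprod_one_eqI[OF 0])
    moreover have "comp i S z = \<zero>\<^bsub>?H\<^esub>"
      using d_at[OF S(1), of i z] Y_zero[OF S(1), of "i - 1"] dz by simp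
    ultimately have "parity_sign R (card S) \<odot>\<^bsub>?H\<^esub> \<delta> S i (z S) = \<zero>\<^bsub>?H\<^esub>"
      using H.smult_closed[OF parity_sign_closed dzS, of "card S"] unfolding comp_def by simp
    then have "parity_sign R (card S) \<odot>\<^bsub>?H\<^esub> (parity_sign R (card S) \<odot>\<^bsub>?H\<^esub> \<delta> S i (z S)) = \<zero>\<^bsub>?H\<^esub>"
      by (simp only: H.smult_r_null[OF parity_sign_closed])
    then have "\<delta> S i (z S) = \<zero>\<^bsub>?H\<^esub>"
      using dzS by (simp add: H.smult_assoc1[symmetric] parity_sign_square)
    moreover have "\<eta> i (z S) = \<zero>\<^bsub>N\<^esub>" if "S \<in> koszul_index n i"
      using f_at[OF that, of z] fz that by (simp add: K_def direct_sum_zero)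
    ultimately show ?thesis using exact[OF S(1) zS] unfolding P_def by blast
  qed
  \<comment> \<open>The sign compensates for the factor with which \<open>\<delta>\<close> enters
    the total differential.\<close>
  define v where "v = (\<lambda>S\<in>Pow {1..n}. if card S = k
    then parity_sign R k \<odot>\<^bsub>V S (i + 1)\<^esub> (SOME w. P S w) else \<zero>\<^bsub>V S (i + 1)\<^esub>)"
  have vk: "\<exists>w. v S = parity_sign R k \<odot>\<^bsub>V S (i + 1)\<^esub> w \<and> P S w" if "S \<subseteq> {1..n}" "card S = k" for S
    using that someI_ex[OF ex[OF that]] by (auto simp: v_def)
  have v0: "v S = \<zero>\<^bsub>V S (i + 1)\<^esub>" if "S \<subseteq> {1..n}" "card S \<noteq> k" for S
    using that by (simp add: v_def)
  have vc: "v S \<in> carrier (V S (i + 1))" if S: "S \<subseteq> {1..n}" for S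
  proof -
    interpret H: module R "V S (i + 1)" by (rule V_module[OF S])
    show ?thesis
      using vk[OF S] v0[OF S] H.smult_closed[OF parity_sign_closed, of _ k] unfolding P_def
      by (cases "card S = k") auto
  qed
  have v: "v \<in> carrier (Y (i + 1))"
    unfolding Y_carrier by (rule PiE_I) (use vc in \<open>simp_all add: v_def\<close>)
  have "f (i + 1) v = \<zero>\<^bsub>K (i + 1)\<^esub>"
  proof (rule K_eqI[OF mod_hom_closed[OF f_hom v]])
    interpret K: module R "K (i + 1)" by (rule K_module)
    show "\<zero>\<^bsub>K (i + 1)\<^esub> \<in> carrier (K (i + 1))" by (rule K.zero_closed)
    fix S assume S': "S \<in> koszul_index n (i + 1)"
    note S = koszul_index_subset[OF S']
    have "\<eta> (i + 1) (v S) = \<zero>\<^bsub>N\<^esub>"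
    proof (cases "card S = k")
      case True
      from vk[OF S True] obtain w where "v S = parity_sign R k \<odot>\<^bsub>V S (i + 1)\<^esub> w" "P S w" by (elim exE conjE)
      then show ?thesis
        using S' mod_hom_smult[OF \<eta>_hom[OF S'] parity_sign_closed[of k], of w] by (simp add: P_def)
    next
      case False
      then show ?thesis
        using v0[OF S False] mod_hom_zero[OF V_module[OF S] N.module_axioms \<eta>_hom[OF S']] by simp
    qed
    then show "f (i + 1) v S = \<zero>\<^bsub>K (i + 1)\<^esub> S"
      using S' by (simp add: f_at K_def direct_sum_zero)
  qed
  moreover have "d (i + 1) v S = z S" if S: "S \<subseteq> {1..n}" "k \<le> card S" for S
  proof -
    let ?H = "V S i"
    interpret H: module R ?H by (rule V_module[OF S(1)])
    have finS: "finite S" using S(1) finite_subset by blast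
    have \<delta>': "\<delta> S (i + 1) \<in> mod_hom R (V S (i + 1)) ?H" using \<delta>_hom[OF S(1), of "i + 1"] by simp
    have zS: "z S \<in> carrier ?H" by (rule Y_closed[OF z S(1)])
    have 0: "koszul_sign R S s \<odot>\<^bsub>?H\<^esub> \<gamma> S s (i + 1) (v (insert s S)) = \<zero>\<^bsub>?H\<^esub>"
      if s: "s \<in> {1..n} - S" for s
    proof -
      have g: "\<gamma> S s (i + 1) \<in> mod_hom R (V (insert s S) (i + 1)) ?H"
        using \<gamma>_hom[OF S(1) s, of "i + 1"] by simp
      have "v (insert s S) = \<zero>\<^bsub>V (insert s S) (i + 1)\<^esub>"
        by (rule v0[OF insert_subset'[OF S(1) s]]) (use S(2) s finS in simp)
      then have "\<gamma> S s (i + 1) (v (insert s S)) = \<zero>\<^bsub>?H\<^esub>"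
        using mod_hom_zero[OF V_module[OF insert_subset'[OF S(1) s]] V_module[OF S(1)] g] by simp
      then show ?thesis by (simp only: H.smult_r_null[OF koszul_sign_closed])
    qed
    have sum0: "(\<Oplus>\<^bsub>?H\<^esub>s\<in>{1..n} - S. koszul_sign R S s \<odot>\<^bsub>?H\<^esub> \<gamma> S s (i + 1) (v (insert s S))) = \<zero>\<^bsub>?H\<^esub>"
      by (rule H.add.finprod_one_eqI[OF 0])
    have i1: "i + 1 - 1 = i" by simp
    have "d (i + 1) v S = parity_sign R (card S) \<odot>\<^bsub>?H\<^esub> \<delta> S (i + 1) (v S) \<oplus>\<^bsub>?H\<^esub> \<zero>\<^bsub>?H\<^esub>"
      unfolding d_at[OF S(1)] comp_def i1 sum0 ..
    also have "\<dots> = parity_sign R (card S) \<odot>\<^bsub>?H\<^esub> \<delta> S (i + 1) (v S)"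
      by (rule H.r_zero[OF H.smult_closed[OF parity_sign_closed mod_hom_closed[OF \<delta>' vc[OF S(1)]]]])
    also have "\<dots> = z S"
    proof (cases "card S = k")
      case True
      from vk[OF S(1) True] obtain w where w: "v S = parity_sign R k \<odot>\<^bsub>V S (i + 1)\<^esub> w" "P S w" by (elim exE conjE)
      have "\<delta> S (i + 1) (v S) = parity_sign R k \<odot>\<^bsub>?H\<^esub> z S"
        using mod_hom_smult[OF \<delta>' parity_sign_closed[of k], of w] w by (simp add: P_def)
      then show ?thesis using True zS by (simp add: H.smult_assoc1[symmetric] parity_sign_square)
    next
      case False
      then have "v S = \<zero>\<^bsub>V S (i + 1)\<^esub>" "z S = \<zero>\<^bsub>?H\<^esub>" using v0[OF S(1)] top[OF S(1)] S(2) by auto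
      then show ?thesis
        using mod_hom_zero[OF V_module[OF S(1)] V_module[OF S(1)] \<delta>'] H.smult_r_null[OF parity_sign_closed] by simp
    qed
    finally show ?thesis .
  qed
  ultimately show ?thesis using v by blast
qed

text \<open>Induction on a strict bound \<open>k\<close> for the cardinalities at which
  \<open>z\<close> may be nonzero. One step subtracts the boundary of an element of the kernel; the
  difference is again a cycle of the kernel, with a bound smaller by one.\<close>

lemma acyclic_kernel_aux:
  assumes "z \<in> carrier (Y i)" "f i z = \<zero>\<^bsub>K i\<^esub>" "d i z = \<zero>\<^bsub>Y (i - 1)\<^esub>"
    and "\<And>S. S \<subseteq> {1..n} \<Longrightarrow> k \<le> card S \<Longrightarrow> z S = \<zero>\<^bsub>V S i\<^esub>"
  shows "\<exists>w\<in>carrier (Y (i + 1)). f (i + 1) w = \<zero>\<^bsub>K (i + 1)\<^esub> \<and> d (i + 1) w = z"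
  using assms
proof (induction k arbitrary: z)
  case 0
  interpret Yi: module R "Y i" by (rule Y_module)
  interpret Y1: module R "Y (i + 1)" by (rule Y_module)
  have d': "d (i + 1) \<in> mod_hom R (Y (i + 1)) (Y i)" using d_hom[of "i + 1"] by simp
  have "z = \<zero>\<^bsub>Y i\<^esub>"
    by (rule Y_eqI[OF 0(1) Yi.zero_closed]) (simp add: Y_zero 0(4))
  then show ?case
    using Y1.zero_closed mod_hom_zero[OF Y_module Y_module d'] mod_hom_zero[OF Y_module K_module f_hom]
    by (intro bexI[of _ "\<zero>\<^bsub>Y (i + 1)\<^esub>"]) simp_all
next
  case (Suc k)
  interpret Yi: module R "Y i" by (rule Y_module)
  interpret Ym: module R "Y (i - 1)" by (rule Y_module)
  interpret Y1: module R "Y (i + 1)" by (rule Y_module)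
  interpret Ki: module R "K i" by (rule K_module)
  interpret K1: module R "K (i + 1)" by (rule K_module)
  have i1: "i + 1 - 1 = i" by simp
  note d' = d_hom[of "i + 1", unfolded i1]
  obtain v where v: "v \<in> carrier (Y (i + 1))" "f (i + 1) v = \<zero>\<^bsub>K (i + 1)\<^esub>"
    and vz: "\<And>S. S \<subseteq> {1..n} \<Longrightarrow> k \<le> card S \<Longrightarrow> d (i + 1) v S = z S"
    using acyclic_kernel_step[OF Suc.prems(1-3), of k] Suc.prems(4) by (auto simp: Suc_le_eq)
  have dv: "d (i + 1) v \<in> carrier (Y i)" by (rule mod_hom_closed[OF d' v(1)])
  define u where "u = z \<ominus>\<^bsub>Y i\<^esub> d (i + 1) v"
  have u: "u \<in> carrier (Y i)" unfolding u_def by (rule Yi.minus_closed[OF Suc.prems(1) dv])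
  have "f i (d (i + 1) v) = koszul_diff R x n N (i + 1) (f (i + 1) v)"
    using f_d[OF v(1)] by simp
  also have "\<dots> = \<zero>\<^bsub>K i\<^esub>"
    using mod_hom_zero[OF K_module[of "i + 1"] K_module[of i]
        koszul_diff_hom[where x = x and n = n and i = "i + 1", OF N.module_axioms x_closed, unfolded i1, folded K_def]]
    by (simp add: v(2))
  finally have fdv: "f i (d (i + 1) v) = \<zero>\<^bsub>K i\<^esub>" .
  have fu: "f i u = \<zero>\<^bsub>K i\<^esub>"
    unfolding u_def mod_hom_minus[OF Y_module K_module f_hom Suc.prems(1) dv] fdv Suc.prems(2)
    by (simp add: Ki.minus_eq)
  have "d i (d (i + 1) v) = \<zero>\<^bsub>Y (i - 1)\<^esub>" using d_d[OF v(1)] by simp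
  then have du: "d i u = \<zero>\<^bsub>Y (i - 1)\<^esub>"
    unfolding u_def mod_hom_minus[OF Y_module Y_module d_hom Suc.prems(1) dv] Suc.prems(3)
    by (simp add: Ym.minus_eq)
  have "u S = \<zero>\<^bsub>V S i\<^esub>" if S: "S \<subseteq> {1..n}" "k \<le> card S" for S
  proof -
    interpret H: module R "V S i" by (rule V_module[OF S(1)])
    have "u S = z S \<ominus>\<^bsub>V S i\<^esub> d (i + 1) v S"
      unfolding u_def by (rule mod_hom_minus[OF Y_module V_module[OF S(1)] Y_proj[OF S(1)] Suc.prems(1) dv])
    then show ?thesis
      using vz[OF S] Y_closed[OF Suc.prems(1) S(1)] by (simp add: H.minus_eq H.r_neg)
  qed
  from Suc.IH[OF u fu du this] obtain w where w: "w \<in> carrier (Y (i + 1))"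
    "f (i + 1) w = \<zero>\<^bsub>K (i + 1)\<^esub>" "d (i + 1) w = u" by auto
  have "f (i + 1) (w \<oplus>\<^bsub>Y (i + 1)\<^esub> v) = \<zero>\<^bsub>K (i + 1)\<^esub>"
    unfolding mod_hom_add[OF f_hom w(1) v(1)] w(2) v(2) by simp
  moreover have "d (i + 1) (w \<oplus>\<^bsub>Y (i + 1)\<^esub> v) = z"
    unfolding mod_hom_add[OF d' w(1) v(1)] w(3) u_def
    using Suc.prems(1) dv by (simp add: Yi.minus_eq Yi.a_assoc Yi.l_neg)
  ultimately show ?case using Y1.a_closed[OF w(1) v(1)] by blast
qed

lemma acyclic_kernel:
  assumes "z \<in> carrier (Y i)" "f i z = \<zero>\<^bsub>K i\<^esub>" "d i z = \<zero>\<^bsub>Y (i - 1)\<^esub>"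
  shows "\<exists>w\<in>carrier (Y (i + 1)). f (i + 1) w = \<zero>\<^bsub>K (i + 1)\<^esub> \<and> d (i + 1) w = z"
\<comment> \<open>As subsets of \<open>{1..n}\<close> have at most \<open>n\<close> elements, the
  strict bound \<open>Suc n\<close> holds for every \<open>z\<close>.\<close>
proof (rule acyclic_kernel_aux[OF assms, of "Suc n"])
  fix S :: "nat set" assume "S \<subseteq> {1..n}" "Suc n \<le> card S"
  moreover from this have "card S \<le> n" using card_mono[of "{1..n}" S] by simp
  ultimately show "z S = \<zero>\<^bsub>V S i\<^esub>" by simp
qed

end

section \<open>Transport along surjections, and reindexing of direct sums\<close>

lemma chain_map_surjective:
  fixes C :: "('a, 'b) cplx" and E :: "('a, 'c) cplx"
  assumes C: "chain_complex R C"
    and E: "\<And>i. module R (obj E i)"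
    and F: "\<And>i. F i \<in> mod_hom R (obj C i) (obj E i)"
    and surj: "\<And>i. F i ` carrier (obj C i) = carrier (obj E i)"
    and comm: "\<And>i c. c \<in> carrier (obj C i) \<Longrightarrow> diff E i (F i c) = F (i - 1) (diff C i c)"
  shows "chain_map R C E F"
proof -
  note mC = chain_complex_module[OF C] and dC = chain_complex_hom[OF C]
  note dCc = mod_hom_closed[OF dC]
  \<comment> \<open>Every element of \<open>E\<close> is some \<open>F i c\<close>, so linearity of
    the differential of \<open>E\<close> and the vanishing of its square are inherited from
    \<open>C\<close>. For the Koszul complex this replaces a computation inside tensor
    products.\<close>
  have ex: "\<exists>c\<in>carrier (obj C i). y = F i c" if "y \<in> carrier (obj E i)" for y i
    using that surj[of i] by auto
  have "diff E i \<in> mod_hom R (obj E i) (obj E (i - 1))" for i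
  proof (rule mod_homI)
    interpret Ci: module R "obj C i" by (rule mC)
    fix y assume "y \<in> carrier (obj E i)"
    from ex[OF this] obtain c where c: "c \<in> carrier (obj C i)" "y = F i c" by (elim bexE)
    show "diff E i y \<in> carrier (obj E (i - 1))"
      unfolding c(2) comm[OF c(1)] by (rule mod_hom_closed[OF F dCc[OF c(1)]])
    show "diff E i (r \<odot>\<^bsub>obj E i\<^esub> y) = r \<odot>\<^bsub>obj E (i - 1)\<^esub> diff E i y" if r: "r \<in> carrier R" for r
      unfolding c(2) mod_hom_smult[OF F r c(1), symmetric] comm[OF c(1)]
        comm[OF Ci.smult_closed[OF r c(1)]] mod_hom_smult[OF dC r c(1)]
      by (rule mod_hom_smult[OF F r dCc[OF c(1)]])
    fix y' assume "y' \<in> carrier (obj E i)"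
    from ex[OF this] obtain c' where c': "c' \<in> carrier (obj C i)" "y' = F i c'" by (elim bexE)
    show "diff E i (y \<oplus>\<^bsub>obj E i\<^esub> y') = diff E i y \<oplus>\<^bsub>obj E (i - 1)\<^esub> diff E i y'"
      unfolding c(2) c'(2) mod_hom_add[OF F c(1) c'(1), symmetric] comm[OF c(1)] comm[OF c'(1)]
        comm[OF Ci.a_closed[OF c(1) c'(1)]] mod_hom_add[OF dC c(1) c'(1)]
      by (rule mod_hom_add[OF F dCc[OF c(1)] dCc[OF c'(1)]])
  qed
  moreover have "diff E (i - 1) (diff E i y) = \<zero>\<^bsub>obj E (i - 2)\<^esub>" if "y \<in> carrier (obj E i)" for i y
  proof -
    from ex[OF that] obtain c where c: "c \<in> carrier (obj C i)" "y = F i c" by (elim bexE)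
    have "diff E (i - 1) (diff E i y) = F (i - 1 - 1) (diff C (i - 1) (diff C i c))"
      unfolding c(2) comm[OF c(1)] comm[OF dCc[OF c(1)]] ..
    also have "\<dots> = F (i - 2) \<zero>\<^bsub>obj C (i - 2)\<^esub>"
      using chain_complex_diff_diff[OF C c(1)] by simp
    also have "\<dots> = \<zero>\<^bsub>obj E (i - 2)\<^esub>" by (rule mod_hom_zero[OF mC E F])
    finally show ?thesis .
  qed
  ultimately have "chain_complex R E" using E by (simp add: chain_complex_def)
  then show ?thesis using C F comm by (simp add: chain_map_def)
qed

lemma direct_sum_reindex:
  fixes W :: "'i \<Rightarrow> ('a, 'b) module" and V :: "'j \<Rightarrow> ('a, 'b) module"
  assumes R: "cring R" and fin: "finite A" "B \<subseteq> A"
    and bij: "bij_betw b I B"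
    and W: "\<And>i. i \<in> I \<Longrightarrow> W i = V (b i)"
    and V: "\<And>S. S \<in> A \<Longrightarrow> module R (V S)"
    and triv: "\<And>S. S \<in> A - B \<Longrightarrow> carrier (V S) = {\<zero>\<^bsub>V S\<^esub>}"
  defines "\<theta> \<equiv> \<lambda>f. \<lambda>S\<in>A. if S \<in> B then f (inv_into I b S) else \<zero>\<^bsub>V S\<^esub>"
    and "\<theta>' \<equiv> \<lambda>g. \<lambda>i\<in>I. g (b i)"
  shows "\<theta> \<in> mod_hom R (direct_sum I W) (direct_sum A V)"
    and "\<theta>' \<in> mod_hom R (direct_sum A V) (direct_sum I W)"
    and "\<And>g. g \<in> carrier (direct_sum A V) \<Longrightarrow> \<theta> (\<theta>' g) = g"
    and "\<And>f. f \<in> carrier (direct_sum I W) \<Longrightarrow> \<theta>' (\<theta> f) = f"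
proof -
  have finI: "finite I" using bij fin bij_betw_finite finite_subset by metis
  have bI: "b i \<in> B" if "i \<in> I" for i using bij that by (auto simp: bij_betw_def)
  have inv: "inv_into I b S \<in> I" "b (inv_into I b S) = S" if "S \<in> B" for S
    using bij that by (auto simp: bij_betw_def inv_into_into f_inv_into_f)
  have invb: "inv_into I b (b i) = i" if "i \<in> I" for i
    using bij that by (simp add: bij_betw_def)
  show \<theta>: "\<theta> \<in> mod_hom R (direct_sum I W) (direct_sum A V)"
    unfolding \<theta>_def
  proof (rule direct_sum_hom_tuple[OF fin(1)])
    fix S assume S: "S \<in> A"
    show "(\<lambda>f. if S \<in> B then f (inv_into I b S) else \<zero>\<^bsub>V S\<^esub>) \<in> mod_hom R (direct_sum I W) (V S)"
    proof (cases "S \<in> B")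
      case True
      have "(\<lambda>f. f (inv_into I b S)) \<in> mod_hom R (direct_sum I W) (W (inv_into I b S))"
        by (rule direct_sum_hom_proj[OF inv(1)[OF True]])
      then show ?thesis using True W[OF inv(1)[OF True]] inv(2)[OF True] by simp
    next
      case False
      then show ?thesis using mod_hom_const_zero[OF V[OF S]] by simp
    qed
  qed
  show \<theta>': "\<theta>' \<in> mod_hom R (direct_sum A V) (direct_sum I W)"
    unfolding \<theta>'_def
  proof (rule direct_sum_hom_tuple[OF finI])
    fix i assume i: "i \<in> I"
    show "(\<lambda>g. g (b i)) \<in> mod_hom R (direct_sum A V) (W i)"
      unfolding W[OF i] using bI[OF i] fin(2) by (intro direct_sum_hom_proj) auto
  qed
  show "\<theta> (\<theta>' g) = g" if g: "g \<in> carrier (direct_sum A V)" for g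
  proof (rule direct_sum_eqI[OF mod_hom_closed[OF \<theta> mod_hom_closed[OF \<theta>' g]] g])
    fix S assume S: "S \<in> A"
    show "\<theta> (\<theta>' g) S = g S"
    proof (cases "S \<in> B")
      case True
      then show ?thesis using S inv[OF True] by (simp add: \<theta>_def \<theta>'_def)
    next
      case False
      then show ?thesis using S triv[of S] direct_sum_closed[OF g S] by (simp add: \<theta>_def)
    qed
  qed
  show "\<theta>' (\<theta> f) = f" if f: "f \<in> carrier (direct_sum I W)" for f
  proof (rule direct_sum_eqI[OF mod_hom_closed[OF \<theta>' mod_hom_closed[OF \<theta> f]] f])
    fix i assume i: "i \<in> I"
    have "b i \<in> A" using bI[OF i] fin(2) by auto
    then show "\<theta>' (\<theta> f) i = f i" using i bI[OF i] invb[OF i] by (simp add: \<theta>_def \<theta>'_def)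
  qed
qed

section \<open>The Koszul complex as sums of copies of the module\<close>

lemma koszul_free_tensor: "module R N \<Longrightarrow> free_tensor_product R (koszul_index n i) N"
  by (simp add: free_tensor_product_def free_tensor_product_axioms_def koszul_index_finite)

lemma koszul_obj: "obj (koszul R x n N) i = tensor_module R (free_module R (koszul_index n i)) N"
  by (simp add: koszul_def tensor_cplx_def koszul_ring_def)

text \<open>The differential of \<open>K(x, R)\<close> is \<open>koszul_diff\<close> with
  coefficients in the ring. On \<open>scale u y\<close> the factor \<open>y\<close> can be pulled
  out of the sum, so \<open>tensor_map_to_tensor\<close> applies with \<open>koszul_diff\<close> for
  both sets of coefficients.\<close>

lemma koszul_diff_to_tensor:
  assumes N: "module R N" and x: "\<And>s. s \<in> {1..n} \<Longrightarrow> x s \<in> carrier R"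
    and m: "m \<in> carrier (direct_sum (koszul_index n i) (\<lambda>_. N))"
  shows "diff (koszul R x n N) i (free_tensor_product.to_tensor R (koszul_index n i) N m)
    = free_tensor_product.to_tensor R (koszul_index n (i - 1)) N (koszul_diff R x n N i m)"
proof -
  interpret N: module R N by fact
  have cr: "cring R" by unfold_locales
  interpret I: free_tensor_product R "koszul_index n i" N by (rule koszul_free_tensor[OF N])
  interpret J: free_tensor_product R "koszul_index n (i - 1)" N by (rule koszul_free_tensor[OF N])
  let ?f = "diff (koszul_ring R x n) i"
  have f_eq: "?f u = koszul_diff R x n (self_module R) i u" for u
    by (simp add: koszul_ring_def koszul_diff_def koszul_sign_def parity_sign_def finsum_self_module)
  have f_hom: "?f \<in> mod_hom R I.A J.A"
    unfolding f_eq[abs_def] free_module_def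
    by (rule koszul_diff_hom[where x = x, OF self_module_module[OF cr] x])
  have d_hom: "koszul_diff R x n N i \<in> mod_hom R I.D J.D"
    by (rule koszul_diff_hom[where x = x, OF N x])
  have fd: "koszul_diff R x n N i (I.scale u y) = J.scale (?f u) y"
    if u: "u \<in> carrier I.A" and y: "y \<in> carrier N" for u y
  proof (rule direct_sum_eqI[where V = "\<lambda>_. N"])
    show "koszul_diff R x n N i (I.scale u y) \<in> carrier J.D"
      by (rule mod_hom_closed[OF d_hom mod_hom_closed[OF I.scale_hom_left[OF y] u]])
    show "J.scale (?f u) y \<in> carrier J.D"
      by (rule mod_hom_closed[OF J.scale_hom_left[OF y] mod_hom_closed[OF f_hom u]])
    fix T assume T: "T \<in> koszul_index n (i - 1)"
    let ?X = "{1..n} - T" and ?c = "\<lambda>s. koszul_sign R T s \<otimes>\<^bsub>R\<^esub> x s"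
    have c: "?c s \<in> carrier R" if "s \<in> ?X" for s
      using x that N.koszul_sign_closed by auto
    have uc: "u (insert s T) \<in> carrier R" if "s \<in> ?X" for s
      by (rule free_module_closed[OF u koszul_index_insert[OF T that]])
    have cu: "(\<lambda>s. ?c s \<otimes>\<^bsub>R\<^esub> u (insert s T)) \<in> ?X \<rightarrow> carrier (self_module R)"
      using c uc by auto
    have "J.scale (?f u) y T = (\<Oplus>\<^bsub>self_module R\<^esub>s\<in>?X. ?c s \<otimes>\<^bsub>R\<^esub> u (insert s T)) \<odot>\<^bsub>N\<^esub> y"
      using T by (simp add: J.scale_def f_eq koszul_diff_def)
    also have "\<dots> = (\<Oplus>\<^bsub>N\<^esub>s\<in>?X. (?c s \<otimes>\<^bsub>R\<^esub> u (insert s T)) \<odot>\<^bsub>N\<^esub> y)"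
      by (rule mod_hom_finsum[OF self_module_module[OF cr] N smult_hom_self_module[OF N y] _ cu]) simp
    also have "\<dots> = (\<Oplus>\<^bsub>N\<^esub>s\<in>?X. ?c s \<odot>\<^bsub>N\<^esub> I.scale u y (insert s T))"
    proof (rule N.finsum_cong'[OF refl])
      show "(\<lambda>s. ?c s \<odot>\<^bsub>N\<^esub> I.scale u y (insert s T)) \<in> ?X \<rightarrow> carrier N"
        by (rule funcsetI)
          (simp only: I.scale_def koszul_index_insert[OF T] restrict_apply if_True
            N.smult_closed c uc y)
      fix s assume s: "s \<in> ?X"
      show "(?c s \<otimes>\<^bsub>R\<^esub> u (insert s T)) \<odot>\<^bsub>N\<^esub> y = ?c s \<odot>\<^bsub>N\<^esub> I.scale u y (insert s T)"
        unfolding I.scale_def using koszul_index_insert[OF T s] N.smult_assoc1[OF c[OF s] uc[OF s] y]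
        by simp
    qed
    also have "\<dots> = koszul_diff R x n N i (I.scale u y) T"
      using T by (simp add: koszul_diff_def)
    finally show "koszul_diff R x n N i (I.scale u y) T = J.scale (?f u) y T" ..
  qed
  have "diff (koszul R x n N) i = tensor_map R I.A J.A N ?f"
    by (simp add: koszul_def tensor_cplx_def koszul_ring_def)
  then show ?thesis
    using tensor_map_to_tensor[OF I.free_tensor_product_axioms J.free_tensor_product_axioms
        f_hom d_hom fd m] by simp
qed

context koszul_cube
begin

text \<open>\<open>\<theta>\<close> and \<open>\<theta>'\<close> allow to replace the index set \<open>Pow {1..n}\<close> of the total complex by
  another one.\<close>

lemma quasi_iso_koszul:
  assumes Q_module: "\<And>i. module R (Q i)"
    and \<theta>: "\<And>i. \<theta> i \<in> mod_hom R (Q i) (Y i)" and \<theta>': "\<And>i. \<theta>' i \<in> mod_hom R (Y i) (Q i)"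
    and \<theta>\<theta>': "\<And>i y. y \<in> carrier (Y i) \<Longrightarrow> \<theta> i (\<theta>' i y) = y"
    and \<theta>'\<theta>: "\<And>i v. v \<in> carrier (Q i) \<Longrightarrow> \<theta>' i (\<theta> i v) = v"
  defines "C \<equiv> \<lparr>obj = Q, diff = \<lambda>i v. \<theta>' (i - 1) (d i (\<theta> i v))\<rparr>"
  shows "chain_complex R C" and "\<exists>F. quasi_iso R C (koszul R x n N) F"
proof -
  let ?t = "\<lambda>i. free_tensor_product.to_tensor R (koszul_index n i) N"
  let ?E = "koszul R x n N"
  \<comment> \<open>The passage to the total complex, then its augmentation, then the identification
    of sums of copies of \<open>N\<close> with the degrees of the Koszul complex.\<close>
  define F where "F i v = ?t i (f i (\<theta> i v))" for i v
  note ftp = koszul_free_tensor[OF N.module_axioms]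
  have t_hom: "?t i \<in> mod_hom R (K i) (obj ?E i)" for i
    unfolding K_def koszul_obj by (rule free_tensor_product.to_tensor_hom[OF ftp])
  have t_bij: "bij_betw (?t i) (carrier (K i)) (carrier (obj ?E i))" for i
    unfolding K_def koszul_obj by (rule free_tensor_product.to_tensor_bij[OF ftp])
  have E_module: "module R (obj ?E i)" for i
  proof -
    interpret I: free_tensor_product R "koszul_index n i" N by (rule ftp)
    show ?thesis unfolding koszul_obj by (rule I.T_module)
  qed
  note \<theta>c = mod_hom_closed[OF \<theta>] and dc = mod_hom_closed[OF d_hom] and fc = mod_hom_closed[OF f_hom]
  have C_obj: "obj C i = Q i" and C_diff: "diff C i v = \<theta>' (i - 1) (d i (\<theta> i v))" for i v
    by (simp_all add: C_def)
  have C_hom: "diff C i \<in> mod_hom R (Q i) (Q (i - 1))" for i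
    unfolding C_def
    using mod_hom_compose[OF mod_hom_compose[OF \<theta> d_hom] \<theta>'] by simp
  have C_dd: "diff C (i - 1) (diff C i v) = \<zero>\<^bsub>Q (i - 2)\<^esub>" if v: "v \<in> carrier (Q i)" for i v
  proof -
    have "diff C (i - 1) (diff C i v) = \<theta>' (i - 1 - 1) (d (i - 1) (d i (\<theta> i v)))"
      unfolding C_diff \<theta>\<theta>'[OF dc[OF \<theta>c[OF v]]] ..
    also have "\<dots> = \<zero>\<^bsub>Q (i - 1 - 1)\<^esub>"
      unfolding d_d[OF \<theta>c[OF v]] by (rule mod_hom_zero[OF Y_module Q_module \<theta>'])
    finally show ?thesis by simp
  qed
  show C: "chain_complex R C"
    using Q_module C_hom C_dd by (simp add: chain_complex_def C_obj)
  have F_hom: "F i \<in> mod_hom R (obj C i) (obj ?E i)" for i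
    unfolding F_def[abs_def] C_obj by (rule mod_hom_compose[OF mod_hom_compose[OF \<theta> f_hom] t_hom])
  have F_surj: "F i ` carrier (obj C i) = carrier (obj ?E i)" for i
  proof (intro equalityI subsetI)
    fix e assume "e \<in> carrier (obj ?E i)"
    then obtain m where m: "m \<in> carrier (K i)" "e = ?t i m"
      using t_bij[of i] unfolding bij_betw_def by (metis imageE)
    then obtain y where y: "y \<in> carrier (Y i)" "m = f i y"
      using f_surj[of i] by (metis imageE)
    have "e = F i (\<theta>' i y)" unfolding F_def \<theta>\<theta>'[OF y(1)] m(2) y(2) ..
    then show "e \<in> F i ` carrier (obj C i)"
      unfolding C_obj using mod_hom_closed[OF \<theta>' y(1)] by (rule image_eqI)
  next
    fix e assume "e \<in> F i ` carrier (obj C i)"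
    then show "e \<in> carrier (obj ?E i)" using mod_hom_closed[OF F_hom] by (elim imageE) simp
  qed
  have F_comm: "diff ?E i (F i v) = F (i - 1) (diff C i v)" if "v \<in> carrier (obj C i)" for i v
  proof -
    have v: "v \<in> carrier (Q i)" using that by (simp only: C_obj)
    have "diff ?E i (F i v) = ?t (i - 1) (koszul_diff R x n N i (f i (\<theta> i v)))"
      unfolding F_def
      by (rule koszul_diff_to_tensor[where x = x, OF N.module_axioms x_closed fc[OF \<theta>c[OF v], unfolded K_def]])
    also have "\<dots> = F (i - 1) (diff C i v)"
      unfolding F_def C_diff \<theta>\<theta>'[OF dc[OF \<theta>c[OF v]]] f_d[OF \<theta>c[OF v]] ..
    finally show ?thesis .
  qed
  have "quasi_iso R C ?E F"
  proof (rule quasi_iso_if_acyclic_kernel[OF chain_map_surjective[OF C E_module F_hom F_surj F_comm] F_surj])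
    fix i v assume v': "v \<in> carrier (obj C i)" and Fv: "F i v = \<zero>\<^bsub>obj ?E i\<^esub>"
      and dv: "diff C i v = \<zero>\<^bsub>obj C (i - 1)\<^esub>"
    have v: "v \<in> carrier (Q i)" using v' by (simp only: C_obj)
    interpret Ki: module R "K i" by (rule K_module)
    have i1: "i + 1 - 1 = i" by simp
    have "?t i (f i (\<theta> i v)) = ?t i \<zero>\<^bsub>K i\<^esub>"
      using Fv unfolding F_def mod_hom_zero[OF K_module E_module t_hom] .
    then have fv: "f i (\<theta> i v) = \<zero>\<^bsub>K i\<^esub>"
      using t_bij[of i] fc[OF \<theta>c[OF v]] Ki.zero_closed unfolding bij_betw_def by (auto dest: inj_onD)
    have "d i (\<theta> i v) = \<theta> (i - 1) (diff C i v)"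
      unfolding C_diff by (rule \<theta>\<theta>'[OF dc[OF \<theta>c[OF v]], symmetric])
    also have "\<dots> = \<zero>\<^bsub>Y (i - 1)\<^esub>"
      unfolding dv C_obj by (rule mod_hom_zero[OF Q_module Y_module \<theta>])
    finally have "d i (\<theta> i v) = \<zero>\<^bsub>Y (i - 1)\<^esub>" .
    from acyclic_kernel[OF \<theta>c[OF v] fv this] obtain w where w: "w \<in> carrier (Y (i + 1))"
      "f (i + 1) w = \<zero>\<^bsub>K (i + 1)\<^esub>" "d (i + 1) w = \<theta> i v" by (elim bexE conjE)
    have "F (i + 1) (\<theta>' (i + 1) w) = \<zero>\<^bsub>obj ?E (i + 1)\<^esub>"
      unfolding F_def \<theta>\<theta>'[OF w(1)] w(2) by (rule mod_hom_zero[OF K_module E_module t_hom])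
    moreover have "diff C (i + 1) (\<theta>' (i + 1) w) = v"
      unfolding C_diff \<theta>\<theta>'[OF w(1)] w(3) i1 by (rule \<theta>'\<theta>[OF v])
    ultimately show "\<exists>w\<in>carrier (obj C (i + 1)). F (i + 1) w = \<zero>\<^bsub>obj ?E (i + 1)\<^esub> \<and> diff C (i + 1) w = v"
      unfolding C_obj using mod_hom_closed[OF \<theta>' w(1)] by blast
  qed
  then show "\<exists>F. quasi_iso R C ?E F" by blast
qed

end

section \<open>Lifting multiplications through syzygies\<close>

text \<open>The maps \<open>r\<close> and \<open>sec\<close> present \<open>B\<close> as a quotient
  of \<open>A\<close>. Although \<open>sec\<close> is a mere function, \<open>H\<close> takes equal
  values on elements with the same image under \<open>r\<close>, so the induced map is linear and
  independent of the section.\<close>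

lemma induced_hom:
  assumes A: "module R A" and B: "module R B" and L: "module R L"
    and r: "r \<in> mod_hom R A B" and H: "H \<in> mod_hom R A L"
    and ker: "\<And>p. p \<in> carrier A \<Longrightarrow> r p = \<zero>\<^bsub>B\<^esub> \<Longrightarrow> H p = \<zero>\<^bsub>L\<^esub>"
    and sec: "\<And>v. v \<in> carrier B \<Longrightarrow> sec v \<in> carrier A" "\<And>v. v \<in> carrier B \<Longrightarrow> r (sec v) = v"
  shows "(\<lambda>v. H (sec v)) \<in> mod_hom R B L"
    and "\<And>p. p \<in> carrier A \<Longrightarrow> H (sec (r p)) = H p"
proof -
  interpret A: module R A by fact
  interpret B: module R B by fact
  note rc = mod_hom_closed[OF r] and Hc = mod_hom_closed[OF H]
  have eq: "H a = H b" if a: "a \<in> carrier A" and b: "b \<in> carrier A" and ab: "r a = r b" for a b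
  proof (rule module_eq_if_minus_zero[OF L Hc[OF a] Hc[OF b]])
    have "r (a \<ominus>\<^bsub>A\<^esub> b) = \<zero>\<^bsub>B\<^esub>"
      unfolding mod_hom_minus[OF A B r a b] ab using rc[OF b] by (simp add: B.minus_eq B.r_neg)
    from ker[OF A.minus_closed[OF a b] this]
    show "H a \<ominus>\<^bsub>L\<^esub> H b = \<zero>\<^bsub>L\<^esub>" unfolding mod_hom_minus[OF A L H a b] .
  qed
  show *: "H (sec (r p)) = H p" if p: "p \<in> carrier A" for p
    by (rule eq[OF sec(1)[OF rc[OF p]] p sec(2)[OF rc[OF p]]])
  show "(\<lambda>v. H (sec v)) \<in> mod_hom R B L"
  proof (rule mod_homI)
    fix v assume v: "v \<in> carrier B"
    show "H (sec v) \<in> carrier L" by (rule Hc[OF sec(1)[OF v]])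
    show "H (sec (a \<odot>\<^bsub>B\<^esub> v)) = a \<odot>\<^bsub>L\<^esub> H (sec v)" if a: "a \<in> carrier R" for a
    proof -
      have "a \<odot>\<^bsub>B\<^esub> v = r (a \<odot>\<^bsub>A\<^esub> sec v)"
        unfolding mod_hom_smult[OF r a sec(1)[OF v]] sec(2)[OF v] ..
      then have "H (sec (a \<odot>\<^bsub>B\<^esub> v)) = H (a \<odot>\<^bsub>A\<^esub> sec v)"
        using *[OF A.smult_closed[OF a sec(1)[OF v]]] by simp
      then show ?thesis unfolding mod_hom_smult[OF H a sec(1)[OF v]] .
    qed
    fix w assume w: "w \<in> carrier B"
    have "v \<oplus>\<^bsub>B\<^esub> w = r (sec v \<oplus>\<^bsub>A\<^esub> sec w)"
      unfolding mod_hom_add[OF r sec(1)[OF v] sec(1)[OF w]] sec(2)[OF v] sec(2)[OF w] ..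
    then have "H (sec (v \<oplus>\<^bsub>B\<^esub> w)) = H (sec v \<oplus>\<^bsub>A\<^esub> sec w)"
      using *[OF A.a_closed[OF sec(1)[OF v] sec(1)[OF w]]] by simp
    then show "H (sec (v \<oplus>\<^bsub>B\<^esub> w)) = H (sec v) \<oplus>\<^bsub>L\<^esub> H (sec w)"
      unfolding mod_hom_add[OF H sec(1)[OF v] sec(1)[OF w]] .
  qed
qed

section \<open>Syzygies and the surjections onto them\<close>

locale ext_annihilated = M: module R M
  for R :: "('a, 'r) ring_scheme" and M :: "('a, 'm) module" +
  fixes P :: "('a, 'm) cplx" and \<epsilon> :: "'m \<Rightarrow> 'm" and x :: "nat \<Rightarrow> 'a" and n :: nat
  assumes res: "projective_resolution R M P \<epsilon>"
    and x_closed: "\<And>s. s \<in> {1..n} \<Longrightarrow> x s \<in> carrier R"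
    and Ext_zero: "\<And>s j e. s \<in> {1..n} \<Longrightarrow> j < s \<Longrightarrow>
      e \<in> carrier (Ext R P (syzygy M P (Suc j)) (Suc j)) \<Longrightarrow>
      x s \<odot>\<^bsub>Ext R P (syzygy M P (Suc j)) (Suc j)\<^esub> e = \<zero>\<^bsub>Ext R P (syzygy M P (Suc j)) (Suc j)\<^esub>"
begin

lemma cring_R: "cring R" by unfold_locales

lemma P_complex: "chain_complex R P"
  and P_neg: "i < 0 \<Longrightarrow> carrier (obj P i) = {\<zero>\<^bsub>obj P i\<^esub>}"
  and P_exact: "i > 0 \<Longrightarrow> cycles P i = boundaries P i"
  and \<epsilon>_hom: "\<epsilon> \<in> mod_hom R (obj P 0) M"
  and \<epsilon>_surj: "\<epsilon> ` carrier (obj P 0) = carrier M"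
  and \<epsilon>_ker: "mod_ker (obj P 0) M \<epsilon> = boundaries P 0"
  using res by (simp_all add: projective_resolution_def zero_module_def)

lemmas P_module = chain_complex_module[OF P_complex]
  and P_hom = chain_complex_hom[OF P_complex]

lemma diff_diff: "p \<in> carrier (obj P i) \<Longrightarrow> diff P (i - 1) (diff P i p) = \<zero>\<^bsub>obj P (i - 1 - 1)\<^esub>"
  using chain_complex_diff_diff[OF P_complex, of p i] by simp

lemma diff_closed: "p \<in> carrier (obj P i) \<Longrightarrow> diff P i p \<in> carrier (obj P (i - 1))"
  by (rule mod_hom_closed[OF P_hom])

lemma diff_Suc_closed: "q \<in> carrier (obj P (int j + 1)) \<Longrightarrow> diff P (int j + 1) q \<in> carrier (obj P (int j))"
  using diff_closed[of q "int j + 1"] by simp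

abbreviation "syz \<equiv> syzygy M P"

text \<open>The canonical surjection from \<open>P_j\<close> onto the \<open>j\<close>-th syzygy. A
  syzygy with \<open>j > 0\<close> is realised inside \<open>P_(j - 1)\<close>, so there the
  surjection is the differential itself.\<close>

definition cover :: "nat \<Rightarrow> 'm \<Rightarrow> 'm" where
  "cover j p = (if j = 0 then \<epsilon> p else diff P (int j) p)"

lemma syz_0: "syz 0 = M"
  by (simp add: syzygy_def)

lemma syz_Suc: "syz (Suc j) = (obj P (int j))\<lparr>carrier := diff P (int j + 1) ` carrier (obj P (int j + 1))\<rparr>"
  by (simp add: syzygy_def add.commute)

lemma cover_0: "cover 0 = \<epsilon>" and cover_Suc: "cover (Suc j) = diff P (int j + 1)"
  by (auto simp: cover_def add.commute)

lemma syz_module: "module R (syz j)"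
proof (cases j)
  case 0
  then show ?thesis by (simp add: syz_0 M.module_axioms)
next
  case (Suc k)
  have "submodule (boundaries P (int k)) R (obj P (int k))" by (rule submodule_boundaries[OF P_complex])
  then show ?thesis
    unfolding Suc syz_Suc boundaries_def using submodule.submodule_is_module P_module by blast
qed

lemma cover_hom: "cover j \<in> mod_hom R (obj P (int j)) (syz j)"
proof (cases j)
  case 0
  then show ?thesis by (simp add: syz_0 cover_0 \<epsilon>_hom)
next
  case (Suc k)
  have h: "diff P (int k + 1) \<in> mod_hom R (obj P (int k + 1)) (obj P (int k))"
    using P_hom[of "int k + 1"] by simp
  have "diff P (int k + 1) \<in> mod_hom R (obj P (int k + 1)) (syz (Suc k))"
    unfolding syz_Suc by (rule mod_homI) (simp_all add: mod_hom_add[OF h] mod_hom_smult[OF h])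
  then show ?thesis unfolding Suc cover_Suc by (simp add: add.commute)
qed

lemma cover_surj: "cover j ` carrier (obj P (int j)) = carrier (syz j)"
proof (cases j)
  case 0
  then show ?thesis by (simp add: syz_0 cover_0 \<epsilon>_surj)
next
  case (Suc k)
  then show ?thesis unfolding Suc cover_Suc syz_Suc by (simp add: add.commute)
qed

lemma cover_ker:
  assumes "p \<in> carrier (obj P (int j))" "cover j p = \<zero>\<^bsub>syz j\<^esub>"
  shows "\<exists>q\<in>carrier (obj P (int j + 1)). diff P (int j + 1) q = p"
proof -
  have "p \<in> boundaries P (int j)"
  proof (cases j)
    case 0
    then have "p \<in> mod_ker (obj P 0) M \<epsilon>" using assms by (simp add: mod_ker_def syz_0 cover_0)
    then show ?thesis using 0 by (simp add: \<epsilon>_ker)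
  next
    case (Suc k)
    then have "p \<in> cycles P (int j)"
      using assms by (simp add: cycles_def mod_ker_def syz_Suc cover_Suc add.commute)
    then show ?thesis using P_exact[of "int j"] Suc by simp
  qed
  then show ?thesis by (auto simp: boundaries_def)
qed

lemma cover_diff:
  assumes "q \<in> carrier (obj P (int j + 1))"
  shows "cover j (diff P (int j + 1) q) = \<zero>\<^bsub>syz j\<^esub>"
proof (cases j)
  case 0
  have "diff P (int j + 1) q \<in> boundaries P 0" using assms 0 by (auto simp: boundaries_def)
  then have "diff P (int j + 1) q \<in> mod_ker (obj P 0) M \<epsilon>" by (simp only: \<epsilon>_ker)
  then show ?thesis using 0 by (simp add: syz_0 cover_0 mod_ker_def)
next
  case (Suc k)
  then show ?thesis
    using diff_diff[OF assms] by (simp add: syz_Suc cover_Suc add.commute)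
qed

text \<open>Lets the differential descend to the syzygy. For \<open>j = 0\<close> the cover is the
  augmentation and not the differential, hence the detour through a preimage in degree
  \<open>j + 1\<close>.\<close>

lemma diff_eq_zero:
  assumes p: "p \<in> carrier (obj P (int j))" and "cover j p = \<zero>\<^bsub>syz j\<^esub>"
  shows "diff P (int j) p = \<zero>\<^bsub>obj P (int j - 1)\<^esub>"
proof -
  from cover_ker[OF assms] obtain q where q: "q \<in> carrier (obj P (int j + 1))" "p = diff P (int j + 1) q"
    by auto
  show ?thesis unfolding q(2) using diff_diff[OF q(1)] by simp
qed

text \<open>The class of \<open>P\<^sub>j\<^sub>+\<^sub>1 \<rightarrow> \<Omega>\<^sup>j\<^sup>+\<^sup>1\<close> in \<open>Ext\<^sup>j\<^sup>+\<^sup>1(M, \<Omega>\<^sup>j\<^sup>+\<^sup>1)\<close> is annihilated by \<open>x s\<close>.\<close>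

lemma scaled_diff_extends:
  assumes s: "s \<in> {1..n}" "j < s"
  shows "\<exists>g\<in>mod_hom R (obj P (int j)) (syz (Suc j)). \<forall>q\<in>carrier (obj P (int j + 1)).
    g (diff P (int j + 1) q) = x s \<odot>\<^bsub>obj P (int j)\<^esub> diff P (int j + 1) q"
proof -
  let ?N = "syz (Suc j)" and ?A = "obj P (int j + 1)"
  define H where "H = hom_cplx R P ?N"
  \<comment> \<open>The complex of homomorphisms is graded homologically, so cochains of degree
    \<open>j + 1\<close> sit in degree \<open>-(j + 1)\<close>.\<close>
  define i where "i = - int (Suc j)"
  \<comment> \<open>Elements of \<open>hom_module\<close> are undefined outside the carrier, hence
    the restriction.\<close>
  define \<phi> where "\<phi> = restrict (diff P (int j + 1)) (carrier ?A)"
  interpret N: module R ?N by (rule syz_module)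
  interpret A: module R ?A by (rule P_module)
  interpret Pj: module R "obj P (int j)" by (rule P_module)
  have mi: "- i = int j + 1" "1 - i = int j + 1 + 1" "- (i - 1) = int j + 1 + 1" "- (i + 1) = int j"
    "1 - (i + 1) = int j + 1"
    by (simp_all add: i_def)
  have h: "diff P (int j + 1) \<in> mod_hom R ?A ?N" using cover_hom[of "Suc j"] by (simp add: cover_Suc add.commute)
  note hc = mod_hom_closed[OF h]
  have \<phi>_hom: "\<phi> \<in> mod_hom R ?A ?N"
    by (rule mod_hom_cong[OF h P_module]) (simp add: \<phi>_def)
  have obj_H: "obj H i = hom_module R ?A ?N" "obj H (i + 1) = hom_module R (obj P (int j)) ?N"
    "obj H (i - 1) = hom_module R (obj P (int j + 1 + 1)) ?N"
    by (simp_all add: H_def hom_cplx_def mi del: minus_add_distrib minus_diff_eq)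
  have diff_H: "diff H i = (\<lambda>f. \<lambda>y\<in>carrier (obj P (int j + 1 + 1)). f (diff P (int j + 1 + 1) y))"
    "diff H (i + 1) = (\<lambda>f. \<lambda>y\<in>carrier ?A. f (diff P (int j + 1) y))"
    by (simp_all only: H_def hom_cplx_def mi cplx.simps)
  have zero_N: "\<zero>\<^bsub>?N\<^esub> = \<zero>\<^bsub>obj P (int j)\<^esub>" by (simp add: syz_Suc)
  have add_N: "a \<oplus>\<^bsub>?N\<^esub> b = a \<oplus>\<^bsub>obj P (int j)\<^esub> b" for a b by (simp add: syz_Suc)
  have smult_N: "r \<odot>\<^bsub>?N\<^esub> b = r \<odot>\<^bsub>obj P (int j)\<^esub> b" for r b by (simp add: syz_Suc)
  have "diff H i \<phi> = \<zero>\<^bsub>obj H (i - 1)\<^esub>"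
    unfolding diff_H obj_H
  proof -
    have "\<phi> (diff P (int j + 1 + 1) y) = \<zero>\<^bsub>?N\<^esub>" if y: "y \<in> carrier (obj P (int j + 1 + 1))" for y
    proof -
      have e: "int j + 1 + 1 - 1 = int j + 1" "int j + 1 - 1 = int j" by simp_all
      show ?thesis
        unfolding \<phi>_def zero_N
        by (simp only: restrict_apply diff_closed[OF y, unfolded e] diff_diff[OF y, unfolded e] if_True)
    qed
    then show "(\<lambda>y\<in>carrier (obj P (int j + 1 + 1)). \<phi> (diff P (int j + 1 + 1) y))
        = \<zero>\<^bsub>hom_module R (obj P (int j + 1 + 1)) ?N\<^esub>"
      by (simp add: hom_module_def cong: restrict_cong)
  qed
  then have cyc: "\<phi> \<in> cycles H i"
    using \<phi>_hom by (simp add: cycles_def mod_ker_def obj_H hom_module_def \<phi>_def)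
  have Ext_eq: "Ext R P ?N (Suc j) = homology H i" by (simp add: Ext_def H_def i_def)
  let ?B = "boundaries H i" and ?O = "obj H i"
  have e: "?B +>\<^bsub>?O\<^esub> \<phi> \<in> carrier (homology H i)"
    unfolding homology_carrier using cyc by (rule imageI)
  have z: "\<zero>\<^bsub>?O\<^esub> \<in> ?B"
  proof -
    have "diff H (i + 1) \<zero>\<^bsub>obj H (i + 1)\<^esub> = \<zero>\<^bsub>?O\<^esub>"
      unfolding diff_H obj_H using diff_Suc_closed
      by (simp add: hom_module_def cong: restrict_cong)
    moreover have "\<zero>\<^bsub>obj H (i + 1)\<^esub> \<in> carrier (obj H (i + 1))"
      unfolding obj_H by (auto simp: hom_module_def intro!: mod_homI)
    ultimately show ?thesis unfolding boundaries_def by (metis imageI)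
  qed
  have "\<zero>\<^bsub>?O\<^esub> \<oplus>\<^bsub>?O\<^esub> \<phi> = \<phi>"
    unfolding obj_H using hc by (simp add: hom_module_def \<phi>_def cong: restrict_cong)
  then have \<phi>e: "\<phi> \<in> ?B +>\<^bsub>?O\<^esub> \<phi>" using z unfolding a_r_coset_def' by force
  \<comment> \<open>Members of a coset have the form \<open>h + a\<close> with \<open>h\<close> a
    boundary. With \<open>h = 0\<close>, this is the representative \<open>x s\<close> times
    \<open>\<phi>\<close> of the multiple of the class of \<open>\<phi>\<close>. Since that multiple
    is the zero class, whose underlying set is the boundaries themselves, \<open>\<psi>\<close> is
    the image of some \<open>g\<close>.\<close>
  let ?\<psi> = "\<zero>\<^bsub>?O\<^esub> \<oplus>\<^bsub>?O\<^esub> (x s \<odot>\<^bsub>?O\<^esub> \<phi>)"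
  have "?\<psi> \<in> x s \<odot>\<^bsub>homology H i\<^esub> (?B +>\<^bsub>?O\<^esub> \<phi>)"
    using \<phi>e z unfolding homology_def quot_module_def by (force simp: a_r_coset_def')
  moreover have "x s \<odot>\<^bsub>homology H i\<^esub> (?B +>\<^bsub>?O\<^esub> \<phi>) = ?B"
    using Ext_zero[OF s, unfolded Ext_eq, OF e] by (simp add: homology_def quot_module_def)
  ultimately have "?\<psi> \<in> ?B" by simp
  then obtain g where g: "g \<in> carrier (obj H (i + 1))" "?\<psi> = diff H (i + 1) g"
    unfolding boundaries_def by (elim imageE)
  have g_hom: "g \<in> mod_hom R (obj P (int j)) ?N" using g(1) by (simp add: obj_H hom_module_def)
  have "g (diff P (int j + 1) q) = x s \<odot>\<^bsub>obj P (int j)\<^esub> diff P (int j + 1) q" if q: "q \<in> carrier ?A" for q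
  proof -
    have "g (diff P (int j + 1) q) = ?\<psi> q" unfolding g(2) diff_H using q by simp
    also have "\<dots> = \<zero>\<^bsub>?N\<^esub> \<oplus>\<^bsub>?N\<^esub> (x s \<odot>\<^bsub>?N\<^esub> diff P (int j + 1) q)"
      unfolding obj_H using q by (simp add: hom_module_def \<phi>_def)
    also have "\<dots> = x s \<odot>\<^bsub>?N\<^esub> diff P (int j + 1) q"
      by (rule N.l_zero[OF N.smult_closed[OF x_closed[OF s(1)] hc[OF q]]])
    finally show ?thesis by (simp only: smult_N)
  qed
  then show ?thesis using g_hom by blast
qed

text \<open>Take \<open>u = x s - g\<close> with \<open>g\<close> from
  \<open>scaled_diff_extends\<close>. The values of \<open>g\<close> are boundaries, which
  \<open>cover j\<close> kills, so \<open>u\<close> lifts multiplication by \<open>x s\<close>. On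
  the kernel of \<open>cover j\<close>, which consists of boundaries, \<open>g\<close> is itself
  multiplication by \<open>x s\<close>, so \<open>u\<close> vanishes there.\<close>

lemma lift_exists:
  assumes s: "s \<in> {1..n}" "j < s"
  shows "\<exists>u. u \<in> mod_hom R (obj P (int j)) (obj P (int j)) \<and>
    (\<forall>p\<in>carrier (obj P (int j)). cover j (u p) = x s \<odot>\<^bsub>syz j\<^esub> cover j p \<and>
      (cover j p = \<zero>\<^bsub>syz j\<^esub> \<longrightarrow> u p = \<zero>\<^bsub>obj P (int j)\<^esub>))"
proof -
  let ?A = "obj P (int j)"
  interpret A: module R ?A by (rule P_module)
  interpret N: module R "syz j" by (rule syz_module)
  from scaled_diff_extends[OF s] obtain g where g: "g \<in> mod_hom R ?A (syz (Suc j))"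
    and gd: "\<And>q. q \<in> carrier (obj P (int j + 1)) \<Longrightarrow>
      g (diff P (int j + 1) q) = x s \<odot>\<^bsub>?A\<^esub> diff P (int j + 1) q" by (elim bexE) blast
  have g_im: "\<exists>q\<in>carrier (obj P (int j + 1)). g p = diff P (int j + 1) q" if "p \<in> carrier ?A" for p
    using mod_hom_closed[OF g that] unfolding syz_Suc by auto
  have gc: "g p \<in> carrier ?A" if "p \<in> carrier ?A" for p
    using g_im[OF that] diff_Suc_closed by auto
  have g_hom: "g \<in> mod_hom R ?A ?A"
    by (rule mod_homI) (simp_all add: gc mod_hom_add[OF g] mod_hom_smult[OF g], simp_all add: syz_Suc)
  have xs: "x s \<in> carrier R" by (rule x_closed[OF s(1)])
  define u where "u p = x s \<odot>\<^bsub>?A\<^esub> p \<ominus>\<^bsub>?A\<^esub> g p" for p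
  have u: "u \<in> mod_hom R ?A ?A"
    unfolding u_def[abs_def]
    by (rule mod_hom_diff_map[OF P_module P_module mod_hom_smult_map[OF P_module P_module mod_hom_id xs] g_hom])
  moreover have "cover j (u p) = x s \<odot>\<^bsub>syz j\<^esub> cover j p" if p: "p \<in> carrier ?A" for p
  proof -
    from g_im[OF p] obtain q where q: "q \<in> carrier (obj P (int j + 1))" "g p = diff P (int j + 1) q"
      by (elim bexE)
    have "cover j (u p) = cover j (x s \<odot>\<^bsub>?A\<^esub> p) \<ominus>\<^bsub>syz j\<^esub> cover j (g p)"
      unfolding u_def by (rule mod_hom_minus[OF P_module syz_module cover_hom A.smult_closed[OF xs p] gc[OF p]])
    also have "\<dots> = x s \<odot>\<^bsub>syz j\<^esub> cover j p"
      unfolding q(2) cover_diff[OF q(1)] mod_hom_smult[OF cover_hom xs p]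
      using xs mod_hom_closed[OF cover_hom p] by (simp add: N.minus_eq)
    finally show ?thesis .
  qed
  moreover have "u p = \<zero>\<^bsub>?A\<^esub>" if p: "p \<in> carrier ?A" "cover j p = \<zero>\<^bsub>syz j\<^esub>" for p
  proof -
    from cover_ker[OF p] obtain q where q: "q \<in> carrier (obj P (int j + 1))" "diff P (int j + 1) q = p"
      by (elim bexE)
    have "g p = x s \<odot>\<^bsub>?A\<^esub> p" using gd[OF q(1)] unfolding q(2) .
    then show ?thesis using xs p by (simp add: u_def A.minus_eq A.r_neg)
  qed
  ultimately show ?thesis by blast
qed

definition u :: "nat \<Rightarrow> nat \<Rightarrow> 'm \<Rightarrow> 'm" where
  "u s j = (SOME u. u \<in> mod_hom R (obj P (int j)) (obj P (int j)) \<and>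
    (\<forall>p\<in>carrier (obj P (int j)). cover j (u p) = x s \<odot>\<^bsub>syz j\<^esub> cover j p \<and>
      (cover j p = \<zero>\<^bsub>syz j\<^esub> \<longrightarrow> u p = \<zero>\<^bsub>obj P (int j)\<^esub>)))"

lemma
  assumes "s \<in> {1..n}" "j < s"
  shows u_hom: "u s j \<in> mod_hom R (obj P (int j)) (obj P (int j))"
    and cover_u: "\<And>p. p \<in> carrier (obj P (int j)) \<Longrightarrow> cover j (u s j p) = x s \<odot>\<^bsub>syz j\<^esub> cover j p"
    and u_ker: "\<And>p. p \<in> carrier (obj P (int j)) \<Longrightarrow> cover j p = \<zero>\<^bsub>syz j\<^esub> \<Longrightarrow>
      u s j p = \<zero>\<^bsub>obj P (int j)\<^esub>"
  using someI_ex[OF lift_exists[OF assms]] unfolding u_def[symmetric] by blast+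

end

section \<open>The cube of syzygies\<close>

text \<open>With \<open>j = i - 1 - card T\<close>, \<open>defect T s i\<close> decides which map \<open>P\<^sub>j \<rightarrow> P\<^sub>j\<close> is used to remove \<open>s\<close>
  from \<open>insert s T\<close> in degree \<open>i\<close>.\<close>

definition defect :: "nat set \<Rightarrow> nat \<Rightarrow> int \<Rightarrow> int" where
  "defect T s i = int s + int (card {t \<in> T. s < t}) - i"

section \<open>Arithmetic of the defect\<close>

lemma defect_pred: "defect T s (i - 1) = defect T s i + 1"
  by (simp add: defect_def)

lemma card_split:
  fixes T :: "nat set"
  assumes "finite T" "s \<notin> T"
  shows "card T = card {t \<in> T. t < s} + card {t \<in> T. s < t}"
proof -
  have "T = {t \<in> T. t < s} \<union> {t \<in> T. s < t}" using assms(2) by (auto simp: not_less_iff_gr_or_eq)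
  then have "card T = card ({t \<in> T. t < s} \<union> {t \<in> T. s < t})" by simp
  also have "\<dots> = card {t \<in> T. t < s} + card {t \<in> T. s < t}"
    by (rule card_Un_disjoint) (use assms(1) in auto)
  finally show ?thesis .
qed

lemma card_below:
  fixes T :: "nat set"
  assumes "T \<subseteq> {1..n}" "1 \<le> s"
  shows "card {t \<in> T. t < s} < s"
proof -
  have "{t \<in> T. t < s} \<subseteq> {1..<s}" using assms(1) by auto
  then have "card {t \<in> T. t < s} \<le> card {1..<s}" by (intro card_mono) auto
  then show ?thesis using assms(2) by simp
qed

text \<open>Counting the elements below \<open>s\<close> exhibits the comparison of degrees behind
  the defect; counting those above \<open>s\<close>, as the definition does, makes its change under
  insertions evident.\<close>

lemma defect_eq:
  assumes "T \<subseteq> {1..n}" "s \<in> {1..n} - T"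
  shows "defect T s i = int s - int (card {t \<in> T. t < s}) - (i - int (card T))"
  using card_split[of T s] assms finite_subset[of T "{1..n}"] by (simp add: defect_def)

text \<open>At defect zero, \<open>i - 1 - card T\<close> equals \<open>s - 1\<close> minus the
  number of elements of \<open>T\<close> below \<open>s\<close>, which is at most
  \<open>s - 1\<close>. This is the range in which the lift \<open>u\<close> is available.\<close>

lemma defect_zero:
  assumes "T \<subseteq> {1..n}" "s \<in> {1..n} - T" "defect T s i = 0"
  shows "0 \<le> i - 1 - int (card T)" "i - 1 - int (card T) < int s"
  using defect_eq[OF assms(1,2), of i] assms(3) card_below[OF assms(1), of s] assms(2) by auto

lemma defect_insert_greater:
  assumes "s < t"
  shows "defect (insert s T) t i = defect T t i"
proof -
  have "{r \<in> insert s T. t < r} = {r \<in> T. t < r}" using assms by auto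
  then show ?thesis by (simp add: defect_def)
qed

lemma defect_insert_less:
  assumes "finite T" "t \<notin> T" "s < t"
  shows "defect (insert t T) s i = defect T s i + 1"
proof -
  have "{r \<in> insert t T. s < r} = insert t {r \<in> T. s < r}" using assms by auto
  then show ?thesis using assms by (simp add: defect_def)
qed

text \<open>As \<open>t \<notin> T\<close>, an element of \<open>T\<close> above \<open>s\<close> is
  above \<open>t\<close> or strictly between \<open>s\<close> and \<open>t\<close>; there are only
  \<open>t - s - 1\<close> places between.\<close>

lemma defect_mono:
  assumes "finite T" "s \<notin> T" "t \<notin> T" "s < t"
  shows "defect T s i + 1 \<le> defect T t i"
proof -
  have "{r \<in> T. s < r} \<subseteq> {r \<in> T. t < r} \<union> {s<..<t}" using assms(3) by (auto simp: not_less_iff_gr_or_eq)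
  then have "card {r \<in> T. s < r} \<le> card ({r \<in> T. t < r} \<union> {s<..<t})"
    using assms(1) by (intro card_mono) auto
  also have "\<dots> \<le> card {r \<in> T. t < r} + card {s<..<t}" by (rule card_Un_le)
  finally show ?thesis using assms(4) by (simp add: defect_def)
qed

section \<open>Multiplications, lifts and zero maps on the resolution\<close>

context ext_annihilated
begin

definition scl :: "nat \<Rightarrow> int \<Rightarrow> int \<Rightarrow> 'm \<Rightarrow> 'm" where
  "scl s c j p = (if 0 < c then x s \<odot>\<^bsub>obj P j\<^esub> p
     else if c = 0 then u s (nat j) p else \<zero>\<^bsub>obj P j\<^esub>)"

text \<open>The lift is used only at \<open>c = 0\<close>, and only there is the degree constrained;
  otherwise \<open>j\<close> may be any integer, including the negative degrees where the resolution
  is zero.\<close>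

definition admissible :: "nat \<Rightarrow> int \<Rightarrow> int \<Rightarrow> bool" where
  "admissible s c j \<longleftrightarrow> s \<in> {1..n} \<and> (c = 0 \<longrightarrow> 0 \<le> j \<and> j < int s)"

lemma admissible_zero: "admissible s 0 j \<Longrightarrow> \<exists>k. j = int k \<and> s \<in> {1..n} \<and> k < s"
  unfolding admissible_def by (rule exI[of _ "nat j"]) auto

lemma admissible_closed: "admissible s c j \<Longrightarrow> x s \<in> carrier R"
  unfolding admissible_def by (intro x_closed) auto

lemma scl_pos: "0 < c \<Longrightarrow> scl s c j p = x s \<odot>\<^bsub>obj P j\<^esub> p"
  and scl_zero: "scl s 0 (int k) p = u s k p"
  and scl_neg: "c < 0 \<Longrightarrow> scl s c j p = \<zero>\<^bsub>obj P j\<^esub>"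
  by (simp_all add: scl_def)

lemma scl_hom:
  assumes "admissible s c j"
  shows "scl s c j \<in> mod_hom R (obj P j) (obj P j)"
proof -
  consider "0 < c" | "c = 0" | "c < 0" by linarith
  then show ?thesis
  proof cases
    case 1
    show ?thesis
      by (rule mod_hom_cong[OF mod_hom_smult_map[OF P_module P_module mod_hom_id admissible_closed[OF assms]] P_module])
        (simp add: scl_pos[OF 1])
  next
    case 2
    with assms obtain k where k: "j = int k" "s \<in> {1..n}" "k < s" using admissible_zero by blast
    show ?thesis
      unfolding k(1) 2 by (rule mod_hom_cong[OF u_hom[OF k(2,3)] P_module]) (simp add: scl_zero)
  next
    case 3
    show ?thesis
      by (rule mod_hom_cong[OF mod_hom_const_zero[OF P_module] P_module]) (simp add: scl_neg[OF 3])
  qed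
qed

lemma scl_closed: "admissible s c j \<Longrightarrow> p \<in> carrier (obj P j) \<Longrightarrow> scl s c j p \<in> carrier (obj P j)"
  by (rule mod_hom_closed[OF scl_hom])

lemma scl_0: "admissible s c j \<Longrightarrow> scl s c j \<zero>\<^bsub>obj P j\<^esub> = \<zero>\<^bsub>obj P j\<^esub>"
  by (rule mod_hom_zero[OF P_module P_module scl_hom])

text \<open>The condition for descending to a syzygy. Multiplication by \<open>x s\<close> need not
  satisfy it, which is why \<open>c\<close> must not be positive.\<close>

lemma scl_ker:
  assumes "admissible s c (int k)" "c \<le> 0" "p \<in> carrier (obj P (int k))" "cover k p = \<zero>\<^bsub>syz k\<^esub>"
  shows "scl s c (int k) p = \<zero>\<^bsub>obj P (int k)\<^esub>"
proof (cases "c = 0")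
  case True
  then show ?thesis
    using admissible_zero[of s "int k"] assms(1) u_ker[OF _ _ assms(3,4)] by (auto simp: scl_zero)
next
  case False
  then show ?thesis using assms(2) by (simp add: scl_neg)
qed

lemma cover_scl:
  assumes "admissible s c (int k)" "0 \<le> c" "p \<in> carrier (obj P (int k))"
  shows "cover k (scl s c (int k) p) = x s \<odot>\<^bsub>syz k\<^esub> cover k p"
proof (cases "c = 0")
  case True
  then show ?thesis
    using admissible_zero[of s "int k"] assms(1) cover_u[OF _ _ assms(3)] by (auto simp: scl_zero)
next
  case False
  then have "0 < c" using assms(2) by simp
  then show ?thesis
    by (simp only: scl_pos mod_hom_smult[OF cover_hom admissible_closed[OF assms(1)] assms(3)])
qed

text \<open>Lowering the degree raises \<open>c\<close> by one, so from low to high degrees the maps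
  are multiplications, then one lift, then zero. Two squares have content: at \<open>c = 0\<close>
  the lift property gives \<open>d u = x d\<close>, and at \<open>c = -1\<close> the square commutes
  because \<open>u\<close> vanishes on boundaries.\<close>

lemma diff_scl:
  assumes a: "admissible s c j" "admissible s (c + 1) (j - 1)" and p: "p \<in> carrier (obj P j)"
  shows "diff P j (scl s c j p) = scl s (c + 1) (j - 1) (diff P j p)"
proof -
  have xs: "x s \<in> carrier R" by (rule admissible_closed[OF a(1)])
  note dp = diff_closed[OF p]
  consider "0 < c" | "c = 0" | "c = -1" | "c < -1" by linarith
  then show ?thesis
  proof cases
    case 1
    then have "0 < c + 1" by simp
    then show ?thesis using 1 by (simp only: scl_pos mod_hom_smult[OF P_hom xs p])
  next
    case 2
    then obtain k where k: "j = int k" "s \<in> {1..n}" "k < s" using admissible_zero a(1) by blast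
    have "diff P j (scl s c j p) = x s \<odot>\<^bsub>obj P (j - 1)\<^esub> diff P j p"
    proof (cases k)
      \<comment> \<open>In degree 0 the cover is the augmentation, so the lift property says nothing
        about the differential; but then the target of the differential is zero.\<close>
      case 0
      interpret Z: module R "obj P (j - 1)" by (rule P_module)
      have "carrier (obj P (j - 1)) = {\<zero>\<^bsub>obj P (j - 1)\<^esub>}" using P_neg 0 k(1) by simp
      moreover have "diff P j (scl s c j p) \<in> carrier (obj P (j - 1))"
        by (rule diff_closed[OF scl_closed[OF a(1) p]])
      moreover have "x s \<odot>\<^bsub>obj P (j - 1)\<^esub> diff P j p \<in> carrier (obj P (j - 1))"
        by (rule Z.smult_closed[OF xs dp])
      ultimately show ?thesis by simp
    next
      case (Suc m)
      have "cover k (scl s c j p) = x s \<odot>\<^bsub>syz k\<^esub> cover k p"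
        using cover_scl[of s c k p] a(1) 2 p k(1) by simp
      then show ?thesis unfolding Suc k(1) by (simp add: cover_def syzygy_def)
    qed
    then show ?thesis using 2 by (simp add: scl_pos)
  next
    case 3
    then obtain k where k: "j - 1 = int k" "s \<in> {1..n}" "k < s" using admissible_zero a(2) by auto
    then have j: "j = int k + 1" by simp
    have e: "int k + 1 - 1 = int k" by simp
    have "scl s (c + 1) (j - 1) (diff P j p) = \<zero>\<^bsub>obj P (j - 1)\<^esub>"
      unfolding j e
      by (rule scl_ker[OF a(2)[unfolded j e] _ dp[unfolded j e] cover_diff[OF p[unfolded j]]]) (simp add: 3)
    moreover have "diff P j (scl s c j p) = \<zero>\<^bsub>obj P (j - 1)\<^esub>"
      using 3 mod_hom_zero[OF P_module P_module P_hom] by (simp add: scl_neg)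
    ultimately show ?thesis by simp
  next
    case 4
    then show ?thesis using mod_hom_zero[OF P_module P_module P_hom] by (simp add: scl_neg)
  qed
qed

text \<open>The assumption \<open>a \<le> b\<close> leaves one critical case,
  \<open>a = b = 0\<close>, where the lift for \<open>s\<close> composed with the lift for
  \<open>t\<close> must equal \<open>x t\<close> times the lift for \<open>s\<close>: the lift for
  \<open>t\<close> differs from \<open>x t\<close> by a map into the kernel of the cover, on which
  the lift for \<open>s\<close> vanishes. For \<open>a < 0\<close> both sides are zero, and whenever
  \<open>b > 0\<close> linearity suffices.\<close>

lemma scl_scl:
  assumes ab: "a \<le> b" and adm: "admissible s a j" "admissible t b j" "admissible t (b + 1) j"
    and p: "p \<in> carrier (obj P j)"
  shows "scl s a j (scl t b j p) = scl t (b + 1) j (scl s a j p)"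
proof -
  interpret A: module R "obj P j" by (rule P_module)
  have xs: "x s \<in> carrier R" "x t \<in> carrier R"
    by (rule admissible_closed[OF adm(1)], rule admissible_closed[OF adm(2)])
  consider "0 < a" | "a = 0" "0 < b" | "a = 0" "b = 0" | "a < 0" using ab by linarith
  then show ?thesis
  proof cases
    case 1
    then have "0 < b" "0 < b + 1" using ab by simp_all
    then show ?thesis using 1 xs p by (simp add: scl_pos A.smult_assoc1[symmetric] M.R.m_comm)
  next
    case 2
    then have "0 < b + 1" by simp
    then show ?thesis
      using 2(2) by (simp only: scl_pos mod_hom_smult[OF scl_hom[OF adm(1)] xs(2) p])
  next
    case 3
    then obtain k where k: "j = int k" using admissible_zero adm(1) by blast
    interpret N: module R "syz k" by (rule syz_module)
    note p' = p[unfolded k]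
    have tp: "scl t b j p \<in> carrier (obj P j)" by (rule scl_closed[OF adm(2) p])
    have xp: "x t \<odot>\<^bsub>obj P j\<^esub> p \<in> carrier (obj P j)" by (rule A.smult_closed[OF xs(2) p])
    have "cover k (scl t b j p) = x t \<odot>\<^bsub>syz k\<^esub> cover k p"
      unfolding k by (rule cover_scl[OF adm(2)[unfolded k] _ p']) (simp add: 3)
    moreover have "cover k (x t \<odot>\<^bsub>obj P j\<^esub> p) = x t \<odot>\<^bsub>syz k\<^esub> cover k p"
      unfolding k by (rule mod_hom_smult[OF cover_hom xs(2) p'])
    ultimately have "cover k (scl t b j p \<ominus>\<^bsub>obj P j\<^esub> x t \<odot>\<^bsub>obj P j\<^esub> p) = \<zero>\<^bsub>syz k\<^esub>"
      using mod_hom_minus[OF P_module syz_module cover_hom tp[unfolded k] xp[unfolded k]]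
        N.smult_closed[OF xs(2) mod_hom_closed[OF cover_hom p']]
      by (simp add: k N.minus_eq N.r_neg)
    then have "scl s a j (scl t b j p \<ominus>\<^bsub>obj P j\<^esub> x t \<odot>\<^bsub>obj P j\<^esub> p) = \<zero>\<^bsub>obj P j\<^esub>"
      using scl_ker[OF adm(1)[unfolded k]] 3(1) A.minus_closed[OF tp xp] by (simp add: k)
    then have "scl s a j (scl t b j p) \<ominus>\<^bsub>obj P j\<^esub> scl s a j (x t \<odot>\<^bsub>obj P j\<^esub> p) = \<zero>\<^bsub>obj P j\<^esub>"
      by (simp only: mod_hom_minus[OF P_module P_module scl_hom[OF adm(1)] tp xp])
    then have "scl s a j (scl t b j p) = scl s a j (x t \<odot>\<^bsub>obj P j\<^esub> p)"
      by (rule module_eq_if_minus_zero[OF P_module scl_closed[OF adm(1) tp] scl_closed[OF adm(1) xp]])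
    also have "\<dots> = x t \<odot>\<^bsub>obj P j\<^esub> scl s a j p"
      by (rule mod_hom_smult[OF scl_hom[OF adm(1)] xs(2) p])
    finally show ?thesis using 3 by (simp add: scl_pos)
  next
    case 4
    then show ?thesis by (simp add: scl_neg scl_0[OF adm(3)])
  qed
qed

text \<open>Above degree \<open>n\<close> a zero module is built inside \<open>M\<close>, so that
  all modules share one element type. No case is made for degrees below \<open>card S\<close>, where
  the resolution vanishes anyway.\<close>

definition V :: "nat set \<Rightarrow> int \<Rightarrow> ('a, 'm) module" where
  "V S i = (if i < int n then obj P (i - int (card S))
     else if i = int n then syz (n - card S) else M\<lparr>carrier := {\<zero>\<^bsub>M\<^esub>}\<rparr>)"

text \<open>Presents \<open>V S i\<close> as a quotient of a term of the resolution in every degree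
  up to \<open>n\<close>, so that the top degree is treated together with the others: maps are
  described, and identities checked, on representatives. \<open>sec\<close> is a section of it as a
  map of sets.\<close>

definition rep :: "nat set \<Rightarrow> int \<Rightarrow> 'm \<Rightarrow> 'm" where
  "rep S i p = (if i < int n then p else cover (n - card S) p)"

definition sec :: "nat set \<Rightarrow> int \<Rightarrow> 'm \<Rightarrow> 'm" where
  "sec S i v = (SOME p. p \<in> carrier (obj P (i - int (card S))) \<and> rep S i p = v)"

definition \<delta> :: "nat set \<Rightarrow> int \<Rightarrow> 'm \<Rightarrow> 'm" where
  "\<delta> S i v = (if i \<le> int n then diff P (i - int (card S)) (sec S i v) else \<zero>\<^bsub>V S (i - 1)\<^esub>)"

definition \<gamma> :: "nat set \<Rightarrow> nat \<Rightarrow> int \<Rightarrow> 'm \<Rightarrow> 'm" where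
  "\<gamma> T s i v = (if i \<le> int n then scl s (defect T s i) (i - 1 - int (card T)) (sec (insert s T) i v)
     else \<zero>\<^bsub>V T (i - 1)\<^esub>)"

text \<open>In degree \<open>n\<close> the only relevant vertex is \<open>S = {1..n}\<close>, where
  the module is \<open>M\<close> itself; so the augmentation is the identity there.\<close>

definition \<eta> :: "int \<Rightarrow> 'm \<Rightarrow> 'm" where
  "\<eta> i v = (if i < int n then \<epsilon> v else v)"

lemma V_less: "i < int n \<Longrightarrow> V S i = obj P (i - int (card S))"
  and V_top: "V S (int n) = syz (n - card S)"
  and V_greater: "int n < i \<Longrightarrow> V S i = M\<lparr>carrier := {\<zero>\<^bsub>M\<^esub>}\<rparr>"
  by (simp_all add: V_def)

section \<open>The cube of resolutions and syzygies\<close>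

lemma V_pred: "i \<le> int n \<Longrightarrow> V S (i - 1) = obj P (i - int (card S) - 1)"
  by (simp add: V_def algebra_simps)

lemma zero_submodule: "module R (M\<lparr>carrier := {\<zero>\<^bsub>M\<^esub>}\<rparr>)"
proof (rule submodule.submodule_is_module)
  show "submodule {\<zero>\<^bsub>M\<^esub>} R M" by (rule M.submoduleI) auto
qed (rule M.module_axioms)

lemma V_module: "module R (V S i)"
  by (simp add: V_def P_module syz_module zero_submodule)

lemma card_le: "S \<subseteq> {1..n} \<Longrightarrow> card S \<le> n"
  using card_mono[of "{1..n}" S] by simp

lemma top_index: "S \<subseteq> {1..n} \<Longrightarrow> int n - int (card S) = int (n - card S)"
  using card_le by (simp add: of_nat_diff)

lemma rep_hom:
  assumes "S \<subseteq> {1..n}" "i \<le> int n"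
  shows "rep S i \<in> mod_hom R (obj P (i - int (card S))) (V S i)"
proof (cases "i < int n")
  case True
  then show ?thesis unfolding V_less[OF True] rep_def[abs_def] by (simp add: mod_hom_id)
next
  case False
  then have i: "i = int n" using assms(2) by simp
  have "rep S i = cover (n - card S)" using False by (auto simp: rep_def)
  then show ?thesis unfolding i V_top top_index[OF assms(1)] using cover_hom by simp
qed

lemma rep_surj:
  assumes "S \<subseteq> {1..n}" "i \<le> int n"
  shows "rep S i ` carrier (obj P (i - int (card S))) = carrier (V S i)"
proof (cases "i < int n")
  case True
  then show ?thesis unfolding V_less[OF True] rep_def[abs_def] by simp
next
  case False
  then have i: "i = int n" using assms(2) by simp
  have "rep S i = cover (n - card S)" using False by (auto simp: rep_def)
  then show ?thesis unfolding i V_top top_index[OF assms(1)] using cover_surj by simp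
qed

lemma sec:
  assumes "S \<subseteq> {1..n}" "i \<le> int n" "v \<in> carrier (V S i)"
  shows "sec S i v \<in> carrier (obj P (i - int (card S)))" "rep S i (sec S i v) = v"
proof -
  have "\<exists>p. p \<in> carrier (obj P (i - int (card S))) \<and> rep S i p = v"
    using rep_surj[OF assms(1,2)] assms(3) by (metis imageE)
  from someI_ex[OF this]
  show "sec S i v \<in> carrier (obj P (i - int (card S)))" "rep S i (sec S i v) = v"
    unfolding sec_def by simp_all
qed

text \<open>A map out of the resolution descends to \<open>V S i\<close>. Below degree
  \<open>n\<close> there is nothing to check; in degree \<open>n\<close> it has to vanish on the
  kernel of the cover.\<close>

lemma induced:
  assumes S: "S \<subseteq> {1..n}" "i \<le> int n" and L: "module R L"
    and H: "H \<in> mod_hom R (obj P (i - int (card S))) L"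
    and ker: "\<And>p. i = int n \<Longrightarrow> p \<in> carrier (obj P (int (n - card S))) \<Longrightarrow>
      cover (n - card S) p = \<zero>\<^bsub>syz (n - card S)\<^esub> \<Longrightarrow> H p = \<zero>\<^bsub>L\<^esub>"
  shows "(\<lambda>v. H (sec S i v)) \<in> mod_hom R (V S i) L"
    and "\<And>p. p \<in> carrier (obj P (i - int (card S))) \<Longrightarrow> H (sec S i (rep S i p)) = H p"
proof -
  have k: "H p = \<zero>\<^bsub>L\<^esub>" if p: "p \<in> carrier (obj P (i - int (card S)))" "rep S i p = \<zero>\<^bsub>V S i\<^esub>" for p
  proof (cases "i < int n")
    case True
    then have "p = \<zero>\<^bsub>obj P (i - int (card S))\<^esub>" using p(2) by (simp add: rep_def V_less)
    then show ?thesis using mod_hom_zero[OF P_module L H] by simp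
  next
    case False
    then have i: "i = int n" using S(2) by simp
    show ?thesis
    proof (rule ker[OF i])
      show "p \<in> carrier (obj P (int (n - card S)))" using p(1) unfolding i top_index[OF S(1)] .
      show "cover (n - card S) p = \<zero>\<^bsub>syz (n - card S)\<^esub>"
        using p(2) unfolding i V_top rep_def by (simp only: less_irrefl if_False)
    qed
  qed
  show "(\<lambda>v. H (sec S i v)) \<in> mod_hom R (V S i) L"
    by (rule induced_hom(1)[where sec = "sec S i", OF P_module V_module L rep_hom[OF S] H])
      (assumption | rule k sec[OF S])+
  show "H (sec S i (rep S i p)) = H p" if "p \<in> carrier (obj P (i - int (card S)))" for p
    by (rule induced_hom(2)[where sec = "sec S i", OF P_module V_module L rep_hom[OF S] H _ _ _ that])
      (assumption | rule k sec[OF S])+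
qed

lemma \<delta>_induced:
  assumes S: "S \<subseteq> {1..n}" "i \<le> int n"
  shows "\<delta> S i \<in> mod_hom R (V S i) (V S (i - 1))"
    and "\<And>p. p \<in> carrier (obj P (i - int (card S))) \<Longrightarrow> \<delta> S i (rep S i p) = diff P (i - int (card S)) p"
proof -
  let ?j = "i - int (card S)"
  have ker: "diff P ?j p = \<zero>\<^bsub>obj P (?j - 1)\<^esub>" if "i = int n" "p \<in> carrier (obj P (int (n - card S)))"
    "cover (n - card S) p = \<zero>\<^bsub>syz (n - card S)\<^esub>" for p
    using diff_eq_zero[OF that(2,3)] unfolding that(1) top_index[OF S(1)] .
  have ind1: "(\<lambda>v. diff P ?j (sec S i v)) \<in> mod_hom R (V S i) (obj P (?j - 1))"
    by (rule induced(1)[OF S P_module P_hom], rule ker)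
  have ind2: "diff P ?j (sec S i (rep S i p)) = diff P ?j p" if "p \<in> carrier (obj P ?j)" for p
    by (rule induced(2)[OF S P_module P_hom _ that], rule ker)
  show "\<delta> S i \<in> mod_hom R (V S i) (V S (i - 1))"
    unfolding V_pred[OF S(2)]
    by (rule mod_hom_cong[OF ind1 V_module]) (simp only: \<delta>_def S(2) if_True)
  show "\<delta> S i (rep S i p) = diff P ?j p" if "p \<in> carrier (obj P ?j)" for p
    using ind2[OF that] by (simp only: \<delta>_def S(2) if_True)
qed

lemma admissible_defect:
  assumes "T \<subseteq> {1..n}" "s \<in> {1..n} - T"
  shows "admissible s (defect T s i) (i - 1 - int (card T))"
  using defect_zero[OF assms, of i] assms(2) by (simp add: admissible_def)

lemma card_insert':
  assumes "T \<subseteq> {1..n}" "s \<in> {1..n} - T"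
  shows "i - int (card (insert s T)) = i - 1 - int (card T)"
  using assms finite_subset[of T "{1..n}"] by simp

lemma defect_top:
  assumes "T \<subseteq> {1..n}" "s \<in> {1..n} - T"
  shows "defect T s (int n) \<le> 0"
proof -
  have "{t \<in> T. s < t} \<subseteq> {s<..n}" using assms(1) by auto
  then have "card {t \<in> T. s < t} \<le> card {s<..n}" by (intro card_mono) auto
  moreover have "s \<le> n" using assms(2) by simp
  ultimately have "s + card {t \<in> T. s < t} \<le> n" unfolding card_greaterThanAtMost by linarith
  then show ?thesis by (simp add: defect_def)
qed

lemma \<gamma>_induced:
  assumes T: "T \<subseteq> {1..n}" "s \<in> {1..n} - T" and i: "i \<le> int n"
  shows "\<gamma> T s i \<in> mod_hom R (V (insert s T) i) (V T (i - 1))"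
    and "\<And>p. p \<in> carrier (obj P (i - 1 - int (card T))) \<Longrightarrow>
      \<gamma> T s i (rep (insert s T) i p) = scl s (defect T s i) (i - 1 - int (card T)) p"
proof -
  let ?S = "insert s T" and ?j = "i - 1 - int (card T)"
  note j = card_insert'[OF T] and adm = admissible_defect[OF T]
  have S: "?S \<subseteq> {1..n}" using T by auto
  have VT: "V T (i - 1) = obj P ?j" using V_pred[OF i, of T] by (simp add: algebra_simps)
  have H: "scl s (defect T s i) ?j \<in> mod_hom R (obj P (i - int (card ?S))) (obj P ?j)"
    unfolding j by (rule scl_hom[OF adm])
  have ker: "scl s (defect T s i) ?j p = \<zero>\<^bsub>obj P ?j\<^esub>"
    if "i = int n" "p \<in> carrier (obj P (int (n - card ?S)))"
      "cover (n - card ?S) p = \<zero>\<^bsub>syz (n - card ?S)\<^esub>" for p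
  proof -
    have e: "?j = int (n - card ?S)"
      using j[of i] that(1) top_index[OF S] by linarith
    show ?thesis
      unfolding e
    proof (rule scl_ker[OF _ _ that(2,3)])
      show "admissible s (defect T s i) (int (n - card ?S))" unfolding e[symmetric] by (rule adm)
      show "defect T s i \<le> 0" unfolding that(1) by (rule defect_top[OF T])
    qed
  qed
  have ind1: "(\<lambda>v. scl s (defect T s i) ?j (sec ?S i v)) \<in> mod_hom R (V ?S i) (obj P ?j)"
    by (rule induced(1)[OF S i P_module H], rule ker)
  have ind2: "scl s (defect T s i) ?j (sec ?S i (rep ?S i p)) = scl s (defect T s i) ?j p"
    if "p \<in> carrier (obj P ?j)" for p
    by (rule induced(2)[OF S i P_module H _ that[folded j]], rule ker)
  show "\<gamma> T s i \<in> mod_hom R (V ?S i) (V T (i - 1))"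
    unfolding VT by (rule mod_hom_cong[OF ind1 V_module]) (simp_all add: \<gamma>_def i)
  show "\<gamma> T s i (rep ?S i p) = scl s (defect T s i) ?j p" if "p \<in> carrier (obj P ?j)" for p
    using ind2[OF that] by (simp only: \<gamma>_def i if_True)
qed

lemma rep_less: "i < int n \<Longrightarrow> rep S i p = p"
  by (simp add: rep_def)

lemma \<delta>_less: "S \<subseteq> {1..n} \<Longrightarrow> i < int n \<Longrightarrow> v \<in> carrier (obj P (i - int (card S))) \<Longrightarrow>
    \<delta> S i v = diff P (i - int (card S)) v"
  using \<delta>_induced(2)[of S i v] by (simp add: rep_less)

lemma \<gamma>_less: "T \<subseteq> {1..n} \<Longrightarrow> s \<in> {1..n} - T \<Longrightarrow> i < int n \<Longrightarrow>
    v \<in> carrier (obj P (i - 1 - int (card T))) \<Longrightarrow>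
    \<gamma> T s i v = scl s (defect T s i) (i - 1 - int (card T)) v"
  using \<gamma>_induced(2)[of T s i v] by (simp add: rep_less)

lemma V_obtain_rep:
  assumes "S \<subseteq> {1..n}" "i \<le> int n" "v \<in> carrier (V S i)"
  obtains p where "p \<in> carrier (obj P (i - int (card S)))" "v = rep S i p"
  using that[OF sec(1)[OF assms] sec(2)[OF assms, symmetric]] .

lemma \<delta>_hom:
  assumes S: "S \<subseteq> {1..n}"
  shows "\<delta> S i \<in> mod_hom R (V S i) (V S (i - 1))"
proof (cases "i \<le> int n")
  case True
  then show ?thesis by (rule \<delta>_induced(1)[OF S])
next
  case False
  then show ?thesis
    by (intro mod_hom_cong[OF mod_hom_const_zero[OF V_module] V_module]) (simp add: \<delta>_def)
qed

lemma \<gamma>_hom: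
  assumes T: "T \<subseteq> {1..n}" "s \<in> {1..n} - T"
  shows "\<gamma> T s i \<in> mod_hom R (V (insert s T) i) (V T (i - 1))"
proof (cases "i \<le> int n")
  case True
  then show ?thesis by (rule \<gamma>_induced(1)[OF T])
next
  case False
  then show ?thesis
    by (intro mod_hom_cong[OF mod_hom_const_zero[OF V_module] V_module]) (simp add: \<gamma>_def)
qed

lemma zero_outside: "int n < i \<Longrightarrow> v \<in> carrier (V S i) \<Longrightarrow> v = \<zero>\<^bsub>V S i\<^esub>"
  by (simp add: V_greater)

lemma \<delta>_greater: "int n < i \<Longrightarrow> \<delta> S i v = \<zero>\<^bsub>V S (i - 1)\<^esub>"
  and \<gamma>_greater: "int n < i \<Longrightarrow> \<gamma> T s i v = \<zero>\<^bsub>V T (i - 1)\<^esub>"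
  by (simp_all add: \<delta>_def \<gamma>_def)

lemma \<delta>_\<delta>:
  assumes S: "S \<subseteq> {1..n}" and v: "v \<in> carrier (V S i)"
  shows "\<delta> S (i - 1) (\<delta> S i v) = \<zero>\<^bsub>V S (i - 1 - 1)\<^esub>"
proof (cases "i \<le> int n")
  case True
  let ?j = "i - int (card S)"
  obtain p where p: "p \<in> carrier (obj P ?j)" "v = rep S i p" by (rule V_obtain_rep[OF S True v])
  have j: "i - 1 - int (card S) = ?j - 1" by simp
  have l: "i - 1 < int n" "i - 1 \<le> int n" using True by simp_all
  have "\<delta> S (i - 1) (\<delta> S i v) = diff P (?j - 1) (diff P ?j p)"
    unfolding p(2) \<delta>_induced(2)[OF S True p(1)]
    by (rule \<delta>_less[OF S l(1), unfolded j]) (rule diff_closed[OF p(1)])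
  also have "\<dots> = \<zero>\<^bsub>V S (i - 1 - 1)\<^esub>"
    unfolding V_pred[OF l(2)] j by (rule diff_diff[OF p(1)])
  finally show ?thesis .
next
  case False
  then show ?thesis
    using mod_hom_zero[OF V_module V_module \<delta>_hom[OF S], of "i - 1"] by (simp only: \<delta>_greater not_le)
qed

text \<open>On a representative this is \<open>diff_scl\<close>, because the defect grows by one
  from degree \<open>i\<close> to degree \<open>i - 1\<close>.\<close>

lemma \<delta>_\<gamma>:
  assumes T: "T \<subseteq> {1..n}" "s \<in> {1..n} - T" and v: "v \<in> carrier (V (insert s T) i)"
  shows "\<delta> T (i - 1) (\<gamma> T s i v) = \<gamma> T s (i - 1) (\<delta> (insert s T) i v)"
proof -
  have S: "insert s T \<subseteq> {1..n}" using T by auto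
  show ?thesis
  proof (cases "i \<le> int n")
    case True
    let ?j = "i - 1 - int (card T)"
    note j = card_insert'[OF T, of i]
    obtain p where p': "p \<in> carrier (obj P (i - int (card (insert s T))))" "v = rep (insert s T) i p"
      by (rule V_obtain_rep[OF S True v])
    note p = p'(1)[unfolded j]
    have l: "i - 1 < int n" using True by simp
    have j1: "i - 1 - 1 - int (card T) = ?j - 1" by simp
    note adm = admissible_defect[OF T, of i] admissible_defect[OF T, of "i - 1", unfolded j1 defect_pred]
    have "\<delta> T (i - 1) (\<gamma> T s i v) = diff P ?j (scl s (defect T s i) ?j p)"
      unfolding p'(2) \<gamma>_induced(2)[OF T True p]
      by (rule \<delta>_less[OF T(1) l scl_closed[OF adm(1) p]])
    also have "\<dots> = scl s (defect T s i + 1) (?j - 1) (diff P ?j p)"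
      by (rule diff_scl[OF adm p])
    also have "\<dots> = \<gamma> T s (i - 1) (diff P ?j p)"
      by (rule \<gamma>_less[OF T l, unfolded j1 defect_pred, symmetric]) (rule diff_closed[OF p])
    also have "diff P ?j p = \<delta> (insert s T) i v"
      using \<delta>_induced(2)[OF S True p'(1)] unfolding p'(2) j by simp
    finally show ?thesis .
  next
    case False
    then show ?thesis
      using mod_hom_zero[OF V_module V_module \<delta>_hom[OF T(1)], of "i - 1"]
        mod_hom_zero[OF V_module V_module \<gamma>_hom[OF T], of "i - 1"]
      by (simp only: \<delta>_greater \<gamma>_greater not_le)
  qed
qed

text \<open>For \<open>s < t\<close>, inserting \<open>s\<close> does not change the defect of
  \<open>t\<close>, inserting \<open>t\<close> raises that of \<open>s\<close> by one, and passing
  to degree \<open>i - 1\<close> raises each by one. Therefore the two ways round the square are the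
  two sides of \<open>scl_scl\<close>, whose order condition is \<open>defect_mono\<close>.\<close>

lemma \<gamma>_\<gamma>_less:
  assumes T: "T \<subseteq> {1..n}" and s: "s \<in> {1..n} - T" and t: "t \<in> {1..n} - T" and st: "s < t"
    and v: "v \<in> carrier (V (insert s (insert t T)) i)"
  shows "\<gamma> T s (i - 1) (\<gamma> (insert s T) t i v) = \<gamma> T t (i - 1) (\<gamma> (insert t T) s i v)"
proof -
  have sT: "insert s T \<subseteq> {1..n}" "t \<in> {1..n} - insert s T"
    and tT: "insert t T \<subseteq> {1..n}" "s \<in> {1..n} - insert t T"
    using T s t st by auto
  have w: "insert s (insert t T) \<subseteq> {1..n}" using T s t by auto
  have finT: "finite T" using T finite_subset by blast
  show ?thesis
  proof (cases "i \<le> int n")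
    case True
    let ?j = "i - 1 - 1 - int (card T)" and ?a = "defect T s i + 1" and ?b = "defect T t i"
    have js: "i - 1 - int (card (insert s T)) = ?j" and jt: "i - 1 - int (card (insert t T)) = ?j"
      using s t finT by simp_all
    have l: "i - 1 < int n" using True by simp
    obtain p where p: "p \<in> carrier (obj P (i - int (card (insert s (insert t T)))))"
      "v = rep (insert s (insert t T)) i p"
      by (rule V_obtain_rep[OF w True v])
    have pj: "p \<in> carrier (obj P ?j)" using p(1) unfolding card_insert'[OF tT] jt .
    have dt: "defect (insert s T) t i = ?b" by (rule defect_insert_greater[OF st])
    have ds: "defect (insert t T) s i = ?a" by (rule defect_insert_less[OF finT _ st]) (use t in simp)
    note as = admissible_defect[OF T s, of "i - 1", unfolded defect_pred]
      and at = admissible_defect[OF T t, of "i - 1", unfolded defect_pred]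
      and at' = admissible_defect[OF sT, of i, unfolded js dt]
    have "\<gamma> (insert s T) t i v = scl t ?b ?j p"
      unfolding p(2) insert_commute[of s t T]
      by (rule \<gamma>_induced(2)[OF sT True, unfolded js dt]) (rule pj)
    then have "\<gamma> T s (i - 1) (\<gamma> (insert s T) t i v) = scl s ?a ?j (scl t ?b ?j p)"
      using \<gamma>_less[OF T s l scl_closed[OF at' pj]] by (simp only: defect_pred)
    moreover have "\<gamma> (insert t T) s i v = scl s ?a ?j p"
      unfolding p(2) by (rule \<gamma>_induced(2)[OF tT True, unfolded jt ds]) (rule pj)
    then have "\<gamma> T t (i - 1) (\<gamma> (insert t T) s i v) = scl t (?b + 1) ?j (scl s ?a ?j p)"
      using \<gamma>_less[OF T t l scl_closed[OF as pj]] by (simp only: defect_pred)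
    moreover have "scl s ?a ?j (scl t ?b ?j p) = scl t (?b + 1) ?j (scl s ?a ?j p)"
      by (rule scl_scl[OF defect_mono[OF finT _ _ st] as at' at pj]) (use s t in simp_all)
    ultimately show ?thesis by simp
  next
    case False
    then show ?thesis
      using mod_hom_zero[OF V_module V_module \<gamma>_hom[OF T s], of "i - 1"]
        mod_hom_zero[OF V_module V_module \<gamma>_hom[OF T t], of "i - 1"]
      by (simp only: \<gamma>_greater not_le)
  qed
qed

lemma \<gamma>_\<gamma>:
  assumes T: "T \<subseteq> {1..n}" and s: "s \<in> {1..n} - T" and t: "t \<in> {1..n} - T" and st: "s \<noteq> t"
    and v: "v \<in> carrier (V (insert s (insert t T)) i)"
  shows "\<gamma> T s (i - 1) (\<gamma> (insert s T) t i v) = \<gamma> T t (i - 1) (\<gamma> (insert t T) s i v)"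
proof (cases "s < t")
  case True
  then show ?thesis by (rule \<gamma>_\<gamma>_less[OF T s t _ v])
next
  case False
  then have "t < s" using st by simp
  from \<gamma>_\<gamma>_less[OF T t s this] v show ?thesis unfolding insert_commute[of s t T] by simp
qed

section \<open>The augmentation to \<open>M\<close>\<close>

lemma \<eta>_rep:
  assumes "S \<in> koszul_index n i"
  shows "\<eta> i (rep S i p) = \<epsilon> p"
proof (cases "i < int n")
  case True
  then show ?thesis by (simp add: \<eta>_def rep_def)
next
  case False
  then have "card S = n"
    using koszul_index_card[OF assms] card_le[OF koszul_index_subset[OF assms]] by simp
  then show ?thesis using False by (simp add: \<eta>_def rep_def cover_0)
qed

lemma koszul_index_le: "S \<in> koszul_index n i \<Longrightarrow> i \<le> int n"
  using koszul_index_card card_le[OF koszul_index_subset] by force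

lemma \<eta>_hom_surj:
  assumes S: "S \<in> koszul_index n i"
  shows "\<eta> i \<in> mod_hom R (V S i) M" and "\<eta> i ` carrier (V S i) = carrier M"
proof -
  have c: "int (card S) = i" by (rule koszul_index_card[OF S])
  consider "i < int n" | "i = int n" using koszul_index_le[OF S] by linarith
  then have "\<eta> i \<in> mod_hom R (V S i) M \<and> \<eta> i ` carrier (V S i) = carrier M"
  proof cases
    case 1
    have "V S i = obj P 0" "\<eta> i = \<epsilon>" using 1 c by (auto simp: V_less \<eta>_def)
    then show ?thesis using \<epsilon>_hom \<epsilon>_surj by simp
  next
    case 2
    have "\<eta> i = (\<lambda>v. v)" by (rule ext) (simp add: \<eta>_def 2)
    moreover have "V S i = M" using 2 c by (simp add: V_top syz_0)
    ultimately show ?thesis by (simp add: mod_hom_id)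
  qed
  then show "\<eta> i \<in> mod_hom R (V S i) M" "\<eta> i ` carrier (V S i) = carrier M" by simp_all
qed

lemma \<eta>_\<delta>:
  assumes S: "S \<in> koszul_index n (i - 1)" and v: "v \<in> carrier (V S i)"
  shows "\<eta> (i - 1) (\<delta> S i v) = \<zero>\<^bsub>M\<^esub>"
proof (cases "i \<le> int n")
  case True
  note S' = koszul_index_subset[OF S]
  have j: "i - int (card S) = int 0 + 1" using koszul_index_card[OF S] by simp
  obtain p where p: "p \<in> carrier (obj P (i - int (card S)))" "v = rep S i p"
    by (rule V_obtain_rep[OF S' True v])
  have "\<eta> (i - 1) (\<delta> S i v) = \<epsilon> (diff P (int 0 + 1) p)"
    unfolding p(2) \<delta>_induced(2)[OF S' True p(1)] j using True by (simp add: \<eta>_def)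
  also have "\<dots> = \<zero>\<^bsub>M\<^esub>" using cover_diff[OF p(1)[unfolded j]] by (simp only: cover_0 syz_0)
  finally show ?thesis .
next
  case False
  then show ?thesis
    using mod_hom_zero[OF V_module M.module_axioms \<eta>_hom_surj(1)[OF S]] by (simp only: \<delta>_greater not_le)
qed

text \<open>The summand concerned is \<open>P_0\<close>. There the defect is \<open>s - 1\<close>
  minus the number of elements of \<open>T\<close> below \<open>s\<close>, hence nonnegative, so the
  map is multiplication by \<open>x s\<close> or a lift of it; both are compatible with the
  augmentation.\<close>

lemma \<eta>_\<gamma>:
  assumes T: "T \<in> koszul_index n (i - 1)" and s: "s \<in> {1..n} - T"
    and v: "v \<in> carrier (V (insert s T) i)"
  shows "\<eta> (i - 1) (\<gamma> T s i v) = x s \<odot>\<^bsub>M\<^esub> \<eta> i v"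
proof -
  note T' = koszul_index_subset[OF T] and w = koszul_index_insert[OF T s]
  have i: "i \<le> int n" by (rule koszul_index_le[OF w])
  have j: "i - 1 - int (card T) = int 0" using koszul_index_card[OF T] by simp
  obtain p where p: "p \<in> carrier (obj P (i - int (card (insert s T))))" "v = rep (insert s T) i p"
    by (rule V_obtain_rep[OF koszul_index_subset[OF w] i v])
  note p0 = p(1)[unfolded card_insert'[OF T' s] j]
  have nn: "0 \<le> defect T s i"
    using defect_eq[OF T' s, of i] card_below[OF T', of s] s koszul_index_card[OF T] by simp
  have "\<gamma> T s i v = scl s (defect T s i) (int 0) p"
    unfolding p(2) by (rule \<gamma>_induced(2)[OF T' s i, unfolded j]) (rule p0)
  then have "\<eta> (i - 1) (\<gamma> T s i v) = cover 0 (scl s (defect T s i) (int 0) p)"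
    using i by (simp add: \<eta>_def cover_0)
  also have "\<dots> = x s \<odot>\<^bsub>syz 0\<^esub> cover 0 p"
    by (rule cover_scl[OF admissible_defect[OF T' s, of i, unfolded j] nn p0])
  also have "\<dots> = x s \<odot>\<^bsub>M\<^esub> \<eta> i v" unfolding p(2) \<eta>_rep[OF w] cover_0 syz_0 ..
  finally show ?thesis .
qed

section \<open>Exactness at each vertex of the cube\<close>

lemma boundary_lift:
  assumes S: "S \<subseteq> {1..n}" and i: "i < int n"
    and p: "p \<in> carrier (obj P (i - int (card S) + 1))"
    and \<epsilon>p: "S \<in> koszul_index n (i + 1) \<Longrightarrow> \<epsilon> p = \<zero>\<^bsub>M\<^esub>"
  shows "\<exists>w\<in>carrier (V S (i + 1)). \<delta> S (i + 1) w = diff P (i - int (card S) + 1) p \<and>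
      (S \<in> koszul_index n (i + 1) \<longrightarrow> \<eta> (i + 1) w = \<zero>\<^bsub>M\<^esub>)"
proof (intro bexI conjI impI)
  have i': "i + 1 \<le> int n" using i by simp
  have j: "i + 1 - int (card S) = i - int (card S) + 1" by simp
  \<comment> \<open>Choosing the preimage through \<open>rep\<close> also covers
    \<open>i + 1 = n\<close>, where it is the class of \<open>p\<close> in a syzygy.\<close>
  show "rep S (i + 1) p \<in> carrier (V S (i + 1))"
    by (rule mod_hom_closed[OF rep_hom[OF S i', unfolded j] p])
  show "\<delta> S (i + 1) (rep S (i + 1) p) = diff P (i - int (card S) + 1) p"
    by (rule \<delta>_induced(2)[OF S i', unfolded j]) (rule p)
  show "\<eta> (i + 1) (rep S (i + 1) p) = \<zero>\<^bsub>M\<^esub>" if "S \<in> koszul_index n (i + 1)"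
    unfolding \<eta>_rep[OF that] by (rule \<epsilon>p[OF that])
qed

text \<open>Below degree \<open>n\<close> this is exactness of the augmented resolution at
  \<open>i - card S\<close>; only at the value -1 does the preimage have to be checked against
  \<open>\<eta>\<close>, and there it is zero. In degree \<open>n\<close>, either
  \<open>S = {1..n}\<close> and \<open>\<eta>\<close> is the identity, or \<open>\<delta>\<close> is
  the inclusion of a syzygy into the preceding term, hence injective.\<close>

lemma exact:
  assumes S: "S \<subseteq> {1..n}" and v: "v \<in> carrier (V S i)" and dv: "\<delta> S i v = \<zero>\<^bsub>V S (i - 1)\<^esub>"
    and \<eta>v: "S \<in> koszul_index n i \<Longrightarrow> \<eta> i v = \<zero>\<^bsub>M\<^esub>"
  shows "\<exists>w\<in>carrier (V S (i + 1)). \<delta> S (i + 1) w = v \<and>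
      (S \<in> koszul_index n (i + 1) \<longrightarrow> \<eta> (i + 1) w = \<zero>\<^bsub>M\<^esub>)"
proof (cases "i < int n")
  case True
  let ?j = "i - int (card S)"
  have vP: "v \<in> carrier (obj P ?j)" using v by (simp only: V_less[OF True])
  have "diff P ?j v = \<delta> S i v" by (rule \<delta>_less[OF S True vP, symmetric])
  then have dP: "diff P ?j v = \<zero>\<^bsub>obj P (?j - 1)\<^esub>"
    using dv V_pred[of i S] True by simp
  have idx: "?j = -1" if "S \<in> koszul_index n (i + 1)" using koszul_index_card[OF that] by simp
  consider "?j < 0" | "?j = 0" | "0 < ?j" by linarith
  then show ?thesis
  proof cases
    case 1
    interpret Q: module R "obj P (?j + 1)" by (rule P_module)
    have "v = \<zero>\<^bsub>obj P ?j\<^esub>" using vP P_neg[OF 1] by simp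
    also have "\<dots> = diff P (?j + 1) \<zero>\<^bsub>obj P (?j + 1)\<^esub>"
      using mod_hom_zero[OF P_module P_module P_hom, of "?j + 1"] by simp
    finally have v0: "v = diff P (?j + 1) \<zero>\<^bsub>obj P (?j + 1)\<^esub>" .
    have e0: "\<epsilon> \<zero>\<^bsub>obj P (?j + 1)\<^esub> = \<zero>\<^bsub>M\<^esub>" if "S \<in> koszul_index n (i + 1)"
      using mod_hom_zero[OF P_module M.module_axioms \<epsilon>_hom] idx[OF that] by simp
    show ?thesis
      unfolding v0 by (rule boundary_lift[OF S True Q.zero_closed e0])
  next
    case 2
    then have "S \<in> koszul_index n i" using S by (simp add: koszul_index_def)
    then have "\<epsilon> v = \<zero>\<^bsub>M\<^esub>" using \<eta>v True by (simp add: \<eta>_def)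
    then have "cover 0 v = \<zero>\<^bsub>syz 0\<^esub>" by (simp add: cover_0 syz_0)
    from cover_ker[OF _ this] obtain q where q: "q \<in> carrier (obj P (?j + 1))" "diff P (?j + 1) q = v"
      using vP 2 by auto
    show ?thesis
      unfolding q(2)[symmetric] by (rule boundary_lift[OF S True q(1)]) (use idx 2 in simp)
  next
    case 3
    have "v \<in> cycles P ?j" using vP dP by (simp add: cycles_def mod_ker_def)
    then have "v \<in> boundaries P ?j" using P_exact[OF 3] by simp
    then obtain q where q: "q \<in> carrier (obj P (?j + 1))" "diff P (?j + 1) q = v"
      by (auto simp: boundaries_def)
    show ?thesis
      unfolding q(2)[symmetric] by (rule boundary_lift[OF S True q(1)]) (use idx 3 in simp)
  qed
next
  case False
  have v0: "v = \<zero>\<^bsub>V S i\<^esub>"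
  proof (cases "i = int n")
    case True
    show ?thesis
    proof (cases "card S = n")
      case True
      then have "S \<in> koszul_index n i" using S \<open>i = int n\<close> by (simp add: koszul_index_def)
      then show ?thesis using \<eta>v True \<open>i = int n\<close> by (simp add: \<eta>_def V_top syz_0)
    next
      case False
      then have lt: "card S < n" using card_le[OF S] by simp
      then obtain k where k: "n - card S = Suc k" by (metis Suc_diff_Suc)
      have j: "i - int (card S) = int (Suc k)" using True lt k by linarith
      have le: "i \<le> int n" using True by simp
      obtain p where p: "p \<in> carrier (obj P (i - int (card S)))" "v = rep S i p"
        by (rule V_obtain_rep[OF S le v])
      \<comment> \<open>With \<open>n - card S > 0\<close> the cover is the differential, so
        \<open>v\<close> and \<open>\<delta> S i v\<close> are the same element.\<close>
      have vp: "v = diff P (i - int (card S)) p"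
        unfolding p(2) j using True k by (simp add: rep_def cover_def)
      also have "\<dots> = \<delta> S i v" unfolding p(2) by (rule \<delta>_induced(2)[OF S le p(1), symmetric])
      also have "\<dots> = \<zero>\<^bsub>obj P (i - int (card S) - 1)\<^esub>" unfolding dv V_pred[OF le] ..
      also have "\<dots> = \<zero>\<^bsub>V S i\<^esub>" using j by (simp add: True V_top k syz_Suc)
      finally show ?thesis .
    qed
  next
    case f: False
    then show ?thesis using zero_outside[OF _ v] False by simp
  qed
  interpret Q: module R "V S (i + 1)" by (rule V_module)
  have g: "int n < i + 1" using False by simp
  show ?thesis
  proof (intro bexI conjI impI)
    show "\<delta> S (i + 1) \<zero>\<^bsub>V S (i + 1)\<^esub> = v" unfolding \<delta>_greater[OF g] v0 by simp
    show "\<eta> (i + 1) \<zero>\<^bsub>V S (i + 1)\<^esub> = \<zero>\<^bsub>M\<^esub>" if "S \<in> koszul_index n (i + 1)"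
      using koszul_index_le[OF that] g by simp
  qed (rule Q.zero_closed)
qed

lemma koszul_cube: "koszul_cube R M x n V \<delta> \<gamma> \<eta>"
proof (intro koszul_cube.intro koszul_cube_axioms.intro)
  show "\<delta> S (i - 1) (\<delta> S i v) = \<zero>\<^bsub>V S (i - 2)\<^esub>" if "S \<subseteq> {1..n}" "v \<in> carrier (V S i)" for S i v
    using \<delta>_\<delta>[OF that] by simp
next
  fix S i v assume "S \<subseteq> {1..n}" "v \<in> carrier (V S i)" "\<delta> S i v = \<zero>\<^bsub>V S (i - 1)\<^esub>"
    "S \<in> koszul_index n i \<Longrightarrow> \<eta> i v = \<zero>\<^bsub>M\<^esub>"
  then show "\<exists>w\<in>carrier (V S (i + 1)). \<delta> S (i + 1) w = v \<and>
      (S \<in> koszul_index n (i + 1) \<longrightarrow> \<eta> (i + 1) w = \<zero>\<^bsub>M\<^esub>)"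
    by (rule exact)
qed (rule cring_R M.module_axioms V_module |
    (rule x_closed \<delta>_hom \<gamma>_hom \<delta>_\<gamma> \<gamma>_\<gamma> \<eta>_hom_surj \<eta>_\<delta> \<eta>_\<gamma>; assumption))+

end

section \<open>Indexing by multiplicities\<close>

lemma bij_betw_subsets_of_card:
  "\<exists>e. bij_betw e {..<n choose a} {S. S \<subseteq> {1..n} \<and> card S = a}"
proof -
  have fin: "finite {S. S \<subseteq> {1..n} \<and> card S = a}" by (rule finite_subset[of _ "Pow {1..n}"]) auto
  have "card {S. S \<subseteq> {1..n} \<and> card S = a} = n choose a" using n_subsets[of "{1..n}" a] by simp
  then show ?thesis
    using ex_bij_betw_nat_finite[OF fin] by (simp add: atLeast0LessThan)
qed

text \<open>The sets with \<open>m - j\<close> elements give the copies of the \<open>j\<close>-th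
  summand, and \<open>k\<close> numbers them. If \<open>m - j\<close> exceeds \<open>n\<close>, the
  binomial coefficient is zero and no pair arises.\<close>

lemma bij_betw_subsets_of_card_le:
  assumes e: "\<And>a. bij_betw (e a) {..<n choose a} {S. S \<subseteq> {1..n} \<and> card S = a}"
  shows "bij_betw (\<lambda>(j, k). e (m - j) k) {(j, k). j \<le> m \<and> k < n choose (m - j)}
    {S. S \<subseteq> {1..n} \<and> card S \<le> m}"
proof (rule bij_betw_byWitness[where f' = "\<lambda>S. (m - card S, inv_into {..<n choose card S} (e (card S)) S)"])
  have mem: "e a k \<subseteq> {1..n} \<and> card (e a k) = a" if "k < n choose a" for a k
    using bij_betwE[OF e[of a]] that by auto
  have inv1: "inv_into {..<n choose a} (e a) (e a k) = k" if "k < n choose a" for a k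
    using e[of a] that by (simp add: bij_betw_def)
  have inv2: "inv_into {..<n choose card S} (e (card S)) S < n choose card S
      \<and> e (card S) (inv_into {..<n choose card S} (e (card S)) S) = S" if "S \<subseteq> {1..n}" for S
  proof -
    have *: "S \<in> e (card S) ` {..<n choose card S}" using e[of "card S"] that by (simp add: bij_betw_def)
    show ?thesis using inv_into_into[OF *] f_inv_into_f[OF *] by simp
  qed
  show "\<forall>a\<in>{(j, k). j \<le> m \<and> k < n choose (m - j)}.
      (\<lambda>S. (m - card S, inv_into {..<n choose card S} (e (card S)) S)) (case a of (j, k) \<Rightarrow> e (m - j) k) = a"
    using mem inv1 by auto
  show "\<forall>S\<in>{S. S \<subseteq> {1..n} \<and> card S \<le> m}.
      (case (m - card S, inv_into {..<n choose card S} (e (card S)) S) of (j, k) \<Rightarrow> e (m - j) k) = S"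
    using inv2 by auto
  show "(\<lambda>(j, k). e (m - j) k) ` {(j, k). j \<le> m \<and> k < n choose (m - j)} \<subseteq> {S. S \<subseteq> {1..n} \<and> card S \<le> m}"
    using mem by auto
  show "(\<lambda>S. (m - card S, inv_into {..<n choose card S} (e (card S)) S)) ` {S. S \<subseteq> {1..n} \<and> card S \<le> m}
      \<subseteq> {(j, k). j \<le> m \<and> k < n choose (m - j)}"
    using inv2 by auto
qed

section \<open>The complex with the prescribed modules\<close>

context ext_annihilated
begin

definition target :: "int \<Rightarrow> ('a, nat \<times> nat \<Rightarrow> 'm) module" where
  "target i = (if 0 \<le> i \<and> i < int n
     then direct_sum {(j, k). j \<le> nat i \<and> k < n choose (nat i - j)} (\<lambda>(j, k). obj P (int j))
     else if i = int n
     then direct_sum {(j, k). j \<le> n \<and> k < n choose j} (\<lambda>(j, k). syz j)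
     else direct_sum {} (\<lambda>_. M))"

text \<open>In degree \<open>i < n\<close> the vertex \<open>S\<close> carries
  \<open>P_(i - card S)\<close>, which is zero when \<open>card S > i\<close>; so only sets with at
  most \<open>i\<close> elements remain. In degree \<open>n\<close> every subset of
  \<open>{1..n}\<close> remains. Outside \<open>0..n\<close> all modules of the cube are
  zero.\<close>

lemma target_reindex:
  "\<exists>I W B b. target i = direct_sum I W \<and> B \<subseteq> Pow {1..n} \<and> bij_betw b I B \<and>
    (\<forall>p\<in>I. W p = V (b p) i) \<and> (\<forall>S\<in>Pow {1..n} - B. carrier (V S i) = {\<zero>\<^bsub>V S i\<^esub>})"
proof -
  obtain e where e: "\<And>a. bij_betw (e a) {..<n choose a} {S. S \<subseteq> {1..n} \<and> card S = a}"
    using bij_betw_subsets_of_card by metis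
  define b where "b = (\<lambda>(j, k). e (nat i - j) k)"
  let ?I = "{(j, k). j \<le> nat i \<and> k < n choose (nat i - j)}"
  let ?B = "{S. S \<subseteq> {1..n} \<and> card S \<le> nat i}"
  have bij: "bij_betw b ?I ?B" unfolding b_def by (rule bij_betw_subsets_of_card_le[OF e])
  have card_b: "card (b (j, k)) = nat i - j" if "(j, k) \<in> ?I" for j k
    using bij_betwE[OF e[of "nat i - j"]] that by (auto simp: b_def)
  have outside: ?thesis if "i < 0 \<or> int n < i"
  proof (intro exI conjI)
    show "target i = direct_sum {} (\<lambda>_. M)" using that by (auto simp: target_def)
    show "{} \<subseteq> Pow {1..n}" by simp
    show "bij_betw b {} {}" by (simp add: bij_betw_def)
    show "\<forall>p\<in>{}. M = V (b p) i" by simp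
    show "\<forall>S\<in>Pow {1..n} - {}. carrier (V S i) = {\<zero>\<^bsub>V S i\<^esub>}"
    proof
      fix S
      show "carrier (V S i) = {\<zero>\<^bsub>V S i\<^esub>}"
      proof (cases "i < 0")
        case True
        then show ?thesis using P_neg[of "i - int (card S)"] by (simp add: V_less)
      next
        case False
        then show ?thesis using that by (simp add: V_greater)
      qed
    qed
  qed
  consider "i < 0 \<or> int n < i" | "0 \<le> i" "i < int n" | "i = int n" by linarith
  then show ?thesis
  proof cases
    case 1
    then show ?thesis by (rule outside)
  next
    case 2
    have v: "V (b (j, k)) i = obj P (int j)" if p: "(j, k) \<in> ?I" for j k
    proof -
      have "j \<le> nat i" using p by simp
      then have "i - int (nat i - j) = int j" using 2 by linarith
      then show ?thesis unfolding V_less[OF 2(2)] card_b[OF p] by (rule arg_cong)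
    qed
    show ?thesis
    proof (intro exI conjI)
      show "target i = direct_sum ?I (\<lambda>(j, k). obj P (int j))" using 2 by (simp only: target_def if_True simp_thms)
      show "?B \<subseteq> Pow {1..n}" by blast
      show "bij_betw b ?I ?B" by (rule bij)
      show "\<forall>p\<in>?I. (case p of (j, k) \<Rightarrow> obj P (int j)) = V (b p) i"
      proof
        fix p assume p: "p \<in> ?I"
        obtain j k where jk: "p = (j, k)" by (cases p)
        show "(case p of (j, k) \<Rightarrow> obj P (int j)) = V (b p) i"
          unfolding jk prod.case by (rule v[symmetric]) (rule p[unfolded jk])
      qed
      show "\<forall>S\<in>Pow {1..n} - ?B. carrier (V S i) = {\<zero>\<^bsub>V S i\<^esub>}"
      proof
        fix S assume "S \<in> Pow {1..n} - ?B"
        then have "i - int (card S) < 0" using 2 by (simp add: not_le) linarith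
        then show "carrier (V S i) = {\<zero>\<^bsub>V S i\<^esub>}" unfolding V_less[OF 2(2)] by (rule P_neg)
      qed
    qed
  next
    case 3
    have ni: "nat i = n" using 3 by simp
    \<comment> \<open>Sets with \<open>n - j\<close> elements carry the \<open>j\<close>-th syzygy;
      symmetry of the binomial coefficients gives the stated multiplicity.\<close>
    have I: "?I = {(j, k). j \<le> n \<and> k < n choose j}"
    proof -
      have "n choose (n - j) = n choose j" if "j \<le> n" for j using binomial_symmetric[OF that] by simp
      then show ?thesis unfolding ni by (intro Collect_cong) (auto split: prod.split)
    qed
    have v: "V (b (j, k)) i = syz j" if p: "(j, k) \<in> ?I" for j k
    proof -
      have "j \<le> nat i" using p by simp
      then have "n - card (b (j, k)) = j" unfolding card_b[OF p] ni by simp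
      then show ?thesis unfolding 3 V_top by simp
    qed
    show ?thesis
    proof (intro exI conjI)
      show "target i = direct_sum ?I (\<lambda>(j, k). syz j)" unfolding I using 3 by (simp add: target_def)
      show "?B \<subseteq> Pow {1..n}" by blast
      show "bij_betw b ?I ?B" by (rule bij)
      show "\<forall>p\<in>?I. (case p of (j, k) \<Rightarrow> syz j) = V (b p) i"
      proof
        fix p assume p: "p \<in> ?I"
        obtain j k where jk: "p = (j, k)" by (cases p)
        show "(case p of (j, k) \<Rightarrow> syz j) = V (b p) i"
          unfolding jk prod.case by (rule v[symmetric]) (rule p[unfolded jk])
      qed
      show "\<forall>S\<in>Pow {1..n} - ?B. carrier (V S i) = {\<zero>\<^bsub>V S i\<^esub>}"
        using card_le unfolding ni by blast
    qed
  qed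
qed

definition total :: "int \<Rightarrow> ('a, nat set \<Rightarrow> 'm) module" where
  "total i = direct_sum (Pow {1..n}) (\<lambda>S. V S i)"

text \<open>One predicate for both maps, so that they can be chosen in all degrees
  simultaneously.\<close>

definition mutually_inverse ::
    "int \<Rightarrow> ((nat \<times> nat \<Rightarrow> 'm) \<Rightarrow> nat set \<Rightarrow> 'm) \<Rightarrow> ((nat set \<Rightarrow> 'm) \<Rightarrow> nat \<times> nat \<Rightarrow> 'm) \<Rightarrow> bool"
  where
  "mutually_inverse i \<theta> \<theta>' \<longleftrightarrow>
    \<theta> \<in> mod_hom R (target i) (total i) \<and> \<theta>' \<in> mod_hom R (total i) (target i) \<and>
    (\<forall>y\<in>carrier (total i). \<theta> (\<theta>' y) = y) \<and> (\<forall>v\<in>carrier (target i). \<theta>' (\<theta> v) = v)"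

lemma target_iso: "module R (target i)" "\<exists>\<theta> \<theta>'. mutually_inverse i \<theta> \<theta>'"
proof -
  obtain I W B b where t: "target i = direct_sum I W" and B: "B \<subseteq> Pow {1..n}"
    and bij: "bij_betw b I B" and W: "\<forall>p\<in>I. W p = V (b p) i"
    and triv: "\<forall>S\<in>Pow {1..n} - B. carrier (V S i) = {\<zero>\<^bsub>V S i\<^esub>}"
    using target_reindex[of i] by (elim exE conjE)
  show "module R (target i)"
    unfolding t by (rule direct_sum_module[OF cring_R]) (simp add: W V_module)
  have fin: "finite (Pow {1..n})" by simp
  note r = direct_sum_reindex[where V = "\<lambda>S. V S i" and W = W, OF cring_R fin B bij
      bspec[OF W] V_module bspec[OF triv]]
  show "\<exists>\<theta> \<theta>'. mutually_inverse i \<theta> \<theta>'"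
    unfolding mutually_inverse_def t total_def
    by (intro exI conjI ballI) (rule r(1) r(2) r(3) r(4); assumption)+
qed

lemma koszul_quasi_iso:
  "\<exists>C F. obj C = target \<and> chain_complex R C \<and> quasi_iso R C (koszul R x n M) F"
proof -
  interpret Q: koszul_cube R M x n V \<delta> \<gamma> \<eta> by (rule koszul_cube)
  have Y: "Q.Y = total" by (rule ext) (simp add: Q.Y_def total_def)
  obtain \<theta> \<theta>' where \<theta>: "\<And>i. mutually_inverse i (\<theta> i) (\<theta>' i)"
    using target_iso(2) by metis
  note \<theta>s = \<theta>[unfolded mutually_inverse_def, folded Y]
  let ?C = "\<lparr>obj = target, diff = \<lambda>i v. \<theta>' (i - 1) (Q.d i (\<theta> i v))\<rparr>"
  have 1: "\<theta> i \<in> mod_hom R (target i) (Q.Y i)" and 2: "\<theta>' i \<in> mod_hom R (Q.Y i) (target i)"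
    and 3: "y \<in> carrier (Q.Y i) \<Longrightarrow> \<theta> i (\<theta>' i y) = y"
    and 4: "v \<in> carrier (target i) \<Longrightarrow> \<theta>' i (\<theta> i v) = v" for i y v
    using \<theta>s[of i] by simp_all
  have "chain_complex R ?C"
    by (rule Q.quasi_iso_koszul(1)[of target \<theta> \<theta>', OF target_iso(1) 1 2 3 4])
  moreover have "\<exists>F. quasi_iso R ?C (koszul R x n M) F"
    by (rule Q.quasi_iso_koszul(2)[of target \<theta> \<theta>', OF target_iso(1) 1 2 3 4])
  then obtain F where "quasi_iso R ?C (koszul R x n M) F" ..
  moreover have "obj ?C = target" by simp
  ultimately show ?thesis by (intro exI conjI)
qed

end

theorem theorem3p1:
  fixes R :: "('a, 'r) ring_scheme"
    and M :: "('a, 'm) module"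
    and P :: "('a, 'm) cplx"
    and \<epsilon> :: "'m \<Rightarrow> 'm"
    and x :: "nat \<Rightarrow> 'a"
    and n :: nat
  assumes "cring R" and "noetherian_ring R"
    and "module R M" and "fg_module R M"
    and "projective_resolution R M P \<epsilon>"
    and "\<And>i. i \<ge> 0 \<Longrightarrow> fg_module R (obj P i)"
    and "\<And>p. p \<in> {1..n} \<Longrightarrow> x p \<in> carrier R"
    and "\<And>p q r e. p \<in> {1..n} \<Longrightarrow> q \<in> {1..p} \<Longrightarrow> r \<in> {1..p} \<Longrightarrow>
           e \<in> carrier (Ext R P (syzygy M P r) q) \<Longrightarrow>
           x p \<odot>\<^bsub>Ext R P (syzygy M P r) q\<^esub> e = \<zero>\<^bsub>Ext R P (syzygy M P r) q\<^esub>"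
  shows "\<exists>C :: ('a, nat \<times> nat \<Rightarrow> 'm) cplx.
           chain_complex R C \<and>
           equivalent R (koszul R x n M) C \<and>
           (\<forall>i. i < 0 \<or> i > int n \<longrightarrow> zero_module (obj C i)) \<and>
           (\<forall>i<n. obj C (int i) =
              direct_sum {(j, k). j \<le> i \<and> k < n choose (i - j)} (\<lambda>(j, k). obj P (int j))) \<and>
           obj C (int n) =
              direct_sum {(j, k). j \<le> n \<and> k < n choose j} (\<lambda>(j, k). syzygy M P j)"
proof -
  \<comment> \<open>The hypothesis on Ext enters at \<open>q = r = Suc j\<close>, which lies in
    \<open>{1..s}\<close> because \<open>j < s\<close>.\<close>
  interpret ext_annihilated R M P \<epsilon> x n
  proof (intro ext_annihilated.intro ext_annihilated_axioms.intro)
    fix s j e assume "s \<in> {1..n}" "j < s" "e \<in> carrier (Ext R P (syzygy M P (Suc j)) (Suc j))"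
    then show "x s \<odot>\<^bsub>Ext R P (syzygy M P (Suc j)) (Suc j)\<^esub> e = \<zero>\<^bsub>Ext R P (syzygy M P (Suc j)) (Suc j)\<^esub>"
      by (intro assms(8)) simp_all
  qed (use assms in simp_all)
  obtain C F where C: "obj C = target" "chain_complex R C" "quasi_iso R C (koszul R x n M) F"
    using koszul_quasi_iso by blast
  have "equivalent R (koszul R x n M) C"
    using C(3) by (auto simp: equivalent_def quasi_linked_def)
  moreover have "zero_module (target i)" if "i < 0 \<or> i > int n" for i
    using that by (auto simp: target_def zero_module_def direct_sum_def)
  ultimately show ?thesis
    using C(2) by (intro exI[of _ C]) (simp add: C(1) target_def)
qed

end
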